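(* Let $t>0$ and $\varepsilon,\eta>0$. For all sufficiently small dyadic scales $\delta=2^{-n}$ the following holds. Let $\mathcal P$ be a $(\delta,t,\delta^{-\eta})$-set of $\delta$-cubes in $[0,1]^d$. Let $A$ be an oracle relative to which $\mathcal P$, $\delta$, $t$, $\varepsilon$ and $\eta$ are computable. Then for every $e\in\mathcal S^{d-1}$ with $$K^A_n(e)\ge(d-1)n-\varepsilon n,$$ the set $$\mathcal P_1:=\mathcal D_\delta\Big(\bigcup_{Q\in\mathcal P}\pi_{e^\perp}Q\Big)$$ contains a $(\delta,t',\delta^{-O(\varepsilon+\eta)})$-subset $\mathcal P_2$ in $\mathbb R^{d-1}$ with $t'=\min\{t,d-1\}$. Moreover, $$|\mathcal P_2|\gtrsim\delta^{-t'+O(\varepsilon+\eta)} .$$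
   Context: Here $d\ge2$. A dyadic scale is $\delta=2^{-n}$, $n\in\mathbb N$. $\mathcal D_\delta(A)$ is the set of half-open dyadic cubes of side $\delta$ meeting $A$; $\delta$-cubes are dyadic cubes of side $\delta$. A non-empty bounded set $A\subseteq\mathbb R^k$ is a $(\delta,s,c)$-set if for every integer $0\le m\le n$ and every dyadic cube $Q$ of side $2^{-m}$, $|\mathcal D_\delta(A\cap Q)|\le c\,2^{-sm}|\mathcal D_\delta(A)|$; a family of $\delta$-cubes is a $(\delta,s,c)$-set if the union of its cubes is. $\mathcal S^{d-1}$ is the set of unit vectors in $\mathbb R^d$; $\pi_{e^\perp}$ is orthogonal projection of $\mathbb R^d$ onto the hyperplane $e^\perp$, and $e^\perp$ is identified isometrically with $\mathbb R^{d-1}$. Kolmogorov complexity: an oracle is an infinite binary sequence. Fix a universal oracle prefix Turing machine $U$. $K^A(\sigma)$ is the least length of a program $\pi$ with $U^A(\pi)=\sigma$, for finite strings $\sigma$ (finite objects such as rational points are encoded as strings). For $x\in\mathbb R^k$, $K^A_n(x)=\min\{K^A(q):q\in\mathbb Q^k,\ |q-x|<2^{-n}\}$. "$\mathcal P$, $\delta$, ... are computable relative to $A$" means that these data are encoded in $A$, i.e. computed from $A$ by a fixed program not depending on the data. $X\gtrsim Y$ means $X\ge cY$ for a constant $c>0$; constants in the $O(\cdot)$ terms do not depend on $\delta,\varepsilon,\eta,\mathcal P,A,e$. *)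

theory Defs
  imports "HOL-Analysis.Analysis" "HOL-Library.Sublist"
begin

section \<open>Turing machines with an infinite read tape\<close>

text \<open>
  Deterministic multi-tape machines. Tapes are infinite to the right; a left move in cell 0
  leaves the head where it is. States and symbols are natural numbers, the start state is 0, and
  the values of \<^term>\<open>delta\<close> outside the finite table constrained by \<open>valid_tm\<close> below are never
  used. The machine halts when \<^term>\<open>delta\<close> returns \<^term>\<open>None\<close>. Symbol 0 is the blank, symbols
  1 and 2 are the bits. Tape 0 initially holds the input string, tape 1 the infinite binary
  sequence \<open>A\<close> relative to which the machine computes; tape 2 holds the output.
\<close>

datatype dir = Left | Stay | Right

record tm =
  ntapes :: nat
  nsyms :: nat
  nstates :: nat
  delta :: "nat \<Rightarrow> nat list \<Rightarrow> (nat \<times> (nat \<times> dir) list) option"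

definition valid_tm :: "tm \<Rightarrow> bool" where
  "valid_tm M \<longleftrightarrow> 3 \<le> ntapes M \<and> 3 \<le> nsyms M \<and> 0 < nstates M \<and>
     (\<forall>q xs q' as. q < nstates M \<and> length xs = ntapes M \<and> (\<forall>x\<in>set xs. x < nsyms M) \<and>
        delta M q xs = Some (q', as) \<longrightarrow>
        q' < nstates M \<and> length as = ntapes M \<and> (\<forall>(w, m)\<in>set as. w < nsyms M))"

type_synonym tape = "nat \<times> (nat \<Rightarrow> nat)"  \<comment> \<open>head position and contents\<close>
type_synonym config = "nat \<times> tape list"

fun read_tape :: "tape \<Rightarrow> nat" where
  "read_tape (h, f) = f h"

fun move_head :: "dir \<Rightarrow> nat \<Rightarrow> nat" where
  "move_head Left h = h - 1"
| "move_head Stay h = h"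
| "move_head Right h = h + 1"

fun act_tape :: "tape \<Rightarrow> nat \<times> dir \<Rightarrow> tape" where
  "act_tape (h, f) (w, m) = (move_head m h, f(h := w))"

fun tm_step :: "tm \<Rightarrow> config \<Rightarrow> config option" where
  "tm_step M (q, ts) =
     (case delta M q (map read_tape ts) of
        None \<Rightarrow> None
      | Some (q', as) \<Rightarrow> Some (q', map2 act_tape ts as))"

definition bit_sym :: "bool \<Rightarrow> nat" where
  "bit_sym b = (if b then 2 else 1)"

definition init_config :: "tm \<Rightarrow> (nat \<Rightarrow> bool) \<Rightarrow> bool list \<Rightarrow> config" where
  "init_config M A p =
     (0, (0, \<lambda>i. if i < length p then bit_sym (p ! i) else 0) #
         (0, \<lambda>i. bit_sym (A i)) #
         replicate (ntapes M - 2) (0, \<lambda>i. 0))"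

definition tape_string :: "tape \<Rightarrow> bool list \<Rightarrow> bool" where
  "tape_string T s \<longleftrightarrow>
     (\<forall>i<length s. snd T i = bit_sym (s ! i)) \<and> snd T (length s) \<notin> range bit_sym"

text \<open>\<open>tm_outputs M A p s\<close> says that \<open>M\<close> with sequence \<open>A\<close> halts on input \<open>p\<close> with output \<open>s\<close>.\<close>

definition tm_outputs :: "tm \<Rightarrow> (nat \<Rightarrow> bool) \<Rightarrow> bool list \<Rightarrow> bool list \<Rightarrow> bool" where
  "tm_outputs M A p s \<longleftrightarrow>
     (\<exists>q ts. (init_config M A p, (q, ts)) \<in> {(c, c'). tm_step M c = Some c'}\<^sup>* \<and>
             tm_step M (q, ts) = None \<and> tape_string (ts ! 2) s)"

lemma tm_outputs_unique:
  assumes "tm_outputs M A p s" "tm_outputs M A p s'"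
  shows "s = s'"
proof -
  let ?R = "{(c, c'). tm_step M c = Some c'}"
  have sv: "single_valued ?R" by (auto simp: single_valued_def)
  from assms obtain c ts c' ts' where
    *: "(init_config M A p, (c, ts)) \<in> ?R\<^sup>*" "tm_step M (c, ts) = None" "tape_string (ts ! 2) s"
       "(init_config M A p, (c', ts')) \<in> ?R\<^sup>*" "tm_step M (c', ts') = None" "tape_string (ts' ! 2) s'"
    unfolding tm_outputs_def by blast
  have "((c, ts), (c', ts')) \<in> ?R\<^sup>* \<or> ((c', ts'), (c, ts)) \<in> ?R\<^sup>*"
    using single_valued_confluent[OF sv *(1) *(4)] .
  then have eq: "ts = ts'"
    using *(2,5) by (auto elim: converse_rtranclE)
  have "length s = length s'"
  proof (rule linorder_cases[of "length s" "length s'"])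
    assume "length s < length s'"
    with *(3,6) eq show ?thesis by (auto simp: tape_string_def)
  next
    assume "length s' < length s"
    with *(3,6) eq show ?thesis by (auto simp: tape_string_def)
  qed
  with *(3,6) eq show ?thesis
    by (intro nth_equalityI) (auto simp: tape_string_def bit_sym_def split: if_splits)
qed

section \<open>Prefix machines and Kolmogorov complexity\<close>

definition prefix_tm :: "tm \<Rightarrow> bool" where
  "prefix_tm M \<longleftrightarrow> valid_tm M \<and>
     (\<forall>A p p' s s'. tm_outputs M A p s \<and> tm_outputs M A p' s' \<and> prefix p p' \<longrightarrow> p = p')"

definition universal_prefix_tm :: "tm \<Rightarrow> bool" where
  "universal_prefix_tm U \<longleftrightarrow> prefix_tm U \<and>
     (\<forall>M. prefix_tm M \<longrightarrow> (\<exists>r. \<forall>A p s. tm_outputs U A (r @ p) s \<longleftrightarrow> tm_outputs M A p s))"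

text \<open>
  For universal \<open>U\<close> every string has a program, so the minimum below exists.
\<close>

definition kolm :: "tm \<Rightarrow> (nat \<Rightarrow> bool) \<Rightarrow> bool list \<Rightarrow> nat" where
  "kolm U A s = (LEAST l. \<exists>p. length p = l \<and> tm_outputs U A p s)"

text \<open>
  Finite objects as strings: numbers are written in self-delimiting unary. Any other computable
  encoding changes complexities by \<open>O(1)\<close> only.
\<close>

definition enc_nat :: "nat \<Rightarrow> bool list" where
  "enc_nat k = replicate k True @ [False]"

definition enc_int :: "int \<Rightarrow> bool list" where
  "enc_int z = (z < 0) # enc_nat (nat \<bar>z\<bar>)"

definition enc_rat :: "rat \<Rightarrow> bool list" where
  "enc_rat r = (case quotient_of r of (a, b) \<Rightarrow> enc_int a @ enc_int b)"

text \<open>An arbitrary but fixed order of the coordinates.\<close>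

definition coords :: "'k::finite list" where
  "coords = (SOME xs. distinct xs \<and> set xs = UNIV)"

definition enc_vec :: "('a \<Rightarrow> bool list) \<Rightarrow> 'a ^ 'k::finite \<Rightarrow> bool list" where
  "enc_vec f v = concat (map (\<lambda>i. f (v $ i)) coords)"

definition enc_list :: "('a \<Rightarrow> bool list) \<Rightarrow> 'a list \<Rightarrow> bool list" where
  "enc_list f xs = enc_nat (length xs) @ concat (map f xs)"

definition kolm_prec :: "tm \<Rightarrow> (nat \<Rightarrow> bool) \<Rightarrow> nat \<Rightarrow> real ^ 'k::finite \<Rightarrow> nat" where
  "kolm_prec U A n x =
     (LEAST l. \<exists>q :: rat ^ 'k. norm ((\<chi> i. of_rat (q $ i)) - x) < (1/2) ^ n \<and>
                               l = kolm U A (enc_vec enc_rat q))"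

section \<open>Dyadic cubes\<close>

definition dyadic_cube :: "nat \<Rightarrow> int ^ 'k::finite \<Rightarrow> (real ^ 'k) set" where
  "dyadic_cube n z =
     {x. \<forall>i. of_int (z $ i) * (1/2) ^ n \<le> x $ i \<and> x $ i < (of_int (z $ i) + 1) * (1/2) ^ n}"

definition dyadic_cubes :: "nat \<Rightarrow> (real ^ 'k::finite) set set" where
  "dyadic_cubes n = range (dyadic_cube n)"

definition cover_cubes :: "nat \<Rightarrow> (real ^ 'k::finite) set \<Rightarrow> (real ^ 'k) set set" where
  "cover_cubes n A = {Q \<in> dyadic_cubes n. Q \<inter> A \<noteq> {}}"

text \<open>The scale \<open>\<delta> = 2\<^sup>-\<^sup>n\<close> is represented by \<open>n\<close> in the following definitions.\<close>

definition delta_set :: "nat \<Rightarrow> real \<Rightarrow> real \<Rightarrow> (real ^ 'k::finite) set \<Rightarrow> bool" where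
  "delta_set n s c A \<longleftrightarrow> A \<noteq> {} \<and> bounded A \<and>
     (\<forall>m\<le>n. \<forall>Q\<in>dyadic_cubes m.
        real (card (cover_cubes n (A \<inter> Q))) \<le> c * 2 powr (- s * real m) * real (card (cover_cubes n A)))"

definition delta_family :: "nat \<Rightarrow> real \<Rightarrow> real \<Rightarrow> (real ^ 'k::finite) set set \<Rightarrow> bool" where
  "delta_family n s c P \<longleftrightarrow> P \<subseteq> dyadic_cubes n \<and> delta_set n s c (\<Union>P)"

text \<open>
  \<open>computes_data M A n P xs\<close>: from \<open>A\<close> the machine \<open>M\<close> computes \<open>n\<close> (equivalently \<open>2\<^sup>-\<^sup>n\<close>), a list
  of the positions of the cubes in \<open>P\<close>, and rational approximations of prescribed precision of
  each of the reals \<open>xs\<close>. The leading number in the input selects the item.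
\<close>

definition computes_data ::
  "tm \<Rightarrow> (nat \<Rightarrow> bool) \<Rightarrow> nat \<Rightarrow> (real ^ 'k::finite) set set \<Rightarrow> real list \<Rightarrow> bool" where
  "computes_data M A n P xs \<longleftrightarrow>
     tm_outputs M A (enc_nat 0) (enc_nat n) \<and>
     (\<exists>zs :: (int ^ 'k) list. dyadic_cube n ` set zs = P \<and>
        tm_outputs M A (enc_nat 1) (enc_list (enc_vec enc_int) zs)) \<and>
     (\<forall>j<length xs. \<forall>k. \<exists>q :: rat.
        \<bar>of_rat q - xs ! j\<bar> \<le> (1/2) ^ k \<and>
        tm_outputs M A (enc_nat (j + 2) @ enc_nat k) (enc_rat q))"

section \<open>Projections\<close>

text \<open>Orthogonal projection onto the hyperplane orthogonal to the unit vector \<open>e\<close>.\<close>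

definition perp_proj :: "real ^ 'k::finite \<Rightarrow> real ^ 'k \<Rightarrow> real ^ 'k" where
  "perp_proj e x = x - (x \<bullet> e) *\<^sub>R e"

text \<open>
  The restriction of \<open>\<phi>\<close> to that hyperplane is a linear isometry into \<open>real ^ 'c\<close>; if
  \<open>CARD('k) = CARD('c) + 1\<close> it is onto. The values of \<open>\<phi>\<close> elsewhere are irrelevant.
\<close>

definition perp_isometry :: "real ^ 'k::finite \<Rightarrow> (real ^ 'k \<Rightarrow> real ^ 'c::finite) \<Rightarrow> bool" where
  "perp_isometry e \<phi> \<longleftrightarrow> linear \<phi> \<and> (\<forall>x. x \<bullet> e = 0 \<longrightarrow> norm (\<phi> x) = norm x)"

end

theory Submission imports Defs "HOL-Real_Asymp.Real_Asymp"
begin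

text \<open>
  Let \<open>Z\<close> be the set of positions of the cubes in the family \<open>P\<close>, \<open>d\<close> the dimension and
  \<open>u = min t (d - 1)\<close>. The proof is Kaufman's argument for projections, with the exceptional
  set of directions replaced by a finite list that can be computed from the data.

  For a vector \<open>v\<close> and a scale \<open>m\<close> the directions whose projection makes \<open>v\<close> shorter than \<open>2 ^ (- m)\<close> form a
  tube around the line of \<open>v\<close>. Their share among all directions is of order
  \<open>(2 ^ (- m) / norm v) ^ (d - 1)\<close> (lemma \<open>tube_count\<close>). Summing over all pairs in \<open>Z\<close> shows that for an average
  direction the number of pairs whose projections are \<open>2 ^ (- m)\<close>-close is at most of order
  \<open>n * 2 powr (\<eta> n - u m) * (card Z)\<^sup>2\<close>, so only a share of order \<open>n * 2 powr (- 3 \<epsilon> n)\<close> of the directions has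
  more than \<open>2 powr ((\<eta> + 3 \<epsilon>) n - u m) * (card Z)\<^sup>2\<close> such pairs (lemma \<open>energy_average\<close>).

  These exceptional directions, rounded to a grid, can be enumerated from the list of cubes, and one of them
  is specified by its rank in the enumeration, which takes about \<open>(d - 1 - 3 \<epsilon>) n\<close> bits. A direction \<open>e\<close>
  of complexity at least \<open>(d - 1 - \<epsilon>) n\<close> is therefore not exceptional at any scale
  (lemma \<open>projected_energy\<close>). A projection with small energy at all scales contains a large regular
  part: discard the cubes with too many partners, and keep those cubes of the
  image whose fibres have about the same size (lemma \<open>regular_image\<close>).

  Most of the work lies in the sentence that the exceptional directions can be enumerated, since it means that a
  prefix-free Turing machine has to exist that does it (theorem \<open>machine_exists\<close>). The machine is compiled
  from a small structured language on tapes, in which registers are tapes and primitive recursive functions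
  are evaluated on registers; the enumeration is an expression built from arithmetic and bounded
  sums. Three choices keep it small. The machine queries \<open>\<Phi>\<close> only once, for the list of cubes; everything
  else, such as the scale, comes from the program. Directions are compared with differences of positions by the minors
  \<open>v j * a i - v i * a j\<close>, so all tests are integer inequalities. And the grid points have odd numerators over a
  power of two, so they are reduced fractions.
\<close>

section \<open>Structured programs compiled to Turing machines\<close>

text \<open>
  A store assigns a tape to every natural number, so that a program can be written before the number
  of tapes of the machine that runs it is known; compilation keeps an initial segment.
  The command \<open>Run\<close> stands for one complete computation of a fixed machine \<open>\<Phi>\<close>, the one
  that extracts the data from the oracle.
\<close>

type_synonym store = "nat \<Rightarrow> tape"

datatype com =
    Skip
  | Act nat "nat \<Rightarrow> nat \<times> dir"
  | Seq com com (infixr ";;" 60)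
  | While nat "nat \<Rightarrow> bool" com
  | Run

definition steps :: "tm \<Rightarrow> (config \<times> config) set" where
  "steps M = {(c, c'). tm_step M c = Some c'}\<^sup>*"

definition tape_list :: "nat \<Rightarrow> store \<Rightarrow> tape list" where
  "tape_list k s = map s [0..<k]"

definition idle :: "nat list \<Rightarrow> (nat \<times> dir) list" where
  "idle xs = map (\<lambda>x. (x, Stay)) xs"

fun uses_below :: "nat \<Rightarrow> com \<Rightarrow> bool" where
  "uses_below k Skip = True"
| "uses_below k (Act \<tau> g) = (\<tau> < k)"
| "uses_below k (c ;; c') = (uses_below k c \<and> uses_below k c')"
| "uses_below k (While \<tau> P c) = (\<tau> < k \<and> uses_below k c)"
| "uses_below k Run = True"

fun writes_below :: "nat \<Rightarrow> com \<Rightarrow> bool" where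
  "writes_below k Skip = True"
| "writes_below k (Act \<tau> g) = (\<forall>x<k. fst (g x) < k)"
| "writes_below k (c ;; c') = (writes_below k c \<and> writes_below k c')"
| "writes_below k (While \<tau> P c) = writes_below k c"
| "writes_below k Run = True"

lemma uses_below_mono: "uses_below k c \<Longrightarrow> k \<le> k' \<Longrightarrow> uses_below k' c"
  by (induction c) auto

lemma uses_below_exists: "\<exists>k. uses_below k c"
proof (induction c)
  case (Act x1 x2) show ?case by (auto intro: exI[of _ "Suc x1"])
next
  case (Seq c1 c2)
  then obtain k1 k2 where "uses_below k1 c1" "uses_below k2 c2" by blast
  then have "uses_below (max k1 k2) (Seq c1 c2)" by (auto intro: uses_below_mono)
  then show ?case by blast
next
  case (While x1 x2 c)
  then obtain k1 where "uses_below k1 c" by blast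
  then have "uses_below (max k1 (Suc x1)) (While x1 x2 c)" by (auto intro: uses_below_mono)
  then show ?case by blast
qed auto

text \<open>
  The host machine has its program on tape 0 and its output on tape 2. The subroutine \<open>\<Phi>\<close>
  therefore reads its input from tape 3 and keeps its tapes \<open>j \<ge> 2\<close> on \<open>j + 2\<close>; the oracle
  tape 1 is shared. As \<open>\<Phi>\<close> may overwrite the oracle, a second run could not rely on it.

  The model offers no way to recognise cell 0 of a tape, so after a run the output of \<open>\<Phi>\<close> could
  not be rewound. For this reason the head of tape \<open>base\<close>, the first tape that \<open>\<Phi>\<close> does not
  own, copies every move of the output head of \<open>\<Phi>\<close>; as it moves on a tape with a mark in cell 0,
  it records the position of that head.
\<close>

locale subroutine =
  fixes \<Phi> :: tm
  assumes valid: "valid_tm \<Phi>"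
begin

abbreviation np where "np \<equiv> ntapes \<Phi>"
abbreviation base where "base \<equiv> np + 2"

definition sub_index :: "nat \<Rightarrow> nat" where
  "sub_index j = (if j = 0 then 3 else if j = 1 then 1 else j + 2)"

definition sub_tapes :: "store \<Rightarrow> tape list" where
  "sub_tapes s = map (\<lambda>j. s (sub_index j)) [0..<np]"

definition put_tapes :: "store \<Rightarrow> tape list \<Rightarrow> store" where
  "put_tapes s ts = (\<lambda>\<tau>. if \<tau> = 1 then ts ! 1 else if \<tau> = 3 then ts ! 0
     else if 4 \<le> \<tau> \<and> \<tau> < base then ts ! (\<tau> - 2)
     else if \<tau> = base then (fst (ts ! 2), snd (s base)) else s \<tau>)"

definition sub_act :: "nat list \<Rightarrow> (nat \<times> dir) list \<Rightarrow> nat \<Rightarrow> nat \<times> dir" where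
  "sub_act xs as \<tau> = (if \<tau> = 1 then as ! 1 else if \<tau> = 3 then as ! 0
     else if 4 \<le> \<tau> \<and> \<tau> < base then as ! (\<tau> - 2)
     else if \<tau> = base then (xs ! \<tau>, snd (as ! 2)) else (xs ! \<tau>, Stay))"

definition sub_instr :: "nat \<Rightarrow> nat \<Rightarrow> nat list \<Rightarrow> nat \<times> (nat \<times> dir) list" where
  "sub_instr i q xs = (case delta \<Phi> q (map (\<lambda>j. xs ! sub_index j) [0..<np]) of
      None \<Rightarrow> (i + nstates \<Phi>, idle xs)
    | Some (q', as) \<Rightarrow> (i + q', map (sub_act xs as) [0..<length xs]))"

fun len :: "com \<Rightarrow> nat" where
  "len Skip = 0"
| "len (Act \<tau> g) = 1"
| "len (c ;; c') = len c + len c'"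
| "len (While \<tau> P c) = len c + 2"
| "len Run = nstates \<Phi>"

fun code :: "com \<Rightarrow> nat \<Rightarrow> (nat list \<Rightarrow> nat \<times> (nat \<times> dir) list) list" where
  "code Skip i = []"
| "code (Act \<tau> g) i = [\<lambda>xs. (i + 1, (idle xs)[\<tau> := g (xs ! \<tau>)])]"
| "code (c ;; c') i = code c i @ code c' (i + len c)"
| "code (While \<tau> P c) i =
     (\<lambda>xs. (if P (xs ! \<tau>) then i + 1 else i + len c + 2, idle xs)) # code c (i + 1) @
     [\<lambda>xs. (i, idle xs)]"
| "code Run i = map (sub_instr i) [0..<nstates \<Phi>]"

lemma length_code [simp]: "length (code c i) = len c"
  by (induction c arbitrary: i) auto

definition compile :: "nat \<Rightarrow> com \<Rightarrow> tm" where
  "compile k c = \<lparr>ntapes = k, nsyms = nsyms \<Phi>, nstates = len c + 1,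
     delta = (\<lambda>q xs. if q < len c then Some ((code c 0 ! q) xs) else None)\<rparr>"

lemma np_ge: "3 \<le> np" "3 \<le> nsyms \<Phi>" "0 < nstates \<Phi>"
  using valid by (auto simp: valid_tm_def)

text \<open>
  The host has the alphabet of \<open>\<Phi>\<close>, so the instructions that simulate \<open>\<Phi>\<close> inherit their
  validity from \<open>\<Phi>\<close> without any check of the symbols read.
\<close>

lemma code_valid:
  assumes "length xs = k" "\<forall>x\<in>set xs. x < nsyms \<Phi>" "uses_below k c" "writes_below (nsyms \<Phi>) c"
    "np + 3 \<le> k" "f \<in> set (code c i)"
  shows "fst (f xs) \<le> i + len c \<and> length (snd (f xs)) = k \<and> (\<forall>(w, m)\<in>set (snd (f xs)). w < nsyms \<Phi>)"
  using assms(3,4,6)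
proof (induction c arbitrary: i)
  case (Act \<tau> g)
  have "set ((idle xs)[\<tau> := g (xs ! \<tau>)]) \<subseteq> insert (g (xs ! \<tau>)) (set (idle xs))"
    by (rule set_update_subset_insert)
  moreover have "xs ! \<tau> < nsyms \<Phi>" using Act assms by auto
  moreover have "f = (\<lambda>xs. (i + 1, (idle xs)[\<tau> := g (xs ! \<tau>)]))" using Act by simp
  moreover have "\<forall>(w, m)\<in>set (idle xs). w < nsyms \<Phi>" using assms(2) by (auto simp: idle_def)
  moreover have "fst (g (xs ! \<tau>)) < nsyms \<Phi>" using Act calculation by simp
  ultimately have "\<forall>(w, m)\<in>set ((idle xs)[\<tau> := g (xs ! \<tau>)]). w < nsyms \<Phi>"
    by (metis (no_types, lifting) case_prod_unfold insert_iff subsetD)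
  then show ?case using \<open>f = _\<close> assms(1) by (simp add: idle_def)
next
  case (Seq c1 c2)
  from Seq.prems(3) consider "f \<in> set (code c1 i)" | "f \<in> set (code c2 (i + len c1))" by auto
  then show ?case
  proof cases
    case 1
    then show ?thesis using Seq.IH(1)[of i] Seq.prems by auto
  next
    case 2
    then show ?thesis using Seq.IH(2)[of "i + len c1"] Seq.prems by auto
  qed
next
  case (While \<tau> P c)
  from While.prems(3) consider "f = (\<lambda>xs. (if P (xs ! \<tau>) then i + 1 else i + len c + 2, idle xs))"
    | "f \<in> set (code c (i + 1))" | "f = (\<lambda>xs. (i, idle xs))" by auto
  then show ?case
  proof cases
    case 2
    then show ?thesis using While.IH[of "i + 1"] While.prems by auto
  qed (use assms(1,2) in \<open>auto simp: idle_def\<close>)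
next
  case Run
  then obtain q where q: "q < nstates \<Phi>" "f = sub_instr i q" by auto
  let ?xs = "map (\<lambda>j. xs ! sub_index j) [0..<np]"
  have xs: "\<forall>x\<in>set ?xs. x < nsyms \<Phi>" using assms by (auto simp: sub_index_def)
  show ?case
  proof (cases "delta \<Phi> q ?xs")
    case None
    then show ?thesis using assms q by (auto simp: sub_instr_def idle_def)
  next
    case (Some r)
    obtain q' as where r: "r = (q', as)" by (cases r)
    with Some xs q valid have *: "q' < nstates \<Phi>" "length as = np" "\<forall>(w, m)\<in>set as. w < nsyms \<Phi>"
      unfolding valid_tm_def by (metis (no_types, lifting) length_map length_upt minus_nat.diff_0)+
    have "fst (sub_act xs as \<tau>) < nsyms \<Phi>" if "\<tau> < k" for \<tau>
    proof -
      have "fst (as ! j) < nsyms \<Phi>" if "j < np" for j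
        using *(2,3) that by (metis (no_types, lifting) case_prod_unfold nth_mem)
      moreover have "xs ! \<tau> < nsyms \<Phi>" using assms that by auto
      ultimately show ?thesis using np_ge(1) by (auto simp: sub_act_def)
    qed
    then show ?thesis using assms(1) q * by (auto simp: sub_instr_def Some r) (metis fst_conv)
  qed
qed auto

lemma compile_valid:
  assumes "uses_below k c" "writes_below (nsyms \<Phi>) c" "np + 3 \<le> k"
  shows "valid_tm (compile k c)"
proof -
  have "q' < len c + 1 \<and> length as = k \<and> (\<forall>(w, m)\<in>set as. w < nsyms \<Phi>)"
    if "q < len c" "length xs = k" "\<forall>x\<in>set xs. x < nsyms \<Phi>" "(code c 0 ! q) xs = (q', as)"
    for q xs q' as
    using code_valid[OF that(2,3) assms, of "code c 0 ! q" 0] that by auto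
  then show ?thesis using np_ge assms unfolding valid_tm_def compile_def
    by (simp split: if_splits) blast
qed

inductive exec :: "com \<Rightarrow> store \<Rightarrow> store \<Rightarrow> bool" where
  exec_Skip: "exec Skip s s"
| exec_Act: "s' = s(\<tau> := act_tape (s \<tau>) (g (read_tape (s \<tau>)))) \<Longrightarrow> exec (Act \<tau> g) s s'"
| exec_Seq: "exec c s s' \<Longrightarrow> exec c' s' s'' \<Longrightarrow> exec (c ;; c') s s''"
| exec_WhileF: "\<not> P (read_tape (s \<tau>)) \<Longrightarrow> exec (While \<tau> P c) s s"
| exec_WhileT: "P (read_tape (s \<tau>)) \<Longrightarrow> exec c s s' \<Longrightarrow> exec (While \<tau> P c) s' s'' \<Longrightarrow>
     exec (While \<tau> P c) s s''"
| exec_Run: "((0, sub_tapes s), (q, ts)) \<in> steps \<Phi> \<Longrightarrow> tm_step \<Phi> (q, ts) = None \<Longrightarrow>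
     fst (s base) = fst (s 4) \<Longrightarrow> (\<forall>j<np. \<forall>i. snd (s (sub_index j)) i < nsyms \<Phi>) \<Longrightarrow>
     exec Run s (put_tapes s ts)"

lemma act_idle [simp]: "act_tape T (read_tape T, Stay) = T"
  by (cases T) auto

lemma act_follow [simp]: "act_tape T (read_tape T, m) = (move_head m (fst T), snd T)"
  by (cases T) auto

lemma read_def: "read_tape T = snd T (fst T)"
  by (cases T) auto

lemma act_def: "act_tape T a = (move_head (snd a) (fst T), (snd T)(fst T := fst a))"
  by (cases T; cases a) auto

definition code_at :: "com \<Rightarrow> com \<Rightarrow> nat \<Rightarrow> bool" where
  "code_at c d i \<longleftrightarrow> (\<forall>j<len d. i + j < len c \<and> code c 0 ! (i + j) = code d i ! j)"

lemma code_at_self: "code_at c c 0"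
  by (simp add: code_at_def)

lemma code_at_Seq:
  assumes "code_at c (d ;; e) i"
  shows "code_at c d i" "code_at c e (i + len d)"
proof -
  show "code_at c d i" using assms unfolding code_at_def
    by (simp add: nth_append)
  show "code_at c e (i + len d)" unfolding code_at_def
  proof (intro allI impI)
    fix j assume "j < len e"
    then have "i + (len d + j) < len c \<and> code c 0 ! (i + (len d + j)) = code (d ;; e) i ! (len d + j)"
      using assms unfolding code_at_def by (metis len.simps(3) nat_add_left_cancel_less)
    then show "i + len d + j < len c \<and> code c 0 ! (i + len d + j) = code e (i + len d) ! j"
      by (simp add: nth_append add.assoc)
  qed
qed

lemma code_at_While:
  assumes "code_at c (While \<tau> P d) i"
  shows "code_at c d (i + 1)"
    "i < len c" "code c 0 ! i = (\<lambda>xs. (if P (xs ! \<tau>) then i + 1 else i + len d + 2, idle xs))"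
    "i + len d + 1 < len c" "code c 0 ! (i + len d + 1) = (\<lambda>xs. (i, idle xs))"
proof -
  have *: "i + j < len c \<and> code c 0 ! (i + j) = code (While \<tau> P d) i ! j" if "j < len d + 2" for j
    using assms that unfolding code_at_def by (metis len.simps(4))
  show "i < len c" "code c 0 ! i = (\<lambda>xs. (if P (xs ! \<tau>) then i + 1 else i + len d + 2, idle xs))"
    using *[of 0] by (simp_all del: One_nat_def)
  show "i + len d + 1 < len c" "code c 0 ! (i + len d + 1) = (\<lambda>xs. (i, idle xs))"
    using *[of "len d + 1"] by (simp_all add: nth_append add.assoc)
  show "code_at c d (i + 1)" unfolding code_at_def
  proof (intro allI impI)
    fix j assume "j < len d"
    then show "i + 1 + j < len c \<and> code c 0 ! (i + 1 + j) = code d (i + 1) ! j"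
      using *[of "j + 1"] by (simp add: nth_append add.assoc)
  qed
qed

lemma compile_step:
  assumes "i < len c" "(code c 0 ! i) (map read_tape (tape_list k s)) = (i', as)"
    "length as = k" "\<And>\<tau>. \<tau> < k \<Longrightarrow> act_tape (s \<tau>) (as ! \<tau>) = s' \<tau>"
  shows "((i, tape_list k s), (i', tape_list k s')) \<in> steps (compile k c)"
proof -
  have "map2 act_tape (tape_list k s) as = tape_list k s'"
    using assms(3,4) by (auto simp: tape_list_def intro!: nth_equalityI)
  then have "tm_step (compile k c) (i, tape_list k s) = Some (i', tape_list k s')"
    using assms by (simp add: compile_def)
  then show ?thesis by (auto simp: steps_def)
qed

lemma steps_trans: "(a, b) \<in> steps M \<Longrightarrow> (b, c) \<in> steps M \<Longrightarrow> (a, c) \<in> steps M"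
  unfolding steps_def by (rule rtrancl_trans)

lemma idle_act: "\<tau> < k \<Longrightarrow> act_tape (s \<tau>) (idle (map read_tape (tape_list k s)) ! \<tau>) = s \<tau>"
  by (simp add: idle_def tape_list_def)

lemma length_idle [simp]: "length (idle xs) = length xs" by (simp add: idle_def)
lemma length_tape_list [simp]: "length (tape_list k s) = k" by (simp add: tape_list_def)
lemma nth_tape_list [simp]: "\<tau> < k \<Longrightarrow> tape_list k s ! \<tau> = s \<tau>" by (simp add: tape_list_def)

lemma sub_index_less: "j < np \<Longrightarrow> sub_index j < base"
  using np_ge by (auto simp: sub_index_def)

lemma sub_tapes_put: "length ts = np \<Longrightarrow> sub_tapes (put_tapes s ts) = ts"
  using np_ge(1) by (auto simp: sub_tapes_def put_tapes_def sub_index_def intro!: nth_equalityI)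

lemma put_self:
  assumes "fst (s base) = fst (s 4)"
  shows "put_tapes s (sub_tapes s) = s"
proof
  fix \<tau>
  have "sub_tapes s ! j = s (sub_index j)" if "j < np" for j
    using that by (simp add: sub_tapes_def)
  moreover have "sub_index 0 = 3" "sub_index 1 = 1" "sub_index 2 = 4"
    "\<And>\<tau>. 4 \<le> \<tau> \<Longrightarrow> sub_index (\<tau> - 2) = \<tau>"
    by (auto simp: sub_index_def)
  ultimately show "put_tapes s (sub_tapes s) \<tau> = s \<tau>"
    using np_ge(1) assms by (auto simp: put_tapes_def prod_eq_iff)
qed

lemma read_sub_tapes:
  assumes "np + 3 \<le> k" "length ts = np"
  shows "map (\<lambda>j. map read_tape (tape_list k (put_tapes s ts)) ! sub_index j) [0..<np] = map read_tape ts"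
proof (rule nth_equalityI)
  fix j assume "j < length (map (\<lambda>j. map read_tape (tape_list k (put_tapes s ts)) ! sub_index j) [0..<np])"
  then have j: "j < np" by simp
  have "put_tapes s ts (sub_index j) = sub_tapes (put_tapes s ts) ! j"
    using j by (simp add: sub_tapes_def)
  then show "map (\<lambda>j. map read_tape (tape_list k (put_tapes s ts)) ! sub_index j) [0..<np] ! j = map read_tape ts ! j"
    using assms j sub_index_less[OF j] by (simp add: sub_tapes_put)
qed (use assms in simp)

text \<open>
  One step of \<open>\<Phi>\<close> is one step of the host. That the states stay below \<^term>\<open>nstates \<Phi>\<close>, the
  number of instructions reserved for \<open>Run\<close>, depends on \<open>\<Phi>\<close> being fed only symbols of its own
  alphabet; the bound on the symbols is therefore carried along the run.
\<close>

lemma Run_steps: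
  assumes k: "np + 3 \<le> k" and at: "code_at c Run i"
    and run: "((0, sub_tapes s), (q, ts)) \<in> steps \<Phi>"
    and sync: "fst (s base) = fst (s 4)"
    and syms: "\<forall>j<np. \<forall>i. snd (s (sub_index j)) i < nsyms \<Phi>"
  shows "q < nstates \<Phi> \<and> length ts = np \<and> (\<forall>T\<in>set ts. \<forall>i. snd T i < nsyms \<Phi>) \<and>
    ((i, tape_list k s), (i + q, tape_list k (put_tapes s ts))) \<in> steps (compile k c)"
  using run unfolding steps_def[of \<Phi>]
proof (induction "(q, ts)" arbitrary: q ts rule: rtrancl_induct)
  case base
  then show ?case using syms np_ge put_self[OF sync]
    by (auto simp: sub_tapes_def steps_def)
next
  case (step y)
  obtain q1 ts1 where y: "y = (q1, ts1)" by (cases y)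
  note IH = step(3)[OF y]
  let ?s = "put_tapes s ts1"
  have q1: "q1 < nstates \<Phi>" "length ts1 = np" using IH by auto
  from step(2) y obtain as where d: "delta \<Phi> q1 (map read_tape ts1) = Some (q, as)"
    and ts: "ts = map2 act_tape ts1 as" by (auto split: option.splits)
  have "\<forall>x\<in>set (map read_tape ts1). x < nsyms \<Phi>" using IH by (auto simp: read_def)
  with d q1 valid have v: "q < nstates \<Phi>" "length as = np" "\<forall>(w, m)\<in>set as. w < nsyms \<Phi>"
    unfolding valid_tm_def by (metis length_map)+
  have lts: "length ts = np" using ts v q1 by simp
  have nth: "ts ! j = act_tape (ts1 ! j) (as ! j)" if "j < np" for j
    using that ts v q1 by simp
  have syms': "snd T i < nsyms \<Phi>" if "T \<in> set ts" for T i
  proof -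
    from that lts obtain j where j: "j < np" "T = ts ! j" by (metis in_set_conv_nth)
    have "fst (as ! j) < nsyms \<Phi>" using v j by (metis (no_types, lifting) case_prod_unfold nth_mem)
    moreover have "\<forall>i. snd (ts1 ! j) i < nsyms \<Phi>" using IH j by auto
    ultimately show ?thesis using j nth by (auto simp: act_def)
  qed
  let ?xs = "map read_tape (tape_list k ?s)"
  have rd: "map (\<lambda>j. ?xs ! sub_index j) [0..<np] = map read_tape ts1"
    by (rule read_sub_tapes[OF k q1(2)])
  have ci: "i + q1 < len c" "code c 0 ! (i + q1) = sub_instr i q1"
    using at q1 unfolding code_at_def by (auto)
  have "((i + q1, tape_list k ?s), (i + q, tape_list k (put_tapes s ts))) \<in> steps (compile k c)"
  proof (rule compile_step[OF ci(1)])
    show "(code c 0 ! (i + q1)) ?xs = (i + q, map (sub_act ?xs as) [0..<k])"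
      using rd d by (simp add: ci sub_instr_def del: map_map)
    fix \<tau> assume \<tau>: "\<tau> < k"
    then show "act_tape (?s \<tau>) (map (sub_act ?xs as) [0..<k] ! \<tau>) = put_tapes s ts \<tau>"
      using np_ge(1) nth by (auto simp: sub_act_def put_tapes_def act_def read_def)
  qed simp
  then show ?case using IH v lts syms' steps_trans by blast
qed

text \<open>
  Code is position dependent, so the claim is about code placed at an arbitrary address of a larger
  program; execution ends at the first address behind it.
\<close>

theorem compile_exec:
  assumes "exec d s s'" "code_at c d i" "uses_below k d" "np + 3 \<le> k"
  shows "((i, tape_list k s), (i + len d, tape_list k s')) \<in> steps (compile k c)"
  using assms
proof (induction arbitrary: i rule: exec.induct)
  case (exec_Skip s)
  then show ?case by (simp add: steps_def)
next
  case (exec_Act s' s \<tau> g)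
  have at: "i < len c" "code c 0 ! i = (\<lambda>xs. (i + 1, (idle xs)[\<tau> := g (xs ! \<tau>)]))"
    using exec_Act(2) unfolding code_at_def by (auto)
  show ?case
    by (rule compile_step[OF at(1)])
      (use exec_Act idle_act in \<open>auto simp: at nth_list_update simp del: map_map\<close>)
next
  case (exec_Seq c1 s s' c2 s'')
  show ?case
    using exec_Seq.IH(1)[OF code_at_Seq(1)[OF exec_Seq.prems(1)]]
      exec_Seq.IH(2)[OF code_at_Seq(2)[OF exec_Seq.prems(1)]] exec_Seq.prems(2,3)
    by (auto intro: steps_trans simp: add.assoc)
next
  case (exec_WhileF P s \<tau> d)
  note at = code_at_While[OF exec_WhileF(2)]
  show ?case
    by (rule compile_step[OF at(2)]) (use exec_WhileF idle_act in \<open>auto simp: at simp del: map_map\<close>)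
next
  case (exec_WhileT P s \<tau> d s' s'')
  note at = code_at_While[OF exec_WhileT.prems(1)]
  have 1: "((i, tape_list k s), (i + 1, tape_list k s)) \<in> steps (compile k c)"
    by (rule compile_step[OF at(2)]) (use exec_WhileT idle_act in \<open>auto simp: at simp del: map_map\<close>)
  have 2: "((i + 1 + len d, tape_list k s'), (i, tape_list k s')) \<in> steps (compile k c)"
    by (rule compile_step) (use exec_WhileT idle_act at in \<open>auto simp: ac_simps simp del: map_map\<close>)
  show ?case
    using 1 2 exec_WhileT.IH(1)[OF at(1)] exec_WhileT.IH(2)[OF exec_WhileT.prems(1)] exec_WhileT.prems(2,3)
    by (auto intro: steps_trans)
next
  case (exec_Run s q ts)
  note R = Run_steps[OF exec_Run.prems(3,1) exec_Run.hyps(1,3,4)]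
  have q: "q < nstates \<Phi>" "length ts = np" using R by auto
  let ?s = "put_tapes s ts"
  let ?xs = "map read_tape (tape_list k ?s)"
  have rd: "map (\<lambda>j. ?xs ! sub_index j) [0..<np] = map read_tape ts"
    by (rule read_sub_tapes[OF exec_Run.prems(3) q(2)])
  have ci: "i + q < len c" "code c 0 ! (i + q) = sub_instr i q"
    using exec_Run.prems(1) q unfolding code_at_def by auto
  have "((i + q, tape_list k ?s), (i + nstates \<Phi>, tape_list k ?s)) \<in> steps (compile k c)"
    by (rule compile_step[OF ci(1), where as = "idle ?xs"])
      (use exec_Run(2) rd idle_act in \<open>auto simp: ci sub_instr_def simp del: map_map split: option.splits\<close>)
  then show ?case using R by (auto intro: steps_trans)
qed

end

section \<open>Registers and computable functions\<close>

fun downrec :: "nat \<Rightarrow> nat \<Rightarrow> (nat \<Rightarrow> nat \<Rightarrow> nat) \<Rightarrow> nat" where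
  "downrec 0 a h = a"
| "downrec (Suc r) a h = downrec r (h r a) h"

lemma downrec_sum: "downrec n a (\<lambda>r acc. acc + g r) = a + (\<Sum>r<n. g r)"
  by (induction n arbitrary: a) auto

lemma downrec_const: "downrec n a (\<lambda>r. h) = (h ^^ n) a"
  by (induction n arbitrary: a) (auto simp: funpow_swap1)

context subroutine begin

text \<open>
  A register is a tape whose head position is the value; the only non-blank symbol is a mark in cell 0,
  which makes the test for zero possible. Register \<open>x\<close> is tape \<open>base + x\<close>, and register 0 is the
  one that follows the output head of the subroutine.
\<close>

definition mark :: "nat \<Rightarrow> nat" where "mark i = (if i = 0 then 1 else 0)"

definition with_regs :: "store \<Rightarrow> (nat \<Rightarrow> nat) \<Rightarrow> store" where
  "with_regs s \<rho> = (\<lambda>\<tau>. if \<tau> < base then s \<tau> else (\<rho> (\<tau> - base), mark))"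

definition inc where "inc x = Act (base + x) (\<lambda>y. (y, Right))"
definition dec where "dec x = Act (base + x) (\<lambda>y. (y, Left))"
definition loop where "loop x c = While (base + x) (\<lambda>y. y = 0) c"

lemma with_regs_upd: "(with_regs s \<rho>)(base + x := (v, mark)) = with_regs s (\<rho>(x := v))"
  by (auto simp: with_regs_def fun_eq_iff)

lemma with_regs_reg [simp]: "with_regs s \<rho> (base + x) = (\<rho> x, mark)"
  by (simp add: with_regs_def)

lemma with_regs_reg' [simp]: "with_regs s \<rho> (Suc (Suc (np + x))) = (\<rho> x, mark)"
  using with_regs_reg[of s \<rho> x] by simp

lemma exec_inc: "exec (inc x) (with_regs s \<rho>) (with_regs s (\<rho>(x := Suc (\<rho> x))))"
  unfolding inc_def by (rule exec_Act) (simp add: act_def flip: with_regs_upd)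

lemma exec_dec: "exec (dec x) (with_regs s \<rho>) (with_regs s (\<rho>(x := \<rho> x - 1)))"
  unfolding dec_def by (rule exec_Act) (simp add: act_def flip: with_regs_upd)

lemma exec_loop_zero: "\<rho> x = 0 \<Longrightarrow> exec (loop x c) (with_regs s \<rho>) (with_regs s \<rho>)"
  unfolding loop_def by (rule exec_WhileF) (simp add: mark_def)

lemma exec_loop_step:
  "\<rho> x \<noteq> 0 \<Longrightarrow> exec c (with_regs s \<rho>) s' \<Longrightarrow> exec (loop x c) s' s'' \<Longrightarrow>
    exec (loop x c) (with_regs s \<rho>) s''"
  unfolding loop_def by (rule exec_WhileT) (auto simp: mark_def)

lemma exec_loop:
  assumes "\<And>i. i \<le> n \<Longrightarrow> S i (base + x) = (i, mark)"
    and "\<And>i. i < n \<Longrightarrow> exec c (S (Suc i)) (S i)"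
  shows "exec (loop x c) (S n) (S 0)"
  using assms
proof (induction n)
  case 0
  then show ?case unfolding loop_def by (intro exec_WhileF) (simp add: mark_def)
next
  case (Suc n)
  then have "exec (loop x c) (S n) (S 0)" by simp
  then show ?case using Suc.prems(1)[of "Suc n"] Suc.prems(2)[of n] unfolding loop_def
    by (auto simp: mark_def intro: exec_WhileT[of _ "S (Suc n)"])
qed

lemma simple_writes [simp]: "writes_below k (inc x)" "writes_below k (dec x)"
  "writes_below k (loop x c) = writes_below k c"
  by (simp_all add: inc_def dec_def loop_def)

text \<open>
  The commands that follow are the usual counter machine idioms. In \<open>copy x y z\<close> the register
  \<open>z\<close> is scratch space from which \<open>x\<close> is restored.
\<close>

definition clear where "clear x = loop x (dec x)"
definition move where "move x y = loop x (dec x ;; inc y)"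
definition copy where "copy x y z = loop x (dec x ;; inc y ;; inc z) ;; move z x"

lemma upd_eq: "s = s' \<Longrightarrow> \<rho> = \<rho>' \<Longrightarrow> with_regs s \<rho> = with_regs s' \<rho>'" by simp

lemma exec_clear: "exec (clear x) (with_regs s \<rho>) (with_regs s (\<rho>(x := 0)))"
  using exec_loop[where S = "\<lambda>i. with_regs s (\<rho>(x := i))" and n = "\<rho> x" and x = x and c = "dec x"]
    exec_dec[of x s "\<rho>(x := Suc i)" for i]
  unfolding clear_def by simp

lemma exec_move:
  assumes "x \<noteq> y"
  shows "exec (move x y) (with_regs s \<rho>) (with_regs s (\<rho>(x := 0, y := \<rho> y + \<rho> x)))"
proof -
  let ?S = "\<lambda>i. with_regs s (\<rho>(x := i, y := \<rho> y + \<rho> x - i))"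
  have "exec (dec x ;; inc y) (?S (Suc i)) (?S i)" if "i < \<rho> x" for i
    by (rule exec_Seq[OF exec_dec], rule back_subst[of "exec _ _", OF exec_inc])
      (use assms that in \<open>auto intro!: upd_eq simp: Suc_diff_Suc Suc_diff_le\<close>)
  from exec_loop[where S = ?S and n = "\<rho> x" and x = x, OF _ this] show ?thesis
    unfolding move_def using assms by (simp add: fun_upd_idem)
qed

lemma exec_copy:
  assumes "x \<noteq> y" "x \<noteq> z" "y \<noteq> z" "\<rho> y = 0" "\<rho> z = 0"
  shows "exec (copy x y z) (with_regs s \<rho>) (with_regs s (\<rho>(y := \<rho> x)))"
proof -
  let ?S = "\<lambda>i. with_regs s (\<rho>(x := i, y := \<rho> x - i, z := \<rho> x - i))"
  have "exec (dec x ;; inc y ;; inc z) (?S (Suc i)) (?S i)" if "i < \<rho> x" for i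
    by (rule exec_Seq[OF exec_dec], rule exec_Seq[OF exec_inc], rule back_subst[of "exec _ _", OF exec_inc])
      (use assms that in \<open>auto intro!: upd_eq simp: Suc_diff_Suc\<close>)
  from exec_loop[where S = ?S and n = "\<rho> x" and x = x, OF _ this]
  have 1: "exec (loop x (dec x ;; inc y ;; inc z)) (with_regs s \<rho>) (?S 0)"
    using assms by (simp add: fun_upd_idem)
  show ?thesis unfolding copy_def
    by (rule exec_Seq[OF 1], rule back_subst[of "exec _ _", OF exec_move])
      (use assms in \<open>auto intro!: upd_eq\<close>)
qed

lemma copy_writes [simp]: "writes_below k (clear x)" "writes_below k (move x y)" "writes_below k (copy x y z)"
  by (simp_all add: clear_def move_def copy_def)

text \<open>
  A function is computable if it can be evaluated on arguments in arbitrary registers below \<open>K\<close>, with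
  \<open>K\<close> as target and all registers above \<open>K\<close> as scratch space that is zero before and after. The
  freedom in the choice of the argument registers and of \<open>K\<close> is what makes substitution and
  recursion compose.
\<close>

definition evaluates :: "com \<Rightarrow> nat \<Rightarrow> nat list \<Rightarrow> (nat list \<Rightarrow> nat) \<Rightarrow> bool" where
  "evaluates c K vs f \<longleftrightarrow> (\<forall>k. writes_below k c) \<and> (\<forall>s \<rho>. (\<forall>x\<ge>K. \<rho> x = 0) \<longrightarrow>
     exec c (with_regs s \<rho>) (with_regs s (\<rho>(K := f (map \<rho> vs)))))"

definition computable :: "nat \<Rightarrow> (nat list \<Rightarrow> nat) \<Rightarrow> bool" where
  "computable m f \<longleftrightarrow>
     (\<forall>vs K. length vs = m \<and> (\<forall>i\<in>set vs. i < K) \<longrightarrow> (\<exists>c. evaluates c K vs f))"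

lemma evaluatesI:
  assumes "\<And>k. writes_below k c"
    "\<And>s \<rho>. \<forall>x\<ge>K. \<rho> x = 0 \<Longrightarrow> exec c (with_regs s \<rho>) (with_regs s (\<rho>(K := f (map \<rho> vs))))"
  shows "evaluates c K vs f"
  using assms unfolding evaluates_def by blast

lemma evaluates_writes: "evaluates c K vs f \<Longrightarrow> writes_below k c"
  unfolding evaluates_def by blast

lemma evaluates_exec:
  "evaluates c K vs f \<Longrightarrow> \<forall>x\<ge>K. \<rho> x = 0 \<Longrightarrow>
    exec c (with_regs s \<rho>) (with_regs s (\<rho>(K := f (map \<rho> vs))))"
  unfolding evaluates_def by blast

lemma computableE:
  assumes "computable m f" "length vs = m" "\<forall>i\<in>set vs. i < K"
  obtains c where "evaluates c K vs f"
  using assms unfolding computable_def by blast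

lemma computableI:
  assumes "\<And>vs K. length vs = m \<Longrightarrow> \<forall>i\<in>set vs. i < K \<Longrightarrow> \<exists>c. evaluates c K vs f"
  shows "computable m f"
  using assms unfolding computable_def by blast

lemma comp_cong:
  assumes "computable m f" "\<And>xs. length xs = m \<Longrightarrow> f xs = g xs"
  shows "computable m g"
  using assms unfolding computable_def evaluates_def by (metis length_map)

lemma comp_0: "computable m (\<lambda>xs. 0)"
proof (rule computableI)
  fix vs and K :: nat
  have "evaluates Skip K vs (\<lambda>xs. 0)"
    by (rule evaluatesI) (auto simp: fun_upd_idem intro: exec_Skip)
  then show "\<exists>c. evaluates c K vs (\<lambda>xs. 0)" by blast
qed

lemma comp_Suc:
  assumes "computable m f" shows "computable m (\<lambda>xs. Suc (f xs))"
proof (rule computableI)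
  fix vs :: "nat list" and K assume "length vs = m" "\<forall>i\<in>set vs. i < K"
  then obtain c where c: "evaluates c K vs f" using computableE[OF assms] by blast
  have "evaluates (c ;; inc K) K vs (\<lambda>xs. Suc (f xs))"
  proof (rule evaluatesI)
    fix s and \<rho> :: "nat \<Rightarrow> nat" assume z: "\<forall>x\<ge>K. \<rho> x = 0"
    show "exec (c ;; inc K) (with_regs s \<rho>) (with_regs s (\<rho>(K := Suc (f (map \<rho> vs)))))"
      by (rule exec_Seq[OF evaluates_exec[OF c z]], rule back_subst[of "exec _ _", OF exec_inc]) simp
  qed (use evaluates_writes[OF c] in simp)
  then show "\<exists>c. evaluates c K vs (\<lambda>xs. Suc (f xs))" by blast
qed

lemma comp_var:
  assumes "i < m" shows "computable m (\<lambda>xs. xs ! i)"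
proof (rule computableI)
  fix vs :: "nat list" and K assume vs: "length vs = m" "\<forall>i\<in>set vs. i < K"
  then have i: "vs ! i < K" using assms by auto
  have "evaluates (copy (vs ! i) K (Suc K)) K vs (\<lambda>xs. xs ! i)"
  proof (rule evaluatesI)
    fix s and \<rho> :: "nat \<Rightarrow> nat" assume z: "\<forall>x\<ge>K. \<rho> x = 0"
    have "exec (copy (vs ! i) K (Suc K)) (with_regs s \<rho>) (with_regs s (\<rho>(K := \<rho> (vs ! i))))"
      by (rule exec_copy) (use i z in auto)
    then show "exec (copy (vs ! i) K (Suc K)) (with_regs s \<rho>) (with_regs s (\<rho>(K := map \<rho> vs ! i)))"
      using vs assms by simp
  qed simp
  then show "\<exists>c. evaluates c K vs (\<lambda>xs. xs ! i)" by blast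
qed

lemma comp_rename:
  assumes "computable (length js) g" "\<forall>j\<in>set js. j < m"
  shows "computable m (\<lambda>xs. g (map ((!) xs) js))"
proof (rule computableI)
  fix vs :: "nat list" and K assume vs: "length vs = m" "\<forall>i\<in>set vs. i < K"
  let ?vs = "map ((!) vs) js"
  have "length ?vs = length js" "\<forall>i\<in>set ?vs. i < K" using vs assms by auto
  then obtain c where c: "evaluates c K ?vs g" using computableE[OF assms(1)] by blast
  have "map \<rho> ?vs = map ((!) (map \<rho> vs)) js" for \<rho> :: "nat \<Rightarrow> nat" using vs assms by auto
  then have "evaluates c K vs (\<lambda>xs. g (map ((!) xs) js))"
    using c unfolding evaluates_def by metis
  then show "\<exists>c. evaluates c K vs (\<lambda>xs. g (map ((!) xs) js))" by blast
qed

lemma comp_let: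
  assumes "computable m f" "computable (Suc m) g"
  shows "computable m (\<lambda>xs. g (f xs # xs))"
proof (rule computableI)
  fix vs :: "nat list" and K assume vs: "length vs = m" "\<forall>i\<in>set vs. i < K"
  then obtain c where c: "evaluates c K vs f" using computableE[OF assms(1)] by blast
  have "length (K # vs) = Suc m" "\<forall>i\<in>set (K # vs). i < Suc K" using vs by auto
  then obtain d where d: "evaluates d (Suc K) (K # vs) g" using computableE[OF assms(2)] by blast
  let ?c = "c ;; d ;; clear K ;; move (Suc K) K"
  have new: "K \<notin> set vs" "Suc K \<notin> set vs" using vs by auto
  have "evaluates ?c K vs (\<lambda>xs. g (f xs # xs))"
  proof (rule evaluatesI)
    fix s and \<rho> :: "nat \<Rightarrow> nat" assume z: "\<forall>x\<ge>K. \<rho> x = 0"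
    show "exec ?c (with_regs s \<rho>) (with_regs s (\<rho>(K := g (f (map \<rho> vs) # map \<rho> vs))))"
      by (rule exec_Seq[OF evaluates_exec[OF c z]], rule exec_Seq[OF evaluates_exec[OF d]], use z in simp,
          rule exec_Seq[OF exec_clear], rule back_subst[of "exec _ _", OF exec_move])
        (use z new in \<open>auto intro!: upd_eq\<close>)
  qed (use evaluates_writes[OF c] evaluates_writes[OF d] in simp)
  then show "\<exists>c. evaluates c K vs (\<lambda>xs. g (f xs # xs))" by blast
qed

text \<open>
  Recursion runs downwards: register \<open>K\<close> holds the number of remaining rounds and serves at the same
  time as the index of the current round, so no second counter is needed.
\<close>

lemma comp_downrec:
  assumes "computable m n" "computable m a" "computable (Suc (Suc m)) h"
  shows "computable m (\<lambda>xs. downrec (n xs) (a xs) (\<lambda>r acc. h (r # acc # xs)))"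
proof (rule computableI)
  fix vs :: "nat list" and K assume vs: "length vs = m" "\<forall>i\<in>set vs. i < K"
  then obtain cn where cn: "evaluates cn K vs n" using computableE[OF assms(1)] by blast
  have "\<forall>i\<in>set vs. i < Suc K" using vs by auto
  then obtain ca where ca: "evaluates ca (Suc K) vs a" using computableE[OF assms(2) vs(1)] by blast
  have "length (K # Suc K # vs) = Suc (Suc m)" "\<forall>i\<in>set (K # Suc K # vs). i < Suc (Suc K)"
    using vs by auto
  then obtain ch where ch: "evaluates ch (Suc (Suc K)) (K # Suc K # vs) h"
    using computableE[OF assms(3)] by blast
  let ?body = "dec K ;; ch ;; clear (Suc K) ;; move (Suc (Suc K)) (Suc K)"
  let ?c = "cn ;; ca ;; loop K ?body ;; move (Suc K) K"
  have new: "K \<notin> set vs" "Suc K \<notin> set vs" using vs by auto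
  have L: "exec (loop K ?body) (with_regs s (\<rho>(K := r, Suc K := b)))
      (with_regs s (\<rho>(K := 0, Suc K := downrec r b (\<lambda>r acc. h (r # acc # map \<rho> vs)))))"
    if z: "\<forall>x\<ge>K. \<rho> x = 0" for s \<rho> r b
  proof (induction r arbitrary: b)
    case 0
    then show ?case by (auto intro!: exec_loop_zero)
  next
    case (Suc r)
    have "exec ?body (with_regs s (\<rho>(K := Suc r, Suc K := b)))
       (with_regs s (\<rho>(K := r, Suc K := h (r # b # map \<rho> vs))))"
      by (rule exec_Seq[OF exec_dec], rule exec_Seq[OF evaluates_exec[OF ch]], use z in simp,
          rule exec_Seq[OF exec_clear], rule back_subst[of "exec _ _", OF exec_move])
        (use z new in \<open>auto intro!: upd_eq simp: fun_upd_twist\<close>)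
    from exec_loop_step[OF _ this Suc.IH] show ?case by (simp add: fun_upd_def)
  qed
  have "evaluates ?c K vs (\<lambda>xs. downrec (n xs) (a xs) (\<lambda>r acc. h (r # acc # xs)))"
  proof (rule evaluatesI)
    fix s and \<rho> :: "nat \<Rightarrow> nat" assume z: "\<forall>x\<ge>K. \<rho> x = 0"
    let ?\<rho> = "\<rho>(K := n (map \<rho> vs))"
    have 2: "exec ca (with_regs s ?\<rho>) (with_regs s (?\<rho>(Suc K := a (map \<rho> vs))))"
      using evaluates_exec[OF ca, of ?\<rho> s] z new by simp
    show "exec ?c (with_regs s \<rho>)
        (with_regs s (\<rho>(K := downrec (n (map \<rho> vs)) (a (map \<rho> vs)) (\<lambda>r acc. h (r # acc # map \<rho> vs)))))"
      by (rule exec_Seq[OF evaluates_exec[OF cn z]], rule exec_Seq[OF 2], rule exec_Seq[OF L[OF z]],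
         rule back_subst[of "exec _ _", OF exec_move]) (use z in \<open>auto intro!: upd_eq\<close>)
  qed (use evaluates_writes[OF cn] evaluates_writes[OF ca] evaluates_writes[OF ch] in simp)
  then show "\<exists>c. evaluates c K vs (\<lambda>xs. downrec (n xs) (a xs) (\<lambda>r acc. h (r # acc # xs)))" by blast
qed

lemma comp_drop:
  assumes "computable m f" shows "computable (l + m) (\<lambda>ys. f (drop l ys))"
proof -
  have "computable (length [l..<l + m]) f" using assms by simp
  from comp_rename[OF this, of "l + m"] have "computable (l + m) (\<lambda>xs. f (map ((!) xs) [l..<l + m]))" by simp
  then show ?thesis by (rule comp_cong) (auto intro!: arg_cong[of _ _ f] nth_equalityI)
qed

lemma comp_take:
  assumes "computable l f" shows "computable (l + m) (\<lambda>ys. f (take l ys))"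
proof -
  have "computable (length [0..<l]) f" using assms by simp
  from comp_rename[OF this, of "l + m"] have "computable (l + m) (\<lambda>xs. f (map ((!) xs) [0..<l]))" by simp
  then show ?thesis by (rule comp_cong) (auto intro!: arg_cong[of _ _ f] nth_equalityI)
qed

lemma comp_append:
  assumes "computable (length fs + m) g" "\<forall>f\<in>set fs. computable m f"
  shows "computable m (\<lambda>xs. g (map (\<lambda>f. f xs) fs @ xs))"
  using assms
proof (induction fs arbitrary: g)
  case (Cons f fs)
  have "computable (length fs + m) (\<lambda>ys. g (f (drop (length fs) ys) # ys))"
    by (rule comp_let) (use Cons.prems comp_drop in auto)
  from Cons.IH[OF this] show ?case using Cons.prems by simp
qed simp

lemma comp_compose:
  assumes "computable (length fs) g" "\<forall>f\<in>set fs. computable m f"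
  shows "computable m (\<lambda>xs. g (map (\<lambda>f. f xs) fs))"
  using comp_append[OF comp_take[OF assms(1)] assms(2)] by simp

lemma comp_subst1:
  assumes "computable 1 (\<lambda>xs. g (xs ! 0))" "computable m a"
  shows "computable m (\<lambda>xs. g (a xs))"
  using comp_compose[of "[a]" "\<lambda>xs. g (xs ! 0)" m] assms by simp

lemma comp_subst2:
  assumes "computable 2 (\<lambda>xs. g (xs ! 0) (xs ! 1))" "computable m a" "computable m b"
  shows "computable m (\<lambda>xs. g (a xs) (b xs))"
  using comp_compose[of "[a, b]" "\<lambda>xs. g (xs ! 0) (xs ! 1)" m] assms by (simp add: numeral_eq_Suc)

lemma comp_subst3:
  assumes "computable 3 (\<lambda>xs. g (xs ! 0) (xs ! 1) (xs ! 2))" "computable m a" "computable m b" "computable m c"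
  shows "computable m (\<lambda>xs. g (a xs) (b xs) (c xs))"
  using comp_compose[of "[a, b, c]" "\<lambda>xs. g (xs ! 0) (xs ! 1) (xs ! 2)" m] assms
  by (simp add: numeral_eq_Suc)

lemma comp_subst4:
  assumes "computable 4 (\<lambda>xs. g (xs ! 0) (xs ! 1) (xs ! 2) (xs ! 3))" "computable m a" "computable m b" "computable m c" "computable m d"
  shows "computable m (\<lambda>xs. g (a xs) (b xs) (c xs) (d xs))"
  using comp_compose[of "[a, b, c, d]" "\<lambda>xs. g (xs ! 0) (xs ! 1) (xs ! 2) (xs ! 3)" m] assms
  by (simp add: numeral_eq_Suc)

lemma comp_subst5:
  assumes "computable 5 (\<lambda>xs. g (xs ! 0) (xs ! 1) (xs ! 2) (xs ! 3) (xs ! 4))"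
    "computable m a" "computable m b" "computable m c" "computable m d" "computable m e"
  shows "computable m (\<lambda>xs. g (a xs) (b xs) (c xs) (d xs) (e xs))"
  using comp_compose[of "[a, b, c, d, e]" "\<lambda>xs. g (xs ! 0) (xs ! 1) (xs ! 2) (xs ! 3) (xs ! 4)" m] assms
  by (simp add: numeral_eq_Suc)

lemma comp_subst6:
  assumes "computable 6 (\<lambda>xs. g (xs ! 0) (xs ! 1) (xs ! 2) (xs ! 3) (xs ! 4) (xs ! 5))"
    "computable m a" "computable m b" "computable m c" "computable m d" "computable m e" "computable m f"
  shows "computable m (\<lambda>xs. g (a xs) (b xs) (c xs) (d xs) (e xs) (f xs))"
  using comp_compose[of "[a, b, c, d, e, f]" "\<lambda>xs. g (xs ! 0) (xs ! 1) (xs ! 2) (xs ! 3) (xs ! 4) (xs ! 5)" m] assms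
  by (simp add: numeral_eq_Suc)

lemma comp_const: "computable m (\<lambda>xs. k)"
  by (induction k) (auto intro: comp_0 comp_Suc)

lemma comp_tl1: "Suc i < m \<Longrightarrow> computable m (\<lambda>xs. tl xs ! i)"
  by (rule comp_cong[OF comp_var[of "Suc i"]]) (auto simp: nth_tl)
lemma comp_tl2: "Suc (Suc i) < m \<Longrightarrow> computable m (\<lambda>xs. tl (tl xs) ! i)"
  by (rule comp_cong[OF comp_var[of "Suc (Suc i)"]]) (auto simp: nth_tl)
lemma comp_tl3: "Suc (Suc (Suc i)) < m \<Longrightarrow> computable m (\<lambda>xs. tl (tl (tl xs)) ! i)"
  by (rule comp_cong[OF comp_var[of "Suc (Suc (Suc i))"]]) (auto simp: nth_tl)

lemmas comp_vars = comp_const comp_var comp_tl1 comp_tl2 comp_tl3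

lemma comp_add:
  assumes "computable m f" "computable m g" shows "computable m (\<lambda>xs. f xs + g xs)"
proof -
  have "computable m (\<lambda>xs. downrec (g xs) (f xs) (\<lambda>r acc. (\<lambda>ys. Suc (ys ! 1)) (r # acc # xs)))"
    by (intro comp_downrec assms comp_Suc comp_var) simp
  then show ?thesis by (rule comp_cong) (simp add: downrec_const)
qed

text \<open>
  In this rule and in those for quantifiers the bound variable becomes the first argument. The premise
  has the form in which resolution instantiates it for a concrete function, so that computability of
  explicit terms is proved by the introduction rules alone.
\<close>

lemma comp_sum:
  assumes "computable m n" "computable (Suc m) (\<lambda>ys. g (ys ! 0) (tl ys))"
  shows "computable m (\<lambda>xs. \<Sum>j<n xs. g j xs)"
proof -
  have "length (0 # [2..<m + 2]) = Suc m" by (simp del: upt_Suc)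
  then have "computable (length (0 # [2..<m + 2])) (\<lambda>ys. g (ys ! 0) (tl ys))" using assms by metis
  from comp_rename[OF this, of "Suc (Suc m)"]
  have "computable (Suc (Suc m)) (\<lambda>ys. g (ys ! 0) (map ((!) ys) [2..<m + 2]))"
    by (simp del: upt_Suc add_2_eq_Suc' add_2_eq_Suc)
  then have "computable (Suc (Suc m)) (\<lambda>ys. g (ys ! 0) (tl (tl ys)))"
    by (rule comp_cong)
      (auto intro!: arg_cong[of _ _ "g _"] nth_equalityI simp: nth_tl simp del: upt_Suc)
  then have "computable m (\<lambda>xs. downrec (n xs) 0 (\<lambda>r acc. (\<lambda>ys. ys ! 1 + g (ys ! 0) (tl (tl ys))) (r # acc # xs)))"
    by (intro comp_downrec assms comp_add comp_var comp_const) auto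
  then show ?thesis by (rule comp_cong) (simp add: downrec_sum)
qed

lemma comp_mult:
  assumes "computable m f" "computable m g" shows "computable m (\<lambda>xs. f xs * g xs)"
proof -
  have "computable m (\<lambda>xs. \<Sum>j<f xs. g xs)"
    by (rule comp_sum[OF assms(1)], rule comp_cong[OF comp_drop[OF assms(2), of 1, simplified]])
      (simp add: drop_Suc)
  then show ?thesis by (rule comp_cong) simp
qed

lemma comp_weaken: "computable m f \<Longrightarrow> computable (Suc m) (\<lambda>ys. f (tl ys))"
  using comp_drop[of m f 1] by (simp add: drop_Suc)

lemma comp_is_zero:
  assumes "computable m f" shows "computable m (\<lambda>xs. of_bool (f xs = 0))"
proof -
  have "computable m (\<lambda>xs. downrec (f xs) 1 (\<lambda>r acc. (\<lambda>ys. 0) (r # acc # xs)))"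
    by (intro comp_downrec assms comp_const)
  moreover have "downrec n 1 (\<lambda>r acc. 0) = of_bool (n = 0)" for n
    by (cases n) (auto simp: downrec_const)
  ultimately show ?thesis by simp
qed

lemma comp_Not:
  assumes "computable m (\<lambda>xs. of_bool (P xs))" shows "computable m (\<lambda>xs. of_bool (\<not> P xs))"
  by (rule comp_cong[OF comp_is_zero[OF assms]]) simp

lemma comp_pred:
  assumes "computable m f" shows "computable m (\<lambda>xs. f xs - 1)"
proof -
  have "computable m (\<lambda>xs. \<Sum>j<f xs. of_bool (\<not> j = 0))"
    by (intro comp_sum assms comp_Not comp_is_zero comp_vars) auto
  moreover have "(\<Sum>j<n. of_bool (\<not> j = 0)) = n - 1" for n :: nat
    by (induction n) auto
  ultimately show ?thesis by simp
qed

lemma comp_diff: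
  assumes "computable m f" "computable m g" shows "computable m (\<lambda>xs. f xs - g xs)"
proof -
  have "computable m (\<lambda>xs. downrec (g xs) (f xs) (\<lambda>r acc. (\<lambda>ys. ys ! 1 - 1) (r # acc # xs)))"
    by (intro comp_downrec assms comp_pred comp_var) simp
  moreover have "((\<lambda>a. a - Suc 0) ^^ n) b = b - n" for n b :: nat
    by (induction n) auto
  ultimately show ?thesis by (simp add: downrec_const)
qed

lemma comp_power:
  assumes "computable m f" "computable m g" shows "computable m (\<lambda>xs. f xs ^ g xs)"
proof -
  have "computable (Suc (Suc m)) (\<lambda>ys. ys ! 1 * f (tl (tl ys)))"
    by (intro comp_mult comp_var) (auto intro: comp_weaken assms comp_weaken[of _ "\<lambda>ys. f (tl ys)"])
  then have "computable m (\<lambda>xs. downrec (g xs) 1 (\<lambda>r acc. (\<lambda>ys. ys ! 1 * f (tl (tl ys))) (r # acc # xs)))"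
    by (intro comp_downrec assms comp_const)
  moreover have "((\<lambda>a. a * b) ^^ n) 1 = b ^ n" for n b :: nat
    by (induction n) auto
  ultimately show ?thesis by (simp add: downrec_const)
qed

lemma comp_le:
  assumes "computable m f" "computable m g" shows "computable m (\<lambda>xs. of_bool (f xs \<le> g xs))"
  by (rule comp_cong[OF comp_is_zero[OF comp_diff[OF assms]]]) simp

lemma comp_less:
  assumes "computable m f" "computable m g" shows "computable m (\<lambda>xs. of_bool (f xs < g xs))"
  by (rule comp_cong[OF comp_Not[OF comp_le[OF assms(2,1)]]]) (simp add: not_le)

lemma comp_conj:
  assumes "computable m (\<lambda>xs. of_bool (P xs))" "computable m (\<lambda>xs. of_bool (Q xs))"
  shows "computable m (\<lambda>xs. of_bool (P xs \<and> Q xs))"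
  by (rule comp_cong[OF comp_mult[OF assms]]) simp

lemma comp_eq:
  assumes "computable m f" "computable m g" shows "computable m (\<lambda>xs. of_bool (f xs = g xs))"
  by (rule comp_cong[OF comp_conj[OF comp_le[OF assms] comp_le[OF assms(2,1)]]]) auto

lemma comp_all:
  assumes "computable m n" "computable (Suc m) (\<lambda>ys. of_bool (P (ys ! 0) (tl ys)))"
  shows "computable m (\<lambda>xs. of_bool (\<forall>j<n xs. P j xs))"
proof -
  have "computable m (\<lambda>xs. of_bool ((\<Sum>j<n xs. of_bool (\<not> P j xs) :: nat) = 0))"
    by (intro comp_is_zero comp_sum comp_Not assms)
  then show ?thesis by (rule comp_cong) (auto simp: Ball_def)
qed

lemma comp_ex:
  assumes "computable m n" "computable (Suc m) (\<lambda>ys. of_bool (P (ys ! 0) (tl ys)))"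
  shows "computable m (\<lambda>xs. of_bool (\<exists>j<n xs. P j xs))"
proof -
  have "computable m (\<lambda>xs. of_bool (\<not> (\<forall>j<n xs. \<not> P j xs)))"
    by (intro comp_all comp_Not assms)
  then show ?thesis by (rule comp_cong) auto
qed

lemma div_as_sum:
  fixes a b :: nat
  assumes "0 < b" shows "(\<Sum>c<a. of_bool ((c + 1) * b \<le> a)) = a div b"
proof -
  have "{c. c < a \<and> (c + 1) * b \<le> a} = {..<a div b}"
  proof -
    have "c < a \<and> (c + 1) * b \<le> a \<longleftrightarrow> c < a div b" for c
      using assms by (metis Suc_eq_plus1 div_le_dividend less_eq_div_iff_mult_less_eq order_less_le_trans Suc_le_eq)
    then show ?thesis by auto
  qed
  moreover have "{c. c < a \<and> (c + 1) * b \<le> a} = {..<a} \<inter> {c. (c + 1) * b \<le> a}" by auto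
  ultimately have "card ({..<a} \<inter> {c. (c + 1) * b \<le> a}) = a div b" by (metis card_lessThan)
  then show ?thesis by (simp only: sum_of_bool_eq finite_lessThan of_nat_id)
qed

lemma comp_div:
  assumes "computable m f" "computable m g" shows "computable m (\<lambda>xs. f xs div g xs)"
proof -
  have 2: "computable 2 (\<lambda>xs. of_bool (0 < xs ! 1) * (\<Sum>c<xs ! 0. of_bool ((c + 1) * (xs ! 1) \<le> xs ! 0)))"
    by (intro comp_mult comp_less comp_sum comp_le comp_add comp_vars) auto
  have "computable 2 (\<lambda>xs. xs ! 0 div xs ! 1)"
    by (rule comp_cong[OF 2]) (use div_as_sum in \<open>auto simp: Suc_le_eq\<close>)
  from comp_subst2[OF this assms] show ?thesis .
qed

lemma comp_mod:
  assumes "computable m f" "computable m g" shows "computable m (\<lambda>xs. f xs mod g xs)"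
  by (rule comp_cong[OF comp_diff[OF assms(1) comp_mult[OF assms(2) comp_div[OF assms]]]])
    (simp add: modulo_nat_def mult.commute)

lemmas comp_intros = comp_vars comp_Suc comp_add comp_mult comp_diff comp_power comp_div comp_mod comp_sum
  comp_le comp_less comp_eq comp_conj comp_Not comp_all comp_ex

end

section \<open>The arithmetic of the decoding\<close>

text \<open>
  A bit string is represented by the number with a leading 1 in front of it, so that its length is not
  lost. All functions below are built from arithmetic and bounded sums; \<open>V\<close> is the number of the
  program and \<open>W\<close> the number of the list of cubes.
\<close>

definition num :: "bool list \<Rightarrow> nat" where
  "num bs = foldl (\<lambda>v b. 2 * v + of_bool b) 1 bs"

definition bit_len :: "nat \<Rightarrow> nat" where
  "bit_len W = (\<Sum>i<W. of_bool (2 ^ Suc i \<le> W))"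

definition bit_at :: "nat \<Rightarrow> nat \<Rightarrow> nat" where
  "bit_at W i = (W div 2 ^ (bit_len W - Suc i)) mod 2"

definition lead_ones :: "nat \<Rightarrow> nat" where
  "lead_ones W = (\<Sum>i<bit_len W. of_bool (\<forall>j<Suc i. bit_at W j = 1))"

text \<open>
  A program is well formed if it consists of \<open>a\<close> ones, a zero and exactly \<open>a\<^sup>2\<close> further bits. Such
  strings form a prefix-free set, and the overhead \<open>a + 1\<close> is only of the order of the
  square root of the length of the payload.
\<close>

definition well_formed :: "nat \<Rightarrow> bool" where
  "well_formed W \<longleftrightarrow> bit_len W = lead_ones W + 1 + lead_ones W ^ 2"

definition payload :: "nat \<Rightarrow> nat" where
  "payload W = W mod 2 ^ (lead_ones W ^ 2)"

text \<open>
  The encoding of a list of vectors with non-negative entries is a concatenation of numbers in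
  unary, since the sign bit of a non-negative integer looks like a unary 0. The number at place
  \<open>k\<close> is the number of ones with exactly \<open>k\<close> zeros before them.
\<close>

definition unary_at :: "nat \<Rightarrow> nat \<Rightarrow> nat" where
  "unary_at W k = (\<Sum>i<bit_len W. of_bool (bit_at W i = 1 \<and> (\<Sum>j<i. of_bool (bit_at W j = 0)) = k))"

text \<open>
  Place 0 holds the length of the list, and every entry takes two places, the first of them for its sign.
\<close>

definition pos :: "nat \<Rightarrow> nat \<Rightarrow> nat \<Rightarrow> nat \<Rightarrow> nat" where
  "pos d W r j = unary_at W (2 * (r * d + j) + 2)"

text \<open>
  The list may contain a cube several times; only first occurrences are counted.
\<close>

definition fresh :: "nat \<Rightarrow> nat \<Rightarrow> nat \<Rightarrow> bool" where
  "fresh d W r \<longleftrightarrow> (\<forall>r'<r. \<exists>j<d. \<not> pos d W r' j = pos d W r j)"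

text \<open>
  A code below \<open>H ^ d\<close> is read as a point whose coordinates have the numerators
  \<open>odd_digit H c j - H\<close> over \<open>H\<close>. Odd numerators over a power of two are automatically reduced
  fractions, so that the rational number is encoded without a computation of a gcd.
\<close>

definition odd_digit :: "nat \<Rightarrow> nat \<Rightarrow> nat \<Rightarrow> nat" where
  "odd_digit H c j = 2 * ((c div H ^ j) mod H) + 1"

text \<open>
  The next two conditions are the inequalities \<open>\<bar>(\<Sum>j<d. a j ^ 2) - H ^ 2\<bar> \<le> 2 * d * H\<close> and
  \<open>v j * a i - v i * a j \<le> R\<close> for \<open>a j = odd_digit H c j - H\<close> and \<open>v\<close> the difference of two
  positions, with the negative terms moved to the other side.
\<close>

definition on_shell :: "nat \<Rightarrow> nat \<Rightarrow> nat \<Rightarrow> bool" where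
  "on_shell d H c \<longleftrightarrow>
     (\<Sum>j<d. (odd_digit H c j)^2 + H^2) \<le> (\<Sum>j<d. 2 * odd_digit H c j * H) + H^2 + 2 * d * H \<and>
     (\<Sum>j<d. 2 * odd_digit H c j * H) + H^2 \<le> (\<Sum>j<d. (odd_digit H c j)^2 + H^2) + 2 * d * H"

definition in_tube :: "nat \<Rightarrow> nat \<Rightarrow> nat \<Rightarrow> nat \<Rightarrow> nat \<Rightarrow> nat \<Rightarrow> nat \<Rightarrow> bool" where
  "in_tube d W H R c r r' \<longleftrightarrow> (\<forall>i<d. \<forall>j<d.
     pos d W r j * odd_digit H c i + pos d W r' j * H + pos d W r' i * odd_digit H c j + pos d W r i * H
     \<le> pos d W r' j * odd_digit H c i + pos d W r j * H + pos d W r i * odd_digit H c j + pos d W r' i * H + R)"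

definition energy :: "nat \<Rightarrow> nat \<Rightarrow> nat \<Rightarrow> nat \<Rightarrow> nat \<Rightarrow> nat" where
  "energy d W H R c = (\<Sum>r<unary_at W 0. \<Sum>r'<unary_at W 0.
     of_bool (fresh d W r \<and> fresh d W r' \<and> in_tube d W H R c r r'))"

definition exceptional :: "nat \<Rightarrow> nat \<Rightarrow> nat \<Rightarrow> nat \<Rightarrow> nat \<Rightarrow> nat \<Rightarrow> bool" where
  "exceptional d W H R k c \<longleftrightarrow> on_shell d H c \<and> 2 ^ k \<le> energy d W H R c"

text \<open>
  The exceptional code of rank \<open>t\<close> is the number of codes \<open>x\<close> for which at most \<open>t\<close> exceptional codes
  are less than or equal to \<open>x\<close>.
\<close>

definition select :: "nat \<Rightarrow> nat \<Rightarrow> nat \<Rightarrow> nat \<Rightarrow> nat \<Rightarrow> nat \<Rightarrow> nat" where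
  "select d W H R k t = (\<Sum>x<H ^ d. of_bool ((\<Sum>y<Suc x. of_bool (exceptional d W H R k y)) \<le> t))"

text \<open>
  The three lowest digits of the payload in base \<open>radix V\<close> are the scale \<open>n\<close>, the scale \<open>m\<close> and the
  exponent \<open>k\<close> of the threshold; what remains above them is the rank of the code.
  The base is a polynomial in the length of the program, so these digits cost only logarithmically
  many bits.
\<close>

definition radix :: "nat \<Rightarrow> nat" where "radix V = (lead_ones V + 1) ^ 4"
definition field_n :: "nat \<Rightarrow> nat" where "field_n V = payload V mod radix V"
definition field_m :: "nat \<Rightarrow> nat" where "field_m V = (payload V div radix V) mod radix V"
definition field_k :: "nat \<Rightarrow> nat" where "field_k V = (payload V div radix V ^ 2) mod radix V"
definition field_t :: "nat \<Rightarrow> nat" where "field_t V = payload V div radix V ^ 3"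
text \<open>
  Grid points have coordinates with denominator \<open>mesh d n\<close>; the factor \<open>2 ^ d > d\<close> makes the grid
  finer than \<open>2 ^ (- n)\<close> in the Euclidean norm.
\<close>

definition mesh :: "nat \<Rightarrow> nat \<Rightarrow> nat" where "mesh d n = 2 ^ (n + d)"
definition tube_width :: "nat \<Rightarrow> nat \<Rightarrow> nat \<Rightarrow> nat" where
  "tube_width d n m = 4 * d * mesh d n * 2 ^ (n - m)"

definition grid :: "nat \<Rightarrow> nat \<Rightarrow> nat" where "grid d V = mesh d (field_n V)"
definition chosen :: "nat \<Rightarrow> nat \<Rightarrow> nat \<Rightarrow> nat" where
  "chosen d V W = select d W (grid d V) (tube_width d (field_n V) (field_m V)) (field_k V) (field_t V)"
definition numer :: "nat \<Rightarrow> nat \<Rightarrow> nat \<Rightarrow> nat \<Rightarrow> nat" where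
  "numer d V W j = odd_digit (grid d V) (chosen d V W) j"

context subroutine begin

text \<open>
  Every function joins the introduction rules as soon as its own computability is established, hence the
  growing rule collections.
\<close>

lemma comp_bit_len: "computable m f \<Longrightarrow> computable m (\<lambda>xs. bit_len (f xs))"
  by (rule comp_subst1[where g = bit_len], unfold bit_len_def, intro comp_intros) auto

lemmas comp_intros1 = comp_intros comp_bit_len

lemma comp_bit_at: "computable m f \<Longrightarrow> computable m g \<Longrightarrow> computable m (\<lambda>xs. bit_at (f xs) (g xs))"
  by (rule comp_subst2[where g = bit_at], unfold bit_at_def, intro comp_intros1) auto

lemmas comp_intros2 = comp_intros1 comp_bit_at

lemma comp_lead_ones: "computable m f \<Longrightarrow> computable m (\<lambda>xs. lead_ones (f xs))"
  by (rule comp_subst1[where g = lead_ones], unfold lead_ones_def, intro comp_intros2) auto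

lemmas comp_intros3 = comp_intros2 comp_lead_ones

lemma comp_well_formed: "computable m f \<Longrightarrow> computable m (\<lambda>xs. of_bool (well_formed (f xs)))"
  by (rule comp_subst1[where g = "\<lambda>x. of_bool (well_formed x)"], unfold well_formed_def, intro comp_intros3) auto

lemma comp_payload: "computable m f \<Longrightarrow> computable m (\<lambda>xs. payload (f xs))"
  by (rule comp_subst1[where g = payload], unfold payload_def, intro comp_intros3) auto

lemma comp_unary_at: "computable m f \<Longrightarrow> computable m g \<Longrightarrow> computable m (\<lambda>xs. unary_at (f xs) (g xs))"
  by (rule comp_subst2[where g = unary_at], unfold unary_at_def, intro comp_intros3) auto

lemmas comp_intros4 = comp_intros3 comp_payload comp_unary_at

lemma comp_pos: "computable m f \<Longrightarrow> computable m g \<Longrightarrow> computable m h \<Longrightarrow>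
    computable m (\<lambda>xs. pos d (f xs) (g xs) (h xs))"
  by (rule comp_subst3[where g = "pos d"], unfold pos_def, intro comp_intros4) auto

lemmas comp_intros5 = comp_intros4 comp_pos

lemma comp_fresh: "computable m f \<Longrightarrow> computable m g \<Longrightarrow>
    computable m (\<lambda>xs. of_bool (fresh d (f xs) (g xs)))"
  by (rule comp_subst2[where g = "\<lambda>x y. of_bool (fresh d x y)"], unfold fresh_def, intro comp_intros5) auto

lemma comp_odd_digit: "computable m f \<Longrightarrow> computable m g \<Longrightarrow> computable m h \<Longrightarrow>
    computable m (\<lambda>xs. odd_digit (f xs) (g xs) (h xs))"
  by (rule comp_subst3[where g = odd_digit], unfold odd_digit_def, intro comp_intros5) auto

lemmas comp_intros6 = comp_intros5 comp_fresh comp_odd_digit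

lemma comp_on_shell: "computable m f \<Longrightarrow> computable m g \<Longrightarrow>
    computable m (\<lambda>xs. of_bool (on_shell d (f xs) (g xs)))"
  by (rule comp_subst2[where g = "\<lambda>x y. of_bool (on_shell d x y)"], unfold on_shell_def, intro comp_intros6) auto

lemma comp_in_tube:
  assumes "computable m a" "computable m b" "computable m c" "computable m e" "computable m f" "computable m g"
  shows "computable m (\<lambda>xs. of_bool (in_tube d (a xs) (b xs) (c xs) (e xs) (f xs) (g xs)))"
  by (rule comp_subst6[where g = "\<lambda>a b c e f g. of_bool (in_tube d a b c e f g)", OF _ assms],
     unfold in_tube_def, intro comp_intros6) auto

lemmas comp_intros7 = comp_intros6 comp_on_shell comp_in_tube

lemma comp_energy:
  assumes "computable m a" "computable m b" "computable m c" "computable m e"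
  shows "computable m (\<lambda>xs. energy d (a xs) (b xs) (c xs) (e xs))"
  by (rule comp_subst4[where g = "energy d", OF _ assms], unfold energy_def, intro comp_intros7) auto

lemmas comp_intros8 = comp_intros7 comp_energy

lemma comp_exceptional:
  assumes "computable m a" "computable m b" "computable m c" "computable m e" "computable m f"
  shows "computable m (\<lambda>xs. of_bool (exceptional d (a xs) (b xs) (c xs) (e xs) (f xs)))"
  by (rule comp_subst5[where g = "\<lambda>a b c e f. of_bool (exceptional d a b c e f)", OF _ assms],
     unfold exceptional_def, intro comp_intros8) auto

lemmas comp_intros9 = comp_intros8 comp_exceptional

lemma comp_select:
  assumes "computable m a" "computable m b" "computable m c" "computable m e" "computable m f"
  shows "computable m (\<lambda>xs. select d (a xs) (b xs) (c xs) (e xs) (f xs))"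
  by (rule comp_subst5[where g = "select d", OF _ assms], unfold select_def, intro comp_intros9) auto

lemma comp_radix: "computable m f \<Longrightarrow> computable m (\<lambda>xs. radix (f xs))"
  by (rule comp_subst1[where g = radix], unfold radix_def, intro comp_intros9) auto

lemmas comp_intros10 = comp_intros9 comp_select comp_radix

lemma comp_fields:
  "computable m f \<Longrightarrow> computable m (\<lambda>xs. field_n (f xs))"
  "computable m f \<Longrightarrow> computable m (\<lambda>xs. field_m (f xs))"
  "computable m f \<Longrightarrow> computable m (\<lambda>xs. field_k (f xs))"
  "computable m f \<Longrightarrow> computable m (\<lambda>xs. field_t (f xs))"
  unfolding field_n_def field_m_def field_k_def field_t_def by (intro comp_intros10; assumption)+

lemma comp_grid: "computable m f \<Longrightarrow> computable m (\<lambda>xs. grid d (f xs))"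
  unfolding grid_def mesh_def by (intro comp_intros10 comp_fields)

lemma comp_numer: "computable m f \<Longrightarrow> computable m g \<Longrightarrow> computable m (\<lambda>xs. numer d (f xs) (g xs) j)"
  unfolding numer_def chosen_def tube_width_def mesh_def by (intro comp_intros10 comp_grid comp_fields)

end

lemma num_append_bounds: "num (xs @ ys) div 2 ^ length ys = num xs"
proof (induction ys rule: rev_induct)
  case (snoc y ys)
  have "num (xs @ ys @ [y]) = 2 * num (xs @ ys) + of_bool y" by (simp add: num_def)
  then have "num (xs @ ys @ [y]) div 2 = num (xs @ ys)" by simp
  then show ?case using snoc by (simp add: div_mult2_eq)
qed simp

lemma num_bounds: "2 ^ length bs \<le> num bs" "num bs < 2 ^ Suc (length bs)"
proof -
  have "num bs div 2 ^ length bs = 1" using num_append_bounds[of "[]" bs] by (simp add: num_def)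
  then show "2 ^ length bs \<le> num bs" "num bs < 2 ^ Suc (length bs)"
    by (metis One_nat_def div_less less_one not_le one_neq_zero,
        metis One_nat_def div_less_iff_less_mult lessI mult.commute numeral_2_eq_2 pos2 power_Suc2 zero_less_power)
qed

lemma bit_len_num [simp]: "bit_len (num bs) = length bs"
proof -
  have "{i. i < num bs \<and> 2 ^ Suc i \<le> num bs} = {..<length bs}"
  proof safe
    fix i assume "2 ^ Suc i \<le> num bs"
    then have "(2::nat) ^ Suc i < 2 ^ Suc (length bs)" using num_bounds(2)[of bs] by linarith
    then show "i < length bs" by (metis Suc_less_eq one_less_numeral_iff power_strict_increasing_iff semiring_norm(76))
  next
    fix i assume i: "i < length bs"
    then have "(2::nat) ^ Suc i \<le> 2 ^ length bs" by (intro power_increasing) auto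
    then show *: "2 ^ Suc i \<le> num bs" using num_bounds(1)[of bs] by linarith
    have "i < 2 ^ Suc i" using less_exp[of "Suc i"] by linarith
    then show "i < num bs" using * by linarith
  qed
  moreover have "{i. i < num bs \<and> 2 ^ Suc i \<le> num bs} = {..<num bs} \<inter> {i. 2 ^ Suc i \<le> num bs}" by auto
  ultimately have "card ({..<num bs} \<inter> {i. 2 ^ Suc i \<le> num bs}) = length bs" by (metis card_lessThan)
  then show ?thesis unfolding bit_len_def by (simp only: sum_of_bool_eq finite_lessThan of_nat_id)
qed

lemma bit_at_num [simp]:
  assumes "i < length bs" shows "bit_at (num bs) i = of_bool (bs ! i)"
proof -
  have "num bs div 2 ^ (length bs - Suc i) = num (take (Suc i) bs)"
    using num_append_bounds[of "take (Suc i) bs" "drop (Suc i) bs"] by simp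
  also have "\<dots> = 2 * num (take i bs) + of_bool (bs ! i)"
    using assms by (simp add: take_Suc_conv_app_nth num_def)
  finally show ?thesis unfolding bit_at_def by simp
qed

lemma lead_ones_num: "lead_ones (num bs) = length (takeWhile id bs)"
proof -
  have *: "{i. i < length bs \<and> (\<forall>j<Suc i. bs ! j)} = {..<length (takeWhile id bs)}" for bs
  proof safe
    fix i assume i: "i < length bs" "\<forall>j<Suc i. bs ! j"
    show "i < length (takeWhile id bs)"
    proof (rule ccontr)
      assume "\<not> ?thesis"
      then have "length (takeWhile id bs) < length bs" "length (takeWhile id bs) < Suc i" using i by auto
      then show False using nth_length_takeWhile[of id bs] i(2) by auto
    qed
  next
    fix i assume i: "i < length (takeWhile id bs)"
    then show "i < length bs" using length_takeWhile_le[of id bs] by linarith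
    fix j assume "j < Suc i"
    then have "j < length (takeWhile id bs)" using i by linarith
    then have "takeWhile id bs ! j = bs ! j" "takeWhile id bs ! j \<in> set (takeWhile id bs)"
      by (rule takeWhile_nth, rule nth_mem)
    then show "bs ! j" using set_takeWhileD[of "bs ! j" id bs] by simp
  qed
  have "lead_ones (num bs) = (\<Sum>i<length bs. of_bool (\<forall>j<Suc i. bs ! j))"
    unfolding lead_ones_def bit_len_num
  proof (rule sum.cong, simp)
    fix i assume "i \<in> {..<length bs}"
    then have "(\<forall>j<Suc i. bit_at (num bs) j = 1) = (\<forall>j<Suc i. bs ! j)" by auto
    then show "of_bool (\<forall>j<Suc i. bit_at (num bs) j = 1) = (of_bool (\<forall>j<Suc i. bs ! j) :: nat)" by simp
  qed
  also have "\<dots> = card {i. i < length bs \<and> (\<forall>j<Suc i. bs ! j)}"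
    by (simp only: sum_of_bool_eq finite_lessThan of_nat_id) (rule arg_cong[of _ _ card], auto)
  finally show ?thesis by (simp only: * card_lessThan)
qed

lemma well_formed_prefix_free:
  assumes "well_formed (num p)" "well_formed (num p')" "prefix p p'"
  shows "p = p'"
proof -
  from assms(3) obtain q where q: "p' = p @ q" by (auto simp: prefix_def)
  let ?l = "length (takeWhile id p)"
  have l: "length p = ?l + 1 + ?l ^ 2" using assms(1) by (simp add: well_formed_def lead_ones_num)
  then have "takeWhile id p \<noteq> p" by (metis add.assoc add_cancel_left_right add_is_0 one_neq_zero)
  then have "takeWhile id (p @ q) = takeWhile id p" by (metis takeWhile_append1 takeWhile_eq_all_conv)
  moreover have "length p' = length (takeWhile id p') + 1 + length (takeWhile id p') ^ 2"
    using assms(2) by (simp add: well_formed_def lead_ones_num)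
  ultimately have "length p' = length p" using q l by simp
  then show ?thesis using q by simp
qed

lemma word_with_value:
  "I < 2 ^ L \<Longrightarrow> \<exists>w. length w = L \<and> (\<forall>xs. num (xs @ w) mod 2 ^ L = I)"
proof (induction L arbitrary: I)
  case (Suc L)
  then have "I div 2 < 2 ^ L" by (simp add: less_mult_imp_div_less mult.commute)
  from Suc.IH[OF this] obtain w where w: "length w = L" "\<And>xs. num (xs @ w) mod 2 ^ L = I div 2" by blast
  have "num (xs @ w @ [odd I]) mod 2 ^ Suc L = I" for xs
  proof -
    have "num (xs @ w @ [odd I]) = 2 * num (xs @ w) + of_bool (odd I)" by (simp add: num_def)
    moreover have "num (xs @ w) = 2 ^ L * (num (xs @ w) div 2 ^ L) + I div 2"
      using w(2)[of xs] by (metis mult_div_mod_eq)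
    moreover have "2 * (I div 2) + of_bool (odd I) = I" by (simp add: mod_2_eq_odd[symmetric])
    ultimately have "num (xs @ w @ [odd I]) = 2 ^ Suc L * (num (xs @ w) div 2 ^ L) + I"
      by (simp add: algebra_simps)
    then show ?thesis using Suc.prems by simp
  qed
  then show ?case using w(1) by (intro exI[of _ "w @ [odd I]"]) simp
qed (auto intro: exI[of _ "[]"])

text \<open>\<^const>\<open>unary_at\<close> on bit lists, where it obeys a recursion along the list.\<close>

definition runs :: "bool list \<Rightarrow> nat \<Rightarrow> nat" where
  "runs bs k = (\<Sum>i<length bs. of_bool (bs ! i \<and> (\<Sum>j<i. of_bool (\<not> bs ! j)) = k))"

lemma unary_at_num: "unary_at (num bs) k = runs bs k"
  unfolding unary_at_def runs_def bit_len_num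
proof (rule sum.cong, simp)
  fix i assume i: "i \<in> {..<length bs}"
  have "(\<Sum>j<i. of_bool (bit_at (num bs) j = 0)) = (\<Sum>j<i. of_bool (\<not> bs ! j) :: nat)"
    by (rule sum.cong) (use i in auto)
  then show "of_bool (bit_at (num bs) i = 1 \<and> (\<Sum>j<i. of_bool (bit_at (num bs) j = 0)) = k) =
      (of_bool (bs ! i \<and> (\<Sum>j<i. of_bool (\<not> bs ! j)) = k) :: nat)"
    using i by auto
qed

lemma runs_Cons: "runs (b # bs) k =
    (if b then of_bool (k = 0) + runs bs k else if k = 0 then 0 else runs bs (k - 1))"
proof -
  have "runs (b # bs) k = of_bool (b \<and> k = 0) +
      (\<Sum>i<length bs. of_bool (bs ! i \<and> of_bool (\<not> b) + (\<Sum>j<i. of_bool (\<not> bs ! j)) = k))"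
    unfolding runs_def
    by (simp add: sum.lessThan_Suc_shift del: sum.lessThan_Suc sum_of_bool_eq)
  then show ?thesis
    by (cases k) (auto simp: runs_def simp del: sum_of_bool_eq intro!: sum.cong)
qed

lemma runs_enc_nat: "runs (enc_nat c @ bs) k = (if k = 0 then c else runs bs (k - 1))"
  by (induction c arbitrary: k) (auto simp: enc_nat_def runs_Cons)

lemma runs_concat: "k < length cs \<Longrightarrow> runs (concat (map enc_nat cs)) k = cs ! k"
  by (induction cs arbitrary: k) (auto simp: runs_enc_nat nth_Cons' )

lemma nth_concat_uniform:
  "(\<And>x. x \<in> set xs \<Longrightarrow> length (f x) = L) \<Longrightarrow> r < length xs \<Longrightarrow> j < L \<Longrightarrow>
    concat (map f xs) ! (r * L + j) = f (xs ! r) ! j"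
proof (induction xs arbitrary: r)
  case (Cons x xs)
  then show ?case by (cases r) (auto simp: nth_append)
qed simp

lemma length_concat_uniform:
  "(\<And>x. x \<in> set xs \<Longrightarrow> length (f x) = L) \<Longrightarrow> length (concat (map f xs)) = length xs * L"
  by (induction xs) auto

lemma coords_props: "distinct (coords :: 'k::finite list)" "set (coords :: 'k list) = UNIV"
proof -
  have "\<exists>xs :: 'k list. distinct xs \<and> set xs = UNIV" using finite_distinct_list[of "UNIV :: 'k set"] by auto
  then have "distinct (coords :: 'k list) \<and> set (coords :: 'k list) = UNIV"
    unfolding coords_def by (rule someI_ex)
  then show "distinct (coords :: 'k::finite list)" "set (coords :: 'k list) = UNIV" by auto
qed

lemma length_coords [simp]: "length (coords :: 'k::finite list) = CARD('k)"
  using distinct_card[OF coords_props(1)] coords_props(2) by metis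

lemma enc_int_nonneg: "0 \<le> z \<Longrightarrow> enc_int z = concat (map enc_nat [0, nat z])"
  by (simp add: enc_int_def enc_nat_def)

definition numbers :: "(int ^ 'k::finite) list \<Rightarrow> nat list" where
  "numbers zs = length zs # concat (map (\<lambda>z. concat (map (\<lambda>i. [0, nat (z $ i)]) coords)) zs)"

lemma enc_list_numbers:
  fixes zs :: "(int ^ 'k::finite) list"
  assumes "\<And>z i. z \<in> set zs \<Longrightarrow> 0 \<le> z $ i"
  shows "enc_list (enc_vec enc_int) zs = concat (map enc_nat (numbers zs))"
proof -
  have 1: "enc_vec enc_int z = concat (map enc_nat (concat (map (\<lambda>i. [0, nat (z $ i)]) coords)))"
    if "z \<in> set zs" for z
  proof -
    have "enc_vec enc_int z = concat (map (\<lambda>i. enc_nat 0 @ enc_nat (nat (z $ i))) coords)"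
      using assms[OF that] by (simp add: enc_vec_def enc_int_nonneg)
    also have "\<dots> = concat (map enc_nat (concat (map (\<lambda>i. [0, nat (z $ i)]) js)))" if "js = coords" for js
      unfolding that[symmetric] by (induction js) auto
    finally show ?thesis by simp
  qed
  then have "concat (map (enc_vec enc_int) zs) =
      concat (map (\<lambda>z. concat (map enc_nat (concat (map (\<lambda>i. [0, nat (z $ i)]) coords)))) zs)"
    by (metis (no_types, lifting) map_eq_conv)
  also have "\<dots> = concat (map enc_nat (concat (map (\<lambda>z. concat (map (\<lambda>i. [0, nat (z $ i)]) coords)) zs)))"
    by (induction zs) auto
  finally show ?thesis by (simp add: enc_list_def numbers_def)
qed

context
  fixes zs :: "(int ^ 'k::finite) list" and W :: nat
  assumes nonneg: "\<And>z i. z \<in> set zs \<Longrightarrow> 0 \<le> z $ i"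
    and W: "W = num (enc_list (enc_vec enc_int) zs)"
begin

lemma W_numbers: "W = num (concat (map enc_nat (numbers zs)))"
  unfolding W using enc_list_numbers[of zs] nonneg by simp

lemma count_decode: "unary_at W 0 = length zs"
  unfolding W_numbers unary_at_num
  by (subst runs_concat) (auto simp: numbers_def)

lemma pos_decode:
  assumes "r < length zs" "j < CARD('k)"
  shows "pos CARD('k) W r j = nat (zs ! r $ (coords ! j))"
proof -
  let ?g = "\<lambda>z :: int ^ 'k. concat (map (\<lambda>i. [0, nat (z $ i)]) coords)"
  have lg: "length (?g z) = CARD('k) * 2" for z
    using length_concat_uniform[of "coords :: 'k list" "\<lambda>i. [0, nat (z $ i)]" 2] by simp
  have r1: "Suc r \<le> length zs" using assms by simp
  have "Suc r * (CARD('k) * 2) \<le> length zs * (CARD('k) * 2)" by (rule mult_le_mono1[OF r1])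
  then have len: "2 * (r * CARD('k) + j) + 2 < length (numbers zs)"
    using assms(2) length_concat_uniform[of zs ?g "CARD('k) * 2", OF lg]
    by (simp add: numbers_def algebra_simps)
  have "numbers zs ! (2 * (r * CARD('k) + j) + 2) = concat (map ?g zs) ! (r * (CARD('k) * 2) + (j * 2 + 1))"
    by (simp add: numbers_def algebra_simps)
  also have "\<dots> = ?g (zs ! r) ! (j * 2 + 1)"
    by (rule nth_concat_uniform[OF lg]) (use assms in auto)
  also have "\<dots> = nat (zs ! r $ (coords ! j))"
    by (subst nth_concat_uniform[where L = 2]) (use assms in auto)
  finally show ?thesis
    unfolding pos_def W_numbers unary_at_num using len by (subst runs_concat) auto
qed

lemma vec_eq_coords: "(\<forall>j<CARD('k). x $ (coords ! j) = y $ (coords ! j)) \<longleftrightarrow> x = (y :: 'a ^ 'k)"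
proof -
  have "\<exists>j<CARD('k). coords ! j = i" for i :: 'k
    using coords_props(2) by (metis UNIV_I in_set_conv_nth length_coords)
  then show ?thesis by (metis vec_eq_iff)
qed

lemma fresh_decode:
  assumes "r < length zs"
  shows "fresh CARD('k) W r \<longleftrightarrow> zs ! r \<notin> set (take r zs)"
proof -
  have "(\<exists>j<CARD('k). \<not> pos CARD('k) W r' j = pos CARD('k) W r j) \<longleftrightarrow> zs ! r' \<noteq> zs ! r" if "r' < r" for r'
  proof -
    have "pos CARD('k) W r' j = pos CARD('k) W r j \<longleftrightarrow> zs ! r' $ (coords ! j) = zs ! r $ (coords ! j)"
      if "j < CARD('k)" for j
      using pos_decode[OF assms that] pos_decode[OF _ that, of r'] nonneg assms \<open>r' < r\<close>
      by (simp add: nat_eq_iff2)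
    then show ?thesis using vec_eq_coords[of "zs ! r'" "zs ! r"] by blast
  qed
  then show ?thesis unfolding fresh_def using assms by (auto simp: in_set_conv_nth)
qed

end

lemma sum_first_occurrences:
  "(\<Sum>r<length zs. of_bool (zs ! r \<notin> set (take r zs)) * g (zs ! r)) = (\<Sum>z\<in>set zs. g z :: nat)"
proof (induction zs rule: rev_induct)
  case (snoc z zs)
  have "(\<Sum>r<length zs. of_bool ((zs @ [z]) ! r \<notin> set (take r (zs @ [z]))) * g ((zs @ [z]) ! r)) =
     (\<Sum>r<length zs. of_bool (zs ! r \<notin> set (take r zs)) * g (zs ! r))"
    by (rule sum.cong) (auto simp: nth_append)
  then show ?case using snoc by (auto simp: insert_absorb)
qed simp

section \<open>The decoding machine\<close>

definition coord_code :: "nat \<Rightarrow> nat \<Rightarrow> nat \<Rightarrow> nat \<Rightarrow> bool list" where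
  "coord_code d V W j = (numer d V W j < grid d V) #
     enc_nat ((numer d V W j - grid d V) + (grid d V - numer d V W j)) @ False # enc_nat (grid d V)"

definition out_tape :: "bool list \<Rightarrow> tape" where
  "out_tape bs = (length bs, \<lambda>i. if i < length bs then bit_sym (bs ! i) else 0)"

context subroutine begin

lemma base_ge: "5 \<le> base" using np_ge by auto

inductive_cases exec_SeqE: "exec (c ;; d) s s'"

lemma with_regs_low: "\<tau> < base \<Longrightarrow> with_regs s \<rho> \<tau> = s \<tau>"
  by (simp add: with_regs_def)

lemma exec_Act_low:
  assumes "\<tau> < base" shows "exec (Act \<tau> g) (with_regs s \<rho>)
    (with_regs (s(\<tau> := act_tape (s \<tau>) (g (read_tape (s \<tau>))))) \<rho>)"
  by (rule exec_Act) (use assms in \<open>auto simp: with_regs_def fun_eq_iff\<close>)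

lemma computable_assign:
  assumes "computable (length vs) f" "\<forall>i\<in>set vs. i < K" "x < K"
  obtains c where "\<forall>k. writes_below k c"
    "\<And>s \<rho>. (\<forall>y\<ge>K. \<rho> y = 0) \<Longrightarrow> exec c (with_regs s \<rho>) (with_regs s (\<rho>(x := f (map \<rho> vs))))"
proof -
  obtain c where c: "evaluates c K vs f" using computableE[OF assms(1) refl assms(2)] by blast
  have "exec (c ;; clear x ;; move K x) (with_regs s \<rho>) (with_regs s (\<rho>(x := f (map \<rho> vs))))"
    if "\<forall>y\<ge>K. \<rho> y = 0" for s \<rho>
    by (rule exec_Seq[OF evaluates_exec[OF c that]], rule exec_Seq[OF exec_clear],
        rule back_subst[of "exec _ _", OF exec_move]) (use that assms in \<open>auto intro!: upd_eq\<close>)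
  then show thesis using evaluates_writes[OF c] by (intro that[of "c ;; clear x ;; move K x"]) auto
qed

text \<open>
  A tape of bits is read into a register, most significant bit first. The language has no conditional;
  the inner loop replaces it, counting a bit 1 and overwriting it with a 0 so that the loop stops. The
  scan thereby destroys its tape.
\<close>

definition scan :: "nat \<Rightarrow> nat \<Rightarrow> com \<Rightarrow> com" where
  "scan \<tau> x dbl = inc x ;; While \<tau> (\<lambda>y. y = 1 \<or> y = 2)
     (dbl ;; While \<tau> (\<lambda>y. y = 2) (Act \<tau> (\<lambda>_. (1, Stay)) ;; inc x) ;; Act \<tau> (\<lambda>y. (y, Right)))"

text \<open>Only the tape to the right of the head matters, which is why its final content is left open.\<close>

lemma exec_scan_loop:
  assumes dbl: "\<forall>s \<rho>. (\<forall>y\<ge>K. \<rho> y = 0) \<longrightarrow> exec dbl (with_regs s \<rho>) (with_regs s (\<rho>(x := 2 * \<rho> x)))"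
    and x: "x < K" and \<tau>: "\<tau> < base"
    and z: "\<forall>y\<ge>K. \<rho> y = 0"
    and T: "s \<tau> = (h, f)" "\<forall>i<length bs. f (h + i) = bit_sym (bs ! i)" "f (h + length bs) \<notin> {1, 2}"
  shows "\<exists>T. exec (While \<tau> (\<lambda>y. y = 1 \<or> y = 2)
     (dbl ;; While \<tau> (\<lambda>y. y = 2) (Act \<tau> (\<lambda>_. (1, Stay)) ;; inc x) ;; Act \<tau> (\<lambda>y. (y, Right))))
     (with_regs s \<rho>) (with_regs (s(\<tau> := T)) (\<rho>(x := foldl (\<lambda>v b. 2 * v + of_bool b) (\<rho> x) bs)))"
  using z T
proof (induction bs arbitrary: s h f \<rho>)
  case Nil
  have "exec (While \<tau> (\<lambda>y. y = 1 \<or> y = 2) c) (with_regs s \<rho>) (with_regs s \<rho>)" for c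
    by (rule exec_WhileF) (use Nil \<tau> in \<open>auto simp: with_regs_low\<close>)
  then show ?case by (intro exI[of _ "s \<tau>"]) (simp add: fun_upd_idem)
next
  case (Cons b bs)
  let ?inner = "While \<tau> (\<lambda>y. y = 2) (Act \<tau> (\<lambda>_. (1, Stay)) ;; inc x)"
  let ?body = "dbl ;; ?inner ;; Act \<tau> (\<lambda>y. (y, Right))"
  let ?\<rho> = "\<rho>(x := 2 * \<rho> x)"
  let ?\<rho>' = "\<rho>(x := 2 * \<rho> x + of_bool b)"
  let ?T = "(h, f(h := 1))"
  have fh: "f h = bit_sym b" using Cons.prems(3) by (metis add_0_right length_Cons nth_Cons_0 zero_less_Suc)
  have inner: "exec ?inner (with_regs s ?\<rho>) (with_regs (s(\<tau> := ?T)) ?\<rho>')"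
  proof (cases b)
    case True
    have 1: "exec (Act \<tau> (\<lambda>_. (1, Stay)) ;; inc x) (with_regs s ?\<rho>) (with_regs (s(\<tau> := ?T)) ?\<rho>')"
      by (rule exec_Seq[OF exec_Act_low[OF \<tau>]], rule back_subst[of "exec _ _", OF exec_inc])
        (use True Cons.prems in \<open>auto intro!: upd_eq simp: act_def\<close>)
    have 2: "exec ?inner (with_regs (s(\<tau> := ?T)) ?\<rho>') (with_regs (s(\<tau> := ?T)) ?\<rho>')"
      by (rule exec_WhileF) (use \<tau> in \<open>auto simp: with_regs_low\<close>)
    show ?thesis
      by (rule exec_WhileT[OF _ 1 2]) (use True fh Cons.prems \<tau> in \<open>auto simp: with_regs_low bit_sym_def\<close>)
  next
    case False
    then have "f(h := 1) = f" using fh by (auto simp: bit_sym_def)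
    then have "s(\<tau> := ?T) = s" using Cons.prems by auto
    moreover have "exec ?inner (with_regs s ?\<rho>) (with_regs s ?\<rho>)"
      by (rule exec_WhileF) (use False fh Cons.prems \<tau> in \<open>auto simp: with_regs_low bit_sym_def\<close>)
    ultimately show ?thesis using False by simp
  qed
  let ?s = "s(\<tau> := (Suc h, f(h := 1)))"
  have body: "exec ?body (with_regs s \<rho>) (with_regs ?s ?\<rho>')"
    by (rule exec_Seq[OF dbl[THEN spec, THEN spec, THEN mp, OF Cons.prems(1)]], rule exec_Seq[OF inner],
        rule back_subst[of "exec _ _", OF exec_Act_low[OF \<tau>]]) (auto simp: act_def)
  have "\<forall>i<length bs. (f(h := 1)) (Suc h + i) = bit_sym (bs ! i)"
    using Cons.prems(3) by (auto simp: less_Suc_eq_0_disj)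
  moreover have "(f(h := 1)) (Suc h + length bs) \<notin> {1, 2}" using Cons.prems(4) by auto
  moreover have "\<forall>y\<ge>K. ?\<rho>' y = 0" using Cons.prems(1) x by auto
  ultimately obtain T where T: "exec (While \<tau> (\<lambda>y. y = 1 \<or> y = 2) ?body) (with_regs ?s ?\<rho>')
     (with_regs (?s(\<tau> := T)) (?\<rho>'(x := foldl (\<lambda>v b. 2 * v + of_bool b) (?\<rho>' x) bs)))"
    using Cons.IH[of ?\<rho>' ?s "Suc h" "f(h := 1)"] unfolding fun_upd_same by blast
  have "exec (While \<tau> (\<lambda>y. y = 1 \<or> y = 2) ?body) (with_regs s \<rho>)
     (with_regs (?s(\<tau> := T)) (?\<rho>'(x := foldl (\<lambda>v b. 2 * v + of_bool b) (?\<rho>' x) bs)))"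
    by (rule exec_WhileT[OF _ body T]) (use fh Cons.prems(2) \<tau> in \<open>auto simp: with_regs_low bit_sym_def\<close>)
  then show ?case by (intro exI[of _ T]) (simp only: fun_upd_upd fun_upd_same foldl_Cons)
qed

definition scanner :: "nat \<Rightarrow> nat \<Rightarrow> com \<Rightarrow> bool" where
  "scanner \<tau> x c \<longleftrightarrow> (\<forall>k\<ge>3. writes_below k c) \<and>
     (\<forall>s \<rho> f bs. (\<forall>y\<ge>3. \<rho> y = 0) \<longrightarrow> \<rho> x = 0 \<longrightarrow> s \<tau> = (0, f) \<longrightarrow>
       (\<forall>i<length bs. f i = bit_sym (bs ! i)) \<longrightarrow> f (length bs) \<notin> {1, 2} \<longrightarrow>
       (\<exists>T. exec c (with_regs s \<rho>) (with_regs (s(\<tau> := T)) (\<rho>(x := num bs)))))"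

lemma scanner_exists:
  assumes "x < 3" "\<tau> < base"
  shows "\<exists>c. scanner \<tau> x c"
proof -
  have "computable (length [x]) (\<lambda>xs. 2 * xs ! 0)" by (intro comp_intros) auto
  from computable_assign[OF this _ assms(1)] assms obtain dbl where dbl: "\<forall>k. writes_below k dbl"
    "\<forall>s \<rho>. (\<forall>y\<ge>3. \<rho> y = 0) \<longrightarrow> exec dbl (with_regs s \<rho>) (with_regs s (\<rho>(x := 2 * \<rho> x)))"
    by auto
  have "scanner \<tau> x (scan \<tau> x dbl)"
    unfolding scanner_def
  proof (intro conjI allI impI)
    fix s :: store and f and \<rho> :: "nat \<Rightarrow> nat" and bs :: "bool list"
    assume a: "\<forall>y\<ge>3. \<rho> y = 0" "\<rho> x = 0" "s \<tau> = (0, f)" "\<forall>i<length bs. f i = bit_sym (bs ! i)"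
      "f (length bs) \<notin> {1, 2}"
    let ?\<rho> = "\<rho>(x := Suc (\<rho> x))"
    have z: "\<forall>y\<ge>3. ?\<rho> y = 0" using a assms by auto
    have "\<forall>i<length bs. f (0 + i) = bit_sym (bs ! i)" "f (0 + length bs) \<notin> {1, 2}" using a by auto
    from exec_scan_loop[where s = s and \<rho> = ?\<rho> and h = 0 and f = f and bs = bs and x = x and \<tau> = \<tau> and K = 3 and dbl = dbl,
        OF dbl(2) assms z a(3) this] obtain T where
      "exec (While \<tau> (\<lambda>y. y = 1 \<or> y = 2)
        (dbl ;; While \<tau> (\<lambda>y. y = 2) (Act \<tau> (\<lambda>_. (1, Stay)) ;; inc x) ;; Act \<tau> (\<lambda>y. (y, Right))))
        (with_regs s ?\<rho>) (with_regs (s(\<tau> := T)) (?\<rho>(x := foldl (\<lambda>v b. 2 * v + of_bool b) (?\<rho> x) bs)))"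
      by blast
    from exec_Seq[OF exec_inc this]
    have "exec (scan \<tau> x dbl) (with_regs s \<rho>) (with_regs (s(\<tau> := T)) (\<rho>(x := num bs)))"
      unfolding scan_def using a(2) by (simp add: num_def)
    then show "\<exists>T. exec (scan \<tau> x dbl) (with_regs s \<rho>) (with_regs (s(\<tau> := T)) (\<rho>(x := num bs)))" by blast
  qed (use dbl(1) in \<open>simp add: scan_def\<close>)
  then show ?thesis by blast
qed

definition emit :: "bool \<Rightarrow> com" where "emit b = Act 2 (\<lambda>_. (bit_sym b, Right))"

lemma exec_emit: "exec (emit b) (with_regs (s(2 := out_tape bs)) \<rho>) (with_regs (s(2 := out_tape (bs @ [b]))) \<rho>)"
proof -
  have "2 < base" using base_ge by simp
  from exec_Act_low[OF this, of "\<lambda>_. (bit_sym b, Right)" "s(2 := out_tape bs)" \<rho>] show ?thesis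
    unfolding emit_def
    by (rule back_subst[of "exec _ _"])
      (auto intro!: upd_eq arg_cong[of _ _ "fun_upd s 2"] simp: act_def out_tape_def fun_eq_iff[of "fun_upd _ _ _"] nth_append)
qed

text \<open>Registers 1 and 2 hold the numbers of the program and of the data; all other registers are free.\<close>

definition writer :: "com \<Rightarrow> (nat \<Rightarrow> nat \<Rightarrow> bool list) \<Rightarrow> bool" where
  "writer c g \<longleftrightarrow> (\<forall>k\<ge>3. writes_below k c) \<and> (\<forall>s \<rho> bs. (\<forall>y\<ge>3. \<rho> y = 0) \<longrightarrow>
     exec c (with_regs (s(2 := out_tape bs)) \<rho>) (with_regs (s(2 := out_tape (bs @ g (\<rho> 1) (\<rho> 2)))) \<rho>))"

lemma writer_replicate:
  assumes "computable 2 (\<lambda>xs. f (xs ! 0) (xs ! 1))"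
  shows "\<exists>c. writer c (\<lambda>V W. replicate (f V W) b)"
proof -
  have "computable (length [1, 2]) (\<lambda>xs. f (xs ! 0) (xs ! 1))" using assms by (simp add: numeral_2_eq_2)
  from computable_assign[OF this, of 4 3] obtain c where c: "\<forall>k. writes_below k c"
    "\<And>s \<rho>. (\<forall>y\<ge>4. \<rho> y = 0) \<Longrightarrow> exec c (with_regs s \<rho>) (with_regs s (\<rho>(3 := f (\<rho> 1) (\<rho> 2))))"
    by auto
  let ?body = "dec 3 ;; emit b"
  have "writer (c ;; loop 3 ?body) (\<lambda>V W. replicate (f V W) b)"
    unfolding writer_def
  proof (intro conjI allI impI)
    fix s :: store and \<rho> :: "nat \<Rightarrow> nat" and bs :: "bool list" assume z: "\<forall>y\<ge>3. \<rho> y = 0"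
    let ?n = "f (\<rho> 1) (\<rho> 2)"
    let ?s = "\<lambda>i. s(2 := out_tape (bs @ replicate (?n - i) b))"
    let ?S = "\<lambda>i. with_regs (?s i) (\<rho>(3 := i))"
    have step: "exec ?body (?S (Suc i)) (?S i)" if "i < ?n" for i
    proof -
      have "replicate (?n - i) b = replicate (?n - Suc i) b @ [b]"
        using that by (metis Suc_diff_Suc replicate_Suc replicate_append_same)
      moreover have "exec (dec 3) (?S (Suc i)) (with_regs (?s (Suc i)) (\<rho>(3 := i)))"
        using exec_dec[of 3 "?s (Suc i)" "\<rho>(3 := Suc i)"] by simp
      ultimately show ?thesis
        using exec_Seq[OF _ exec_emit[where b = b and s = s and bs = "bs @ replicate (?n - Suc i) b" and \<rho> = "\<rho>(3 := i)"]]
        by simp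
    qed
    have "exec (loop 3 ?body) (?S ?n) (?S 0)"
      by (rule exec_loop[where S = ?S]) (simp only: with_regs_reg fun_upd_same, rule step)
    moreover have "?S 0 = with_regs (s(2 := out_tape (bs @ replicate ?n b))) \<rho>"
      using z by (simp add: fun_upd_idem)
    ultimately show "exec (c ;; loop 3 ?body) (with_regs (s(2 := out_tape bs)) \<rho>)
         (with_regs (s(2 := out_tape (bs @ replicate (f (\<rho> 1) (\<rho> 2)) b))) \<rho>)"
      using c(2)[of \<rho> "s(2 := out_tape bs)"] z by (auto intro: exec_Seq)
  qed (use c(1) in \<open>simp add: emit_def bit_sym_def\<close>)
  then show ?thesis by blast
qed

lemma writer_append: "\<exists>c. writer c g \<Longrightarrow> \<exists>c. writer c h \<Longrightarrow> \<exists>c. writer c (\<lambda>V W. g V W @ h V W)"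
proof -
  assume "\<exists>c. writer c g" "\<exists>c. writer c h"
  then obtain c d where "writer c g" "writer d h" by blast
  then have c: "\<forall>k\<ge>3. writes_below k c" "\<And>s \<rho> bs. (\<forall>y\<ge>3. \<rho> y = 0) \<Longrightarrow>
     exec c (with_regs (s(2 := out_tape bs)) \<rho>) (with_regs (s(2 := out_tape (bs @ g (\<rho> 1) (\<rho> 2)))) \<rho>)"
    and d: "\<forall>k\<ge>3. writes_below k d" "\<And>s \<rho> bs. (\<forall>y\<ge>3. \<rho> y = 0) \<Longrightarrow>
     exec d (with_regs (s(2 := out_tape bs)) \<rho>) (with_regs (s(2 := out_tape (bs @ h (\<rho> 1) (\<rho> 2)))) \<rho>)"
    unfolding writer_def by auto
  have "writer (c ;; d) (\<lambda>V W. g V W @ h V W)"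
    unfolding writer_def
  proof (intro conjI allI impI)
    fix s :: store and \<rho> :: "nat \<Rightarrow> nat" and bs :: "bool list" assume z: "\<forall>y\<ge>3. \<rho> y = 0"
    show "exec (c ;; d) (with_regs (s(2 := out_tape bs)) \<rho>)
      (with_regs (s(2 := out_tape (bs @ g (\<rho> 1) (\<rho> 2) @ h (\<rho> 1) (\<rho> 2)))) \<rho>)"
      using exec_Seq[OF c(2)[OF z] d(2)[OF z]] by simp
  qed (use c(1) d(1) in auto)
  then show ?thesis by blast
qed

lemma writer_coord: "\<exists>c. writer c (\<lambda>V W. coord_code d V W j)"
proof -
  have eq: "coord_code d V W j =
    replicate (of_bool (numer d V W j < grid d V)) True @
    replicate (1 - of_bool (numer d V W j < grid d V)) False @
    replicate ((numer d V W j - grid d V) + (grid d V - numer d V W j)) True @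
    replicate 2 False @ replicate (grid d V) True @ replicate 1 False" for V W
    by (simp add: coord_code_def enc_nat_def numeral_2_eq_2)
  have n: "computable 2 (\<lambda>xs. numer d (xs ! 0) (xs ! 1) j)" "computable 2 (\<lambda>xs. grid d (xs ! 0))"
    by (auto intro!: comp_numer comp_grid comp_vars)
  show ?thesis unfolding eq
    by (intro writer_append writer_replicate comp_less comp_diff comp_add comp_const n)
qed

lemma writer_coords: "\<exists>c. writer c (\<lambda>V W. concat (map (coord_code d V W) [0..<l]))"
proof (induction l)
  case 0
  have "writer Skip (\<lambda>V W. [])" unfolding writer_def by (auto intro: exec_Skip)
  then show ?case by auto
next
  case (Suc l)
  from writer_append[OF this writer_coord[of d l]] show ?case by simp
qed

text \<open>
  Initially all tapes except 0 and 1 are blank. Writing the mark into cell 0 turns a blank tape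
  into a register of value 0.
\<close>

fun inits :: "nat \<Rightarrow> com" where
  "inits 0 = Skip"
| "inits (Suc k) = inits k ;; Act (base + k) (\<lambda>_. (1, Stay))"

lemma exec_inits:
  assumes "\<And>x. x < k \<Longrightarrow> s (base + x) = (0, \<lambda>_. 0)"
  shows "exec (inits k) s (\<lambda>\<tau>. if base \<le> \<tau> \<and> \<tau> < base + k then (0, mark) else s \<tau>)"
  using assms
proof (induction k)
  case 0
  have "(\<lambda>\<tau>. if base \<le> \<tau> \<and> \<tau> < base + 0 then (0, mark) else s \<tau>) = s"
    by (rule ext) auto
  then show ?case using exec_Skip[of s] by (simp only: inits.simps)
next
  case (Suc k)
  have "exec (inits k) s (\<lambda>\<tau>. if base \<le> \<tau> \<and> \<tau> < base + k then (0, mark) else s \<tau>)"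
    using Suc by simp
  then show ?case unfolding inits.simps
    by (rule exec_Seq, intro exec_Act)
      (use Suc.prems[of k] in \<open>auto simp: fun_eq_iff act_def mark_def less_Suc_eq\<close>)
qed

lemma inits_below: "base + k \<le> b \<Longrightarrow> uses_below b (inits k)" "3 \<le> n \<Longrightarrow> writes_below n (inits k)"
  by (induction k) auto

lemma put_with_regs:
  "put_tapes (with_regs s \<rho>) ts = with_regs (put_tapes s ts) (\<rho>(0 := fst (ts ! 2)))"
  using np_ge(1) by (auto simp: put_tapes_def with_regs_def fun_eq_iff)

text \<open>
  Since machines are deterministic, one reachable configuration on a cycle rules out halting.
\<close>

lemma hang:
  assumes at: "code_at c (loop x Skip) i" and r: "\<rho> x \<noteq> 0" and k: "base + x < k"
    and reach: "(init, (i, tape_list k (with_regs s \<rho>))) \<in> steps (compile k c)"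
  shows "\<not> (\<exists>h. (init, h) \<in> steps (compile k c) \<and> tm_step (compile k c) h = None)"
proof
  let ?M = "compile k c"
  let ?ts = "tape_list k (with_regs s \<rho>)"
  note a = code_at_While[OF at[unfolded loop_def]]
  have rd: "map read_tape ?ts ! (base + x) = 0" using r k by (simp add: mark_def)
  have id: "map2 act_tape ?ts (idle (map read_tape ?ts)) = ?ts"
    by (rule nth_equalityI) (auto simp: idle_def)
  have s1: "tm_step ?M (i, ?ts) = Some (i + 1, ?ts)"
    using a(2,3) rd id by (simp add: compile_def del: map_map)
  have s2: "tm_step ?M (i + 1, ?ts) = Some (i, ?ts)"
    using a(4,5) id by (simp add: compile_def)
  assume "\<exists>h. (init, h) \<in> steps ?M \<and> tm_step ?M h = None"
  then obtain h where h: "(init, h) \<in> steps ?M" "tm_step ?M h = None" by blast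
  have sv: "single_valued {(c, c'). tm_step ?M c = Some c'}" by (auto simp: single_valued_def)
  have "((i, ?ts), h) \<in> steps ?M"
    using single_valued_confluent[OF sv h(1)[unfolded steps_def] reach[unfolded steps_def]] h(2) s1
    unfolding steps_def by (auto elim: converse_rtranclE)
  then have "h \<in> {(i, ?ts), (i + 1, ?ts)}" unfolding steps_def
  proof (induction rule: rtrancl_induct)
    case (step y z)
    then show ?case using s1 s2 by auto
  qed simp
  then show False using h(2) s1 s2 by auto
qed

text \<open>
  The machine reads its program \<open>p\<close> into a number, hangs unless \<open>p\<close> is well formed, runs \<open>\<Phi>\<close> on
  the request for the list of cubes, reads the answer into a second number and writes the requested
  grid point. It is prefix-free because of the first test alone, whatever the oracle is.
\<close>

theorem machine_exists:
  "\<exists>M. prefix_tm M \<and> (\<forall>A p t. well_formed (num p) \<longrightarrow> tm_outputs \<Phi> A (enc_nat 1) t \<longrightarrow>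
     tm_outputs M A p (concat (map (coord_code d (num p) (num t)) [0..<d])))"
proof -
  have low: "0 < base" "2 < base" "3 < base" "4 < base" using base_ge by auto
  obtain scan0 where scan0: "scanner 0 1 scan0" using scanner_exists[of 1 0] low by auto
  obtain scan4 where scan4: "scanner 4 2 scan4" using scanner_exists[of 2 4] low by auto
  have "computable (length [1]) (\<lambda>xs. of_bool (\<not> well_formed (xs ! 0)))"
    by (intro comp_Not comp_well_formed comp_var) simp
  from computable_assign[OF this, of 4 3] obtain chk where chk: "\<forall>k. writes_below k chk"
    "\<And>s \<rho>. (\<forall>y\<ge>4. \<rho> y = 0) \<Longrightarrow>
       exec chk (with_regs s \<rho>) (with_regs s (\<rho>(3 := of_bool (\<not> well_formed (\<rho> 1)))))"
    by auto
  obtain out where out: "\<forall>k\<ge>3. writes_below k out"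
    "\<And>s \<rho> bs. (\<forall>y\<ge>3. \<rho> y = 0) \<Longrightarrow> exec out (with_regs (s(2 := out_tape bs)) \<rho>)
       (with_regs (s(2 := out_tape (bs @ concat (map (coord_code d (\<rho> 1) (\<rho> 2)) [0..<d])))) \<rho>)"
    using writer_coords[of d d] unfolding writer_def by blast
  let ?start = "scan0 ;; chk"
  let ?feed = "Act 3 (\<lambda>_. (2, Right)) ;; Act 3 (\<lambda>_. (1, Left))"
  let ?back = "loop 0 (dec 0 ;; Act 4 (\<lambda>y. (y, Left)))"
  let ?rest = "?feed ;; Run ;; ?back ;; scan4 ;; out"
  let ?main = "?start ;; loop 3 Skip ;; ?rest"
  obtain k0 where k0: "uses_below k0 ?main" using uses_below_exists by blast
  define r where "r = k0 + 4"
  let ?k = "base + r"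
  define c where "c = inits r ;; ?main"
  define M where "M = compile ?k c"
  have us: "uses_below ?k c" using k0 inits_below uses_below_mono[OF k0, of ?k] unfolding c_def r_def by simp
  have ws: "writes_below (nsyms \<Phi>) c"
    using scan0 scan4 unfolding scanner_def using chk(1) out(1) np_ge(2) inits_below(2)[of "nsyms \<Phi>" r] by (auto simp: c_def)
  have valM: "valid_tm M" unfolding M_def by (rule compile_valid[OF us ws]) (simp add: r_def)
  define s0 :: "(nat \<Rightarrow> bool) \<Rightarrow> bool list \<Rightarrow> store" where "s0 A p \<tau> =
     (if \<tau> = 0 then (0, \<lambda>i. if i < length p then bit_sym (p ! i) else 0)
      else if \<tau> = 1 then (0, \<lambda>i. bit_sym (A i)) else if \<tau> < ?k then (0, \<lambda>_. 0) else (0, mark))" for A p \<tau>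
  have init: "init_config M A p = (0, tape_list ?k (s0 A p))" for A p
    using np_ge(1) unfolding init_config_def M_def compile_def
    by (auto intro!: nth_equalityI simp: s0_def r_def nth_Cons split: nat.splits)
  let ?z = "\<lambda>_ :: nat. 0 :: nat"
  have inits: "exec (inits r) (s0 A p) (with_regs (s0 A p) ?z)" for A p
    by (rule back_subst[of "exec _ _", OF exec_inits])
      (use low in \<open>auto simp: s0_def with_regs_def fun_eq_iff\<close>)
  have pre: "\<exists>T. exec (inits r ;; ?start) (s0 A p) (with_regs ((s0 A p)(0 := T))
     (?z(1 := num p, 3 := of_bool (\<not> well_formed (num p)))))" for A p
  proof -
    have "\<exists>T. exec scan0 (with_regs (s0 A p) ?z) (with_regs ((s0 A p)(0 := T)) (?z(1 := num p)))"
      by (rule scan0[unfolded scanner_def, THEN conjunct2, rule_format,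
          where f = "\<lambda>i. if i < length p then bit_sym (p ! i) else 0"]) (auto simp: s0_def)
    then obtain T where "exec scan0 (with_regs (s0 A p) ?z) (with_regs ((s0 A p)(0 := T)) (?z(1 := num p)))"
      by blast
    from exec_Seq[OF this chk(2)] have "exec ?start (with_regs (s0 A p) ?z) (with_regs ((s0 A p)(0 := T))
     (?z(1 := num p, 3 := of_bool (\<not> well_formed (num p)))))" by simp
    with inits show ?thesis by (blast intro: exec_Seq)
  qed
  \<comment> \<open>An ill-formed program leaves 1 in register 3 and is caught by the empty loop on it.\<close>
  have halts: "well_formed (num p)" if "tm_outputs M A p t" for A p t
  proof (rule ccontr)
    assume nw: "\<not> ?thesis"
    from pre obtain T where T: "exec (inits r ;; ?start) (s0 A p) (with_regs ((s0 A p)(0 := T))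
     (?z(1 := num p, 3 := of_bool (\<not> well_formed (num p)))))" (is "exec _ _ (with_regs _ ?\<rho>)") by blast
    define c' where "c' = (inits r ;; ?start) ;; loop 3 Skip ;; ?rest"
    have cc: "code c 0 = code c' 0" "len c = len c'" by (simp_all add: c_def c'_def add.assoc)
    have MM: "M = compile ?k c'" unfolding M_def compile_def cc by (rule refl)
    have us': "uses_below ?k (inits r ;; ?start)" using us by (simp add: c_def)
    note at = code_at_self[of c']
    have at1: "code_at c' (inits r ;; ?start) 0" "code_at c' (loop 3 Skip) (0 + len (inits r ;; ?start))"
      using code_at_Seq[OF at[unfolded c'_def], folded c'_def] code_at_Seq(1) by blast+
    have "((0, tape_list ?k (s0 A p)), (0 + len (inits r ;; ?start), tape_list ?k (with_regs ((s0 A p)(0 := T)) ?\<rho>)))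
       \<in> steps (compile ?k c')"
      by (rule compile_exec[OF T at1(1) us']) (simp add: r_def)
    from hang[OF at1(2) _ _ this] nw
    have no: "\<not> (\<exists>h. ((0, tape_list ?k (s0 A p)), h) \<in> steps M \<and> tm_step M h = None)"
      unfolding MM by (simp add: r_def)
    from that obtain q ts where "(init_config M A p, (q, ts)) \<in> steps M" "tm_step M (q, ts) = None"
      unfolding tm_outputs_def steps_def by blast
    with no show False unfolding init by blast
  qed
  have prefM: "prefix_tm M"
    unfolding prefix_tm_def using valM halts well_formed_prefix_free by blast
  have "tm_outputs M A p (concat (map (coord_code d (num p) (num t)) [0..<d]))" (is "tm_outputs _ _ _ ?o")
    if wf: "well_formed (num p)" and run: "tm_outputs \<Phi> A (enc_nat 1) t" for A p t
  proof -
    from pre[of A p] obtain T where "exec (inits r ;; ?start) (s0 A p)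
       (with_regs ((s0 A p)(0 := T)) (?z(1 := num p, 3 := of_bool (\<not> well_formed (num p)))))" by blast
    moreover have "?z(1 := num p, 3 := of_bool (\<not> well_formed (num p))) = ?z(1 := num p)"
      using wf by (auto simp: fun_eq_iff)
    ultimately have T: "exec (inits r ;; ?start) (s0 A p) (with_regs ((s0 A p)(0 := T)) (?z(1 := num p)))"
      by (simp only:)
    let ?\<rho> = "?z(1 := num p)"
    let ?s1 = "(s0 A p)(0 := T)"
    let ?in = "(0, \<lambda>i. if i < length (enc_nat 1) then bit_sym (enc_nat 1 ! i) else 0) :: tape"
    let ?s2 = "?s1(3 := ?in)"
    have loop3: "exec (loop 3 Skip) (with_regs ?s1 ?\<rho>) (with_regs ?s1 ?\<rho>)"
      by (rule exec_loop_zero) simp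
    have feed: "exec ?feed (with_regs ?s1 ?\<rho>) (with_regs ?s2 ?\<rho>)"
    proof (rule exec_Seq[OF exec_Act_low[OF low(3)]], rule back_subst[of "exec _ _", OF exec_Act_low[OF low(3)]],
        rule upd_eq[OF _ refl])
      show "?s1(3 := act_tape (?s1 3) (2, Right), 3 := act_tape ((?s1(3 := act_tape (?s1 3) (2, Right))) 3) (1, Left)) = ?s2"
        using low by (auto simp: act_def s0_def r_def enc_nat_def fun_eq_iff bit_sym_def nth_Cons split: nat.splits)
    qed
    from run obtain q ts where q: "(init_config \<Phi> A (enc_nat 1), (q, ts)) \<in> steps \<Phi>"
      "tm_step \<Phi> (q, ts) = None" "tape_string (ts ! 2) t" unfolding tm_outputs_def steps_def by blast
    have in\<Phi>: "init_config \<Phi> A (enc_nat 1) = (0, sub_tapes (with_regs ?s2 ?\<rho>))"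
    proof -
      have "with_regs ?s2 ?\<rho> (sub_index j) = ?s2 (sub_index j)" if "j < np" for j
        using sub_index_less[OF that] by (simp add: with_regs_low)
      then have "sub_tapes (with_regs ?s2 ?\<rho>) = map (\<lambda>j. ?s2 (sub_index j)) [0..<np]"
        by (simp add: sub_tapes_def)
      moreover have "init_config \<Phi> A (enc_nat 1) = (0, map (\<lambda>j. ?s2 (sub_index j)) [0..<np])"
        using np_ge(1) unfolding init_config_def
        by (auto intro!: nth_equalityI simp: s0_def r_def sub_index_def nth_Cons split: nat.splits)
      ultimately show ?thesis by simp
    qed
    have syms: "\<forall>j<np. \<forall>i. snd (with_regs ?s2 ?\<rho> (sub_index j)) i < nsyms \<Phi>"
    proof (intro allI impI)
      fix j i assume j: "j < np"
      have "bit_sym b < nsyms \<Phi>" for b using np_ge(2) by (auto simp: bit_sym_def)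
      moreover have "with_regs ?s2 ?\<rho> (sub_index j) = ?s2 (sub_index j)"
        using sub_index_less[OF j] by (simp add: with_regs_low)
      ultimately show "snd (with_regs ?s2 ?\<rho> (sub_index j)) i < nsyms \<Phi>"
        using np_ge(2) j by (auto simp: s0_def sub_index_def r_def)
    qed
    have "exec Run (with_regs ?s2 ?\<rho>) (put_tapes (with_regs ?s2 ?\<rho>) ts)"
    proof (rule exec_Run[OF _ q(2) _ syms])
      show "((0, sub_tapes (with_regs ?s2 ?\<rho>)), q, ts) \<in> steps \<Phi>" using q(1) in\<Phi> by simp
      show "fst (with_regs ?s2 ?\<rho> base) = fst (with_regs ?s2 ?\<rho> 4)"
        using low with_regs_reg[of ?s2 ?\<rho> 0] by (simp add: with_regs_low s0_def r_def)
    qed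
    then have runs: "exec Run (with_regs ?s2 ?\<rho>) (with_regs (put_tapes ?s2 ts) (?\<rho>(0 := fst (ts ! 2))))"
      by (simp add: put_with_regs)
    define s3 where "s3 = put_tapes ?s2 ts"
    have s3: "s3 4 = ts ! 2" "s3 2 = out_tape []"
      using low by (auto simp: s3_def put_tapes_def s0_def r_def out_tape_def)
    let ?S = "\<lambda>i. with_regs (s3(4 := (i, snd (ts ! 2)))) (?\<rho>(0 := i))"
    have "exec (dec 0 ;; Act 4 (\<lambda>y. (y, Left))) (?S (Suc i)) (?S i)" for i
      by (rule exec_Seq[OF exec_dec], rule back_subst[of "exec _ _", OF exec_Act_low[OF low(4)]])
        (auto simp: act_def intro!: upd_eq)
    then have rewind: "exec ?back (?S (fst (ts ! 2))) (?S 0)"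
      by (intro exec_loop[where S = ?S]) (simp only: with_regs_reg fun_upd_same)
    let ?s4 = "s3(4 := (0, snd (ts ! 2)))"
    have S0: "?S 0 = with_regs ?s4 ?\<rho>" by (rule upd_eq) auto
    have S1: "?S (fst (ts ! 2)) = with_regs s3 (?\<rho>(0 := fst (ts ! 2)))" by (rule upd_eq) (auto simp: s3)
    have "\<exists>T. exec scan4 (with_regs ?s4 ?\<rho>) (with_regs (?s4(4 := T)) (?\<rho>(2 := num t)))"
    proof (rule scan4[unfolded scanner_def, THEN conjunct2, rule_format, where f = "snd (ts ! 2)"])
      have "range bit_sym = {1, 2}" by (auto simp: bit_sym_def)
      then show "snd (ts ! 2) (length t) \<notin> {1, 2}" using q(3) by (simp add: tape_string_def)
    qed (use q(3) in \<open>auto simp: tape_string_def\<close>)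
    then obtain T' where scn: "exec scan4 (with_regs ?s4 ?\<rho>) (with_regs (?s4(4 := T')) (?\<rho>(2 := num t)))" by blast
    let ?s5 = "?s4(4 := T')"
    have s5: "?s5(2 := out_tape []) = ?s5" using s3(2) by auto
    have ou: "exec out (with_regs ?s5 (?\<rho>(2 := num t))) (with_regs (?s5(2 := out_tape ?o)) (?\<rho>(2 := num t)))"
      using out(2)[of "?\<rho>(2 := num t)" ?s5 "[]"] unfolding s5 by simp
    have tail: "exec (?back ;; scan4 ;; out) (with_regs s3 (?\<rho>(0 := fst (ts ! 2))))
        (with_regs (?s5(2 := out_tape ?o)) (?\<rho>(2 := num t)))"
      by (rule exec_Seq[OF rewind[unfolded S0 S1] exec_Seq[OF scn ou]])
    have "exec ?rest (with_regs ?s1 ?\<rho>) (with_regs (?s5(2 := out_tape ?o)) (?\<rho>(2 := num t)))"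
      by (rule exec_Seq[OF feed exec_Seq[OF runs[folded s3_def] tail]])
    note rest = exec_Seq[OF loop3 this]
    have "exec c (s0 A p) (with_regs (?s5(2 := out_tape ?o)) (?\<rho>(2 := num t)))" (is "exec _ _ ?fin")
      unfolding c_def by (rule exec_SeqE[OF T], rule exec_Seq, assumption, rule exec_Seq[OF _ rest])
    from compile_exec[OF this code_at_self us]
    have "(init_config M A p, (len c, tape_list ?k ?fin)) \<in> steps M"
      unfolding M_def[symmetric] init by (simp add: r_def)
    moreover have "tm_step M (len c, tape_list ?k ?fin) = None" by (simp add: M_def compile_def)
    moreover have "tape_list ?k ?fin ! 2 = out_tape ?o" using low by (simp add: with_regs_low r_def)
    moreover have "tape_string (out_tape bs) bs" for bs
      by (auto simp: tape_string_def out_tape_def bit_sym_def)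
    ultimately show ?thesis unfolding tm_outputs_def steps_def by metis
  qed
  with prefM show ?thesis by blast
qed

end

section \<open>Exceptional directions are simple\<close>

definition coord_index :: "'k::finite \<Rightarrow> nat" where
  "coord_index i = (THE j. j < CARD('k) \<and> coords ! j = i)"

lemma coords_bij: "bij_betw ((!) (coords :: 'k::finite list)) {..<CARD('k)} UNIV"
  using bij_betw_nth[OF coords_props(1), where A = "{..<CARD('k)}" and B = "UNIV :: 'k set"]
  by (simp add: coords_props(2))

lemma coord_index: "coord_index i < CARD('k)" "coords ! coord_index i = (i :: 'k::finite)"
proof -
  have "\<exists>!j. j < CARD('k) \<and> coords ! j = i"
  proof (rule ex_ex1I)
    have "i \<in> (!) coords ` {..<CARD('k)}" using coords_bij[where 'k = 'k] by (simp add: bij_betw_def)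
    then show "\<exists>j. j < CARD('k) \<and> coords ! j = i" by auto
    fix j j' assume "j < CARD('k) \<and> coords ! j = i" "j' < CARD('k) \<and> coords ! j' = i"
    then show "j = j'" using bij_betw_imp_inj_on[OF coords_bij[where 'k = 'k]] by (auto dest: inj_onD)
  qed
  from theI'[OF this] show "coord_index i < CARD('k)" "coords ! coord_index i = i"
    unfolding coord_index_def by auto
qed

lemma coord_index_nth: "j < CARD('k) \<Longrightarrow> coord_index (coords ! j :: 'k::finite) = j"
  using coords_bij[where 'k = 'k] coord_index[of "coords ! j :: 'k"] unfolding bij_betw_def inj_on_def by auto

lemma sum_coords: "(\<Sum>j<CARD('k). f (coords ! j :: 'k::finite)) = (\<Sum>i\<in>UNIV. f i)"
  by (rule sum.reindex_bij_betw[OF coords_bij])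

lemma all_coords: "(\<forall>j<CARD('k). P j) \<longleftrightarrow> (\<forall>i :: 'k::finite. P (coord_index i))"
  using coord_index(1) coord_index_nth by metis

definition grid_vec :: "nat \<Rightarrow> nat \<Rightarrow> int ^ 'k::finite" where
  "grid_vec H c = (\<chi> i. int (odd_digit H c (coord_index i)) - int H)"

definition grid_point :: "nat \<Rightarrow> nat \<Rightarrow> real ^ 'k::finite" where
  "grid_point H c = (\<chi> i. of_int (grid_vec H c $ i) / of_nat H)"

text \<open>
  The width of the shell is the rounding error: it contains every \<open>a\<close> with \<open>\<bar>a $ i\<bar> \<le> H\<close> and
  \<open>\<bar>a $ i - H * e $ i\<bar> \<le> 1\<close> for a unit vector \<open>e\<close>.
\<close>

definition shell :: "nat \<Rightarrow> int ^ 'k::finite \<Rightarrow> bool" where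
  "shell H a \<longleftrightarrow> \<bar>(\<Sum>i\<in>UNIV. (a $ i)\<^sup>2) - (int H)\<^sup>2\<bar> \<le> 2 * int CARD('k) * int H"

text \<open>
  The minors of the pair \<open>(v, a)\<close> vanish if and only if \<open>v\<close> and \<open>a\<close> are linearly dependent. For
  \<open>a = H e\<close> with a unit vector \<open>e\<close> the largest of them is comparable to \<open>H\<close> times the length of the
  projection of \<open>v\<close> to the orthogonal complement of \<open>e\<close>.
\<close>

definition tube :: "int \<Rightarrow> int ^ 'k::finite \<Rightarrow> int ^ 'k \<Rightarrow> bool" where
  "tube R v a \<longleftrightarrow> (\<forall>i j. v $ j * a $ i - v $ i * a $ j \<le> R)"

definition tube_pairs :: "nat \<Rightarrow> (int ^ 'k::finite) set \<Rightarrow> int ^ 'k \<Rightarrow> ((int ^ 'k) \<times> (int ^ 'k)) set" where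
  "tube_pairs R Z a = {(z, z') \<in> Z \<times> Z. tube (int R) (z - z') a}"

text \<open>
  The set depends on the family only through the positions of its cubes, so it can be enumerated from the
  answer of \<open>\<Phi>\<close>; the parameters \<open>t\<close>, \<open>\<epsilon>\<close> and \<open>\<eta>\<close> enter through \<open>k\<close> alone.
\<close>

definition exceptional_codes :: "nat \<Rightarrow> nat \<Rightarrow> nat \<Rightarrow> (int ^ 'k::finite) set \<Rightarrow> nat set" where
  "exceptional_codes n m k Z = {c. c < mesh CARD('k) n ^ CARD('k) \<and>
     shell (mesh CARD('k) n) (grid_vec (mesh CARD('k) n) c :: int ^ 'k) \<and>
     2 ^ k \<le> card (tube_pairs (tube_width CARD('k) n m) Z (grid_vec (mesh CARD('k) n) c))}"

lemma digits_inj: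
  assumes "c < H ^ d" "c' < H ^ d" "\<forall>j<d. (c div H ^ j) mod H = (c' div H ^ j) mod H"
  shows "c = (c' :: nat)"
  using assms
proof (induction d arbitrary: c c')
  case (Suc d)
  have "c div H < H ^ d" "c' div H < H ^ d"
    using Suc.prems by (simp_all add: less_mult_imp_div_less mult.commute)
  moreover have "\<forall>j<d. (c div H div H ^ j) mod H = (c' div H div H ^ j) mod H"
  proof (intro allI impI)
    fix j assume "j < d"
    then show "(c div H div H ^ j) mod H = (c' div H div H ^ j) mod H"
      using Suc.prems(3)[rule_format, of "Suc j"] by (simp add: div_mult2_eq)
  qed
  ultimately have "c div H = c' div H" by (rule Suc.IH)
  moreover have "c mod H = c' mod H" using Suc.prems(3)[rule_format, of 0] by simp
  ultimately show ?case by (metis mult_div_mod_eq)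
qed simp

lemma digits_surj:
  assumes "\<forall>j<d. f j < H"
  shows "\<exists>c<H ^ d. \<forall>j<d. (c div H ^ j) mod H = (f j :: nat)"
  using assms
proof (induction d arbitrary: f)
  case (Suc d)
  then have "\<forall>j<d. f (Suc j) < H" by simp
  from Suc.IH[OF this] obtain c where c: "c < H ^ d" "\<forall>j<d. (c div H ^ j) mod H = f (Suc j)" by blast
  have H: "f 0 < H" using Suc.prems by simp
  let ?c = "f 0 + H * c"
  have "?c < H ^ Suc d"
  proof -
    have "?c < H + H * c" using H by simp
    also have "\<dots> = H * Suc c" by simp
    also have "\<dots> \<le> H * H ^ d" using c(1) by (intro mult_le_mono2) simp
    finally show ?thesis by simp
  qed
  moreover have "(?c div H ^ j) mod H = f j" if "j < Suc d" for j
  proof (cases j)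
    case 0
    then show ?thesis using H by simp
  next
    case (Suc i)
    then have "?c div H ^ j = c div H ^ i" using H by (simp add: div_mult2_eq)
    then show ?thesis using c(2) Suc that by simp
  qed
  ultimately show ?case by blast
qed simp

lemma grid_vec_inj: "inj_on (grid_vec H :: nat \<Rightarrow> int ^ 'k::finite) {..<H ^ CARD('k)}"
proof (rule inj_onI)
  fix c c' assume c: "c \<in> {..<H ^ CARD('k)}" "c' \<in> {..<H ^ CARD('k)}"
    and eq: "grid_vec H c = (grid_vec H c' :: int ^ 'k)"
  have "(c div H ^ j) mod H = (c' div H ^ j) mod H" if "j < CARD('k)" for j
  proof -
    have "grid_vec H c $ (coords ! j :: 'k) = grid_vec H c' $ (coords ! j :: 'k)" using eq by simp
    then show ?thesis using that by (simp add: grid_vec_def odd_digit_def coord_index_nth)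
  qed
  with c show "c = c'" by (intro digits_inj) auto
qed

lemma grid_vec_surj:
  assumes "\<And>i. b i < H"
  shows "\<exists>c<H ^ CARD('k). \<forall>i :: 'k::finite. grid_vec H c $ i = 2 * int (b i) + 1 - int H"
proof -
  obtain c where "c < H ^ CARD('k)" "\<forall>j<CARD('k). (c div H ^ j) mod H = b (coords ! j :: 'k)"
    using digits_surj[of "CARD('k)" "\<lambda>j. b (coords ! j :: 'k)" H] assms by blast
  then show ?thesis
    by (intro exI[of _ c]) (auto simp: grid_vec_def odd_digit_def coord_index)
qed

lemma grid_vec_bound:
  assumes "0 < H" shows "\<bar>grid_vec H c $ i\<bar> < int H"
proof -
  have "(c div H ^ coord_index i) mod H < H" using assms by simp
  then have "2 * int ((c div H ^ coord_index i) mod H) + 2 \<le> 2 * int H" by linarith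
  then show ?thesis unfolding grid_vec_def odd_digit_def by (simp add: abs_less_iff)
qed

lemma on_shell_iff: "on_shell CARD('k) H c \<longleftrightarrow> shell H (grid_vec H c :: int ^ 'k::finite)"
proof -
  let ?A = "\<lambda>j. odd_digit H c j"
  have "(\<Sum>i\<in>UNIV. (grid_vec H c $ (i :: 'k))\<^sup>2) = (\<Sum>j<CARD('k). (grid_vec H c $ (coords ! j :: 'k))\<^sup>2)"
    by (rule sum_coords[symmetric])
  also have "\<dots> = (\<Sum>j<CARD('k). (int (?A j) - int H)\<^sup>2)"
    by (rule sum.cong) (auto simp: grid_vec_def coord_index_nth)
  also have "\<dots> = (\<Sum>j<CARD('k). int ((?A j)^2 + H^2) - int (2 * ?A j * H))"
    by (rule sum.cong) (auto simp: power2_eq_square algebra_simps)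
  also have "\<dots> = int (\<Sum>j<CARD('k). (?A j)^2 + H^2) - int (\<Sum>j<CARD('k). 2 * ?A j * H)"
    by (simp only: sum_subtractf of_nat_sum)
  finally have eq: "(\<Sum>i\<in>UNIV. (grid_vec H c $ (i :: 'k))\<^sup>2) =
    int (\<Sum>j<CARD('k). (?A j)^2 + H^2) - int (\<Sum>j<CARD('k). 2 * ?A j * H)" .
  define X where "X = (\<Sum>j<CARD('k). (?A j)^2 + H^2)"
  define Y where "Y = (\<Sum>j<CARD('k). 2 * ?A j * H)"
  define Z where "Z = 2 * CARD('k) * H"
  have Z: "2 * int CARD('k) * int H = int Z" by (simp add: Z_def)
  have "X \<le> Y + H^2 + Z \<and> Y + H^2 \<le> X + Z \<longleftrightarrow> \<bar>int X - int Y - int (H^2)\<bar> \<le> int Z"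
    by linarith
  then show ?thesis unfolding on_shell_def shell_def eq Z X_def Y_def Z_def by simp
qed

context
  fixes zs :: "(int ^ 'k::finite) list" and W :: nat
  assumes nonneg: "\<And>z i. z \<in> set zs \<Longrightarrow> 0 \<le> z $ i"
    and W: "W = num (enc_list (enc_vec enc_int) zs)"
begin

lemma in_tube_iff:
  assumes "r < length zs" "r' < length zs"
  shows "in_tube CARD('k) W H R c r r' \<longleftrightarrow> tube (int R) (zs ! r - zs ! r') (grid_vec H c)"
proof -
  have p: "int (pos CARD('k) W q (coord_index i)) = zs ! q $ i" if "q < length zs" for q i
    using pos_decode[OF nonneg W that coord_index(1)[of i]] nonneg[of "zs ! q" i] that
    by (simp add: coord_index(2))
  have "int (pos CARD('k) W r (coord_index j)) * int (odd_digit H c (coord_index i))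
       + int (pos CARD('k) W r' (coord_index j)) * int H
       + int (pos CARD('k) W r' (coord_index i)) * int (odd_digit H c (coord_index j))
       + int (pos CARD('k) W r (coord_index i)) * int H
     \<le> int (pos CARD('k) W r' (coord_index j)) * int (odd_digit H c (coord_index i))
       + int (pos CARD('k) W r (coord_index j)) * int H
       + int (pos CARD('k) W r (coord_index i)) * int (odd_digit H c (coord_index j))
       + int (pos CARD('k) W r' (coord_index i)) * int H + int R
    \<longleftrightarrow> (zs ! r - zs ! r') $ j * grid_vec H c $ i - (zs ! r - zs ! r') $ i * grid_vec H c $ j \<le> int R"
    for i j :: 'k
    unfolding p[OF assms(1)] p[OF assms(2)] grid_vec_def by (simp add: algebra_simps)
  then show ?thesis
    unfolding in_tube_def all_coords[where 'k = 'k] tube_def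
    by (simp only: of_nat_add[symmetric] of_nat_mult[symmetric] of_nat_le_iff)
qed

lemma energy_eq:
  "energy CARD('k) W H R c = card (tube_pairs R (set zs) (grid_vec H c))"
proof -
  have cnt: "unary_at W 0 = length zs" using count_decode[of zs W] nonneg W by blast
  have fr: "fresh CARD('k) W r \<longleftrightarrow> zs ! r \<notin> set (take r zs)" if "r < length zs" for r
    using fresh_decode[of zs W r] nonneg W that by blast
  let ?t = "\<lambda>z z'. of_bool (tube (int R) (z - z') (grid_vec H c)) :: nat"
  have "energy CARD('k) W H R c = (\<Sum>r<length zs. \<Sum>r'<length zs.
      of_bool (zs ! r \<notin> set (take r zs)) * (of_bool (zs ! r' \<notin> set (take r' zs)) * ?t (zs ! r) (zs ! r')))"
    unfolding energy_def cnt by (intro sum.cong refl) (auto simp: fr in_tube_iff)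
  also have "\<dots> = (\<Sum>r<length zs. of_bool (zs ! r \<notin> set (take r zs)) * (\<Sum>z'\<in>set zs. ?t (zs ! r) z'))"
    by (rule sum.cong[OF refl])
      (simp only: sum_distrib_left[symmetric] sum_first_occurrences[where g = "?t _"])
  also have "\<dots> = (\<Sum>z\<in>set zs. \<Sum>z'\<in>set zs. ?t z z')"
    by (rule sum_first_occurrences)
  also have "\<dots> = (\<Sum>(z, z')\<in>set zs \<times> set zs. ?t z z')"
    by (rule sum.cartesian_product)
  also have "\<dots> = card {x \<in> set zs \<times> set zs. tube (int R) (fst x - snd x) (grid_vec H c)}"
    by (simp add: case_prod_unfold sum_of_bool_eq Int_def)
  also have "{x \<in> set zs \<times> set zs. tube (int R) (fst x - snd x) (grid_vec H c)} =
     {(z, z') \<in> set zs \<times> set zs. tube (int R) (z - z') (grid_vec H c)}" by auto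
  finally show ?thesis unfolding tube_pairs_def .
qed

end

lemma select_eq:
  assumes "c < M" "E c"
  shows "(\<Sum>x<M. of_bool ((\<Sum>y<Suc x. of_bool (E y)) \<le> card {y. y < c \<and> E y})) = (c :: nat)"
proof -
  have count: "(\<Sum>y<k. of_bool (E y)) = card {y. y < k \<and> E y}" for k :: nat
    by (simp add: sum_of_bool_eq Int_def)
  have "card {y. y < Suc x \<and> E y} \<le> card {y. y < c \<and> E y} \<longleftrightarrow> x < c" for x
  proof (cases "x < c")
    case True
    then have "card {y. y < Suc x \<and> E y} \<le> card {y. y < c \<and> E y}" by (intro card_mono) auto
    then show ?thesis using True by simp
  next
    case False
    have "card (insert c {y. y < c \<and> E y}) \<le> card {y. y < Suc x \<and> E y}"
      by (intro card_mono) (use False assms in auto)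
    then show ?thesis using False by simp
  qed
  then have "(\<Sum>x<M. of_bool ((\<Sum>y<Suc x. of_bool (E y)) \<le> card {y. y < c \<and> E y})) = (\<Sum>x<M. of_bool (x < c) :: nat)"
    unfolding count by simp
  also have "\<dots> = card {x. x < M \<and> x < c}" by (simp add: sum_of_bool_eq Int_def)
  also have "{x. x < M \<and> x < c} = {..<c}" using assms by auto
  finally show ?thesis by simp
qed

lemma enc_rat_grid:
  assumes "0 < l"
  shows "enc_rat (of_int (int (odd_digit (2 ^ l) c j) - 2 ^ l) / of_nat (2 ^ l)) =
    (odd_digit (2 ^ l) c j < 2 ^ l) #
     enc_nat ((odd_digit (2 ^ l) c j - 2 ^ l) + (2 ^ l - odd_digit (2 ^ l) c j)) @ False # enc_nat (2 ^ l)"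
proof -
  let ?A = "odd_digit (2 ^ l) c j"
  let ?n = "int ?A - 2 ^ l"
  have "odd ?n" using assms by (auto simp: odd_digit_def)
  then have "coprime ?n (2 ^ l)" by simp
  then have "quotient_of (Fract ?n (2 ^ l)) = (?n, 2 ^ l)" by (simp add: quotient_of_Fract normalize_def)
  moreover have "(of_int ?n / of_nat (2 ^ l) :: rat) = Fract ?n (2 ^ l)"
    by (simp add: Fract_of_int_quotient)
  moreover have "int ?A < 2 ^ l \<longleftrightarrow> ?A < 2 ^ l"
    by (metis of_nat_less_iff of_nat_numeral of_nat_power)
  moreover have "nat \<bar>?n\<bar> = (?A - 2 ^ l) + (2 ^ l - ?A)"
  proof -
    have "(2::int) ^ l = int (2 ^ l)" by simp
    then show ?thesis by linarith
  qed
  ultimately show ?thesis by (simp add: enc_rat_def enc_int_def nat_power_eq)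
qed

text \<open>
  A program for an exceptional grid point consists of the three parameters and the rank of its code.
  Its length is therefore governed by the logarithm of the number of exceptional codes, and every
  vector close to the point has complexity at most that length at the scale of the distance.
  The factor \<open>(a + 1) ^ 12\<close> makes room for the three parameters, each below \<open>(a + 1) ^ 4\<close>.
\<close>

theorem exceptional_directions_simple:
  fixes U \<Phi> :: tm
  assumes U: "universal_prefix_tm U" and \<Phi>: "valid_tm \<Phi>"
  shows "\<exists>r0. \<forall>A (zs :: (int ^ 'k::finite) list) a n m k c x l.
    tm_outputs \<Phi> A (enc_nat 1) (enc_list (enc_vec enc_int) zs) \<longrightarrow>
    (\<forall>z\<in>set zs. \<forall>i. 0 \<le> z $ i) \<longrightarrow>
    n < (a + 1) ^ 4 \<longrightarrow> m < (a + 1) ^ 4 \<longrightarrow> k < (a + 1) ^ 4 \<longrightarrow>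
    c \<in> exceptional_codes n m k (set zs) \<longrightarrow>
    card (exceptional_codes n m k (set zs)) * (a + 1) ^ 12 \<le> 2 ^ (a ^ 2) \<longrightarrow>
    norm (grid_point (mesh CARD('k) n) c - x) < (1/2) ^ l \<longrightarrow>
    kolm_prec U A l (x :: real ^ 'k) \<le> r0 + a + 1 + a ^ 2"
proof -
  let ?d = "CARD('k)"
  interpret subroutine \<Phi> by (rule subroutine.intro[OF \<Phi>])
  obtain M where M: "prefix_tm M" "\<And>A p t. well_formed (num p) \<Longrightarrow> tm_outputs \<Phi> A (enc_nat 1) t \<Longrightarrow>
     tm_outputs M A p (concat (map (coord_code ?d (num p) (num t)) [0..<?d]))"
    using machine_exists[of ?d] by blast
  from U M(1) obtain r where r: "\<And>A p s. tm_outputs U A (r @ p) s \<longleftrightarrow> tm_outputs M A p s"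
    unfolding universal_prefix_tm_def by blast
  show ?thesis
  proof (rule exI[of _ "length r"], intro allI impI)
    fix A and zs :: "(int ^ 'k) list" and a n m k c l and x :: "real ^ 'k"
    define H :: nat where "H = mesh ?d n"
    define R where "R = tube_width ?d n m"
    define E where "E c \<longleftrightarrow> shell H (grid_vec H c :: int ^ 'k) \<and>
      2 ^ k \<le> card (tube_pairs R (set zs) (grid_vec H c))" for c
    have EX: "exceptional_codes n m k (set zs) = {c. c < H ^ ?d \<and> E c}"
      by (simp add: exceptional_codes_def E_def H_def R_def)
    assume run: "tm_outputs \<Phi> A (enc_nat 1) (enc_list (enc_vec enc_int) zs)"
      and nonneg: "\<forall>z\<in>set zs. \<forall>i. 0 \<le> z $ i"
      and small: "n < (a + 1) ^ 4" "m < (a + 1) ^ 4" "k < (a + 1) ^ 4"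
      and c': "c \<in> exceptional_codes n m k (set zs)"
      and cnt: "card (exceptional_codes n m k (set zs)) * (a + 1) ^ 12 \<le> 2 ^ a\<^sup>2"
      and close: "norm (grid_point (mesh ?d n) c - x) < (1/2) ^ l"
    note cnt = cnt[unfolded EX] and close = close[folded H_def]
    have c: "c < H ^ ?d" "E c" using c' unfolding EX by simp_all
    define W where "W = num (enc_list (enc_vec enc_int) zs)"
    have EE: "exceptional ?d W H R k c = E c" for c
      unfolding exceptional_def E_def on_shell_iff
      using energy_eq[OF _ W_def] nonneg by simp
    define t where "t = card {y. y < c \<and> E y}"
    define B where "B = (a + 1) ^ 4"
    define I where "I = n + B * (m + B * (k + B * t))"
    have B: "0 < B" by (simp add: B_def)
    have "t < card {c. c < H ^ ?d \<and> E c}" unfolding t_def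
      by (rule psubset_card_mono) (use c in auto)
    then have t: "Suc t \<le> card {c. c < H ^ ?d \<and> E c}" by simp
    have step: "u + B * v < B * w" if "u < B" "v < w" for u v w
    proof -
      have "u + B * v < B + B * v" using that by simp
      also have "\<dots> = B * Suc v" by simp
      also have "\<dots> \<le> B * w" using that by (intro mult_le_mono2) simp
      finally show ?thesis .
    qed
    have "I < B * (B * (B * Suc t))"
      unfolding I_def by (intro step) (use small in \<open>auto simp: B_def\<close>)
    also have "\<dots> = Suc t * B ^ 3" by (simp add: power3_eq_cube algebra_simps)
    also have "\<dots> = Suc t * (a + 1) ^ 12" unfolding B_def by (simp only: power_mult[symmetric]) simp
    also have "\<dots> \<le> 2 ^ (a ^ 2)" using t cnt by (meson le_trans mult_le_mono1)
    finally have "I < 2 ^ (a ^ 2)" .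
    from word_with_value[OF this] obtain w where w: "length w = a ^ 2" "\<And>xs. num (xs @ w) mod 2 ^ (a ^ 2) = I"
      by blast
    define p where "p = replicate a True @ False # w"
    have "takeWhile id (replicate a True @ False # w) = replicate a True" by (induction a) auto
    then have lead: "lead_ones (num p) = a" by (simp add: lead_ones_num p_def)
    have wf: "well_formed (num p)" by (simp add: well_formed_def lead) (simp add: p_def w(1))
    have pay: "payload (num p) = I" unfolding payload_def lead using w(2)[of "replicate a True @ [False]"] by (simp add: p_def)
    have rad: "radix (num p) = B" by (simp add: radix_def lead B_def)
    have small': "n < B" "m < B" "k < B" using small by (simp_all add: B_def)
    have d1: "I div B = m + B * (k + B * t)" unfolding I_def using small' B by simp
    have d2: "I div B ^ 2 = k + B * t"
      using d1 small' B by (simp add: power2_eq_square div_mult2_eq)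
    have d3: "I div B ^ 3 = t"
      using d2 small' B by (simp add: power3_eq_cube power2_eq_square div_mult2_eq)
    have fields: "field_n (num p) = n" "field_m (num p) = m" "field_k (num p) = k" "field_t (num p) = t"
      unfolding field_n_def field_m_def field_k_def field_t_def pay rad d1 d2 d3
      using small' by (simp_all add: I_def)
    have grid: "grid ?d (num p) = H" by (simp add: grid_def fields H_def)
    have "chosen ?d (num p) W = select ?d W H R k t"
      unfolding chosen_def grid unfolding fields R_def ..
    also have "\<dots> = c" unfolding select_def EE t_def by (rule select_eq[where E = E, OF c])
    finally have ch: "chosen ?d (num p) W = c" .
    define q :: "rat ^ 'k" where "q = (\<chi> i. of_int (grid_vec H c $ i) / of_nat H)"
    have "coord_code ?d (num p) W j = enc_rat (q $ (coords ! j))" if "j < ?d" for j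
      unfolding coord_code_def numer_def ch grid q_def
      using enc_rat_grid[of "n + ?d" c j] that
      by (simp add: H_def mesh_def grid_vec_def coord_index_nth)
    then have "concat (map (coord_code ?d (num p) W) [0..<?d]) = enc_vec enc_rat q"
      unfolding enc_vec_def by (intro arg_cong[of _ _ concat] nth_equalityI) auto
    with M(2)[OF wf run] have "tm_outputs M A p (enc_vec enc_rat q)" unfolding W_def by simp
    then have "tm_outputs U A (r @ p) (enc_vec enc_rat q)" using r by blast
    then have "kolm U A (enc_vec enc_rat q) \<le> length (r @ p)"
      unfolding kolm_def by (intro Least_le exI[of _ "r @ p"]) simp
    also have "\<dots> = length r + a + 1 + a ^ 2" by (simp add: p_def w(1))
    finally have le: "kolm U A (enc_vec enc_rat q) \<le> length r + a + 1 + a ^ 2" .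
    have "(\<chi> i. of_rat (q $ i)) = (grid_point H c :: real ^ 'k)"
      unfolding q_def grid_point_def by (simp add: vec_eq_iff of_rat_divide)
    then have "kolm_prec U A l x \<le> kolm U A (enc_vec enc_rat q)"
      unfolding kolm_prec_def using close by (intro Least_le exI[of _ q]) simp
    with le show "kolm_prec U A l x \<le> length r + a + 1 + a ^ 2" by linarith
  qed
qed

section \<open>Counting directions in a tube\<close>

text \<open>
  If all coordinates but the \<open>i\<close>-th are given, the shell condition confines \<open>(a $ i)\<^sup>2\<close> to an
  interval of length \<open>4 d H\<close>. As \<open>a $ i\<close> is of size at least \<open>H / (2 d)\<close> and of known sign, it lies
  in an interval of length \<open>4 d\<^sup>2\<close>, and its residue modulo \<open>4 d\<^sup>2 + 1\<close> determines it. The shell thus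
  contributes only \<open>d - 1\<close> degrees of freedom.
\<close>

lemma slab_count:
  fixes i :: "'k::finite" and J :: "'k \<Rightarrow> int set"
  assumes s: "s = 1 \<or> s = (-1 :: int)" and J: "\<And>j. finite (J j)" "\<And>j. card (J j) \<le> X" and H: "0 < H"
  defines "S \<equiv> {a :: int ^ 'k. (\<forall>j. j \<noteq> i \<longrightarrow> a $ j \<in> J j) \<and> shell H a \<and> int H \<le> 2 * int CARD('k) * (s * a $ i)}"
  shows "finite S \<and> card S \<le> X ^ (CARD('k) - 1) * (4 * CARD('k)^2 + 1)"
proof -
  define d where "d = int CARD('k)"
  define q where "q = 4 * d^2 + 1"
  define f where "f a = (restrict (\<lambda>j. a $ j) (UNIV - {i}), (s * a $ i) mod q)" for a :: "int ^ 'k"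
  let ?T = "PiE (UNIV - {i}) J \<times> {0..<q}"
  have d: "0 < d" by (simp add: d_def)
  have q: "0 < q" by (simp add: q_def add_nonneg_pos)
  have le: "s * a $ i \<le> s * b $ i"
    if a: "a \<in> S" and b: "b \<in> S" and eq: "\<And>j. j \<noteq> i \<Longrightarrow> a $ j = b $ j" and m: "(s * a $ i) mod q = (s * b $ i) mod q"
    for a b
  proof (rule ccontr)
    define u where "u = s * a $ i"
    define v where "v = s * b $ i"
    assume "\<not> ?thesis"
    then have uv: "v < u" by (simp add: u_def v_def)
    have "q dvd u - v" using m by (simp add: mod_eq_dvd_iff u_def v_def)
    then have uq: "q \<le> u - v" using uv by (intro zdvd_imp_le) auto
    have sq: "(a $ i)\<^sup>2 = u\<^sup>2" "(b $ i)\<^sup>2 = v\<^sup>2" using s by (auto simp: u_def v_def)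
    have "(\<Sum>j\<in>UNIV. (a $ j)\<^sup>2) = u\<^sup>2 + (\<Sum>j\<in>UNIV - {i}. (a $ j)\<^sup>2)"
      "(\<Sum>j\<in>UNIV. (b $ j)\<^sup>2) = v\<^sup>2 + (\<Sum>j\<in>UNIV - {i}. (b $ j)\<^sup>2)"
      unfolding sq[symmetric] by (rule sum.remove; simp)+
    moreover have "(\<Sum>j\<in>UNIV - {i}. (a $ j)\<^sup>2) = (\<Sum>j\<in>UNIV - {i}. (b $ j)\<^sup>2)"
      by (rule sum.cong) (use eq in auto)
    ultimately have "u\<^sup>2 - v\<^sup>2 \<le> 4 * d * int H"
      using a b unfolding S_def shell_def d_def by auto
    then have 1: "(u - v) * (u + v) \<le> 4 * d * int H" by (simp add: power2_eq_square algebra_simps)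
    have "int H \<le> 2 * d * u" "int H \<le> 2 * d * v" using a b by (auto simp: S_def d_def u_def v_def)
    then have 2: "int H \<le> d * (u + v)" by (simp add: algebra_simps)
    have "q * int H \<le> (u - v) * (d * (u + v))"
      by (rule mult_mono[OF uq 2]) (use uv in auto)
    also have "\<dots> = d * ((u - v) * (u + v))" by (simp add: algebra_simps)
    also have "\<dots> \<le> d * (4 * d * int H)" using 1 d by (intro mult_left_mono) auto
    finally have "q * int H \<le> (4 * d^2) * int H" by (simp add: power2_eq_square algebra_simps)
    then show False using H by (simp add: q_def)
  qed
  have inj: "inj_on f S"
  proof (rule inj_onI)
    fix a b assume a: "a \<in> S" and b: "b \<in> S" and eq: "f a = f b"
    have 1: "a $ j = b $ j" if "j \<noteq> i" for j
      using eq that unfolding f_def by (auto dest!: fun_cong[of _ _ j])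
    have 2: "(s * a $ i) mod q = (s * b $ i) mod q" using eq by (simp add: f_def)
    have "s * a $ i = s * b $ i"
      using le[OF a b 1 2] le[OF b a 1[symmetric] 2[symmetric]] by linarith
    then have "a $ i = b $ i" using s by auto
    with 1 show "a = b" by (metis vec_eq_iff)
  qed
  have "f a \<in> ?T" if "a \<in> S" for a
    unfolding f_def
  proof (rule SigmaI)
    show "restrict (\<lambda>j. a $ j) (UNIV - {i}) \<in> PiE (UNIV - {i}) J"
      by (rule iffD2[OF restrict_PiE_iff]) (use that in \<open>auto simp: S_def\<close>)
  qed (use q in simp)
  then have sub: "f ` S \<subseteq> ?T" by blast
  have fin: "finite ?T" by (intro finite_cartesian_product finite_PiE J) auto
  have "card S \<le> card ?T" by (rule card_inj_on_le[OF inj sub fin])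
  also have "\<dots> = (\<Prod>j\<in>UNIV - {i}. card (J j)) * nat q" by (simp add: card_cartesian_product card_PiE)
  also have "\<dots> \<le> (\<Prod>j\<in>UNIV - {i}. X) * nat q" using J by (intro mult_le_mono1 prod_mono) auto
  also have "nat q = 4 * CARD('k)^2 + 1" by (simp add: q_def d_def nat_add_distrib nat_mult_distrib nat_power_eq)
  finally show ?thesis using finite_subset[OF sub fin] inj finite_imageD by (auto simp: card_Diff_singleton)
qed

lemma shell_large_coordinate:
  assumes "shell H (a :: int ^ 'k::finite)" "4 * CARD('k) \<le> H"
  obtains i where "int H \<le> 2 * int CARD('k) * \<bar>a $ i\<bar>"
proof -
  define d where "d = int CARD('k)"
  have d: "0 < d" by (simp add: d_def)
  have H4: "4 * d \<le> int H" using assms(2) by (simp add: d_def)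
  have "\<exists>i. int H \<le> 2 * d * \<bar>a $ i\<bar>"
  proof (rule ccontr)
    assume "\<not> ?thesis"
    then have lt: "2 * d * \<bar>a $ i\<bar> < int H" for i by (simp add: not_le)
    have sq: "4 * d\<^sup>2 * (a $ i)\<^sup>2 \<le> (int H)\<^sup>2" for i
      using power_mono[of "2 * d * \<bar>a $ i\<bar>" "int H" 2] lt[of i] d by (simp add: power_mult_distrib)
    have "4 * d\<^sup>2 * (\<Sum>i\<in>UNIV. (a $ i)\<^sup>2) = (\<Sum>i\<in>UNIV. 4 * d\<^sup>2 * (a $ i)\<^sup>2)" by (rule sum_distrib_left)
    also have "\<dots> \<le> (\<Sum>i\<in>(UNIV :: 'k set). (int H)\<^sup>2)" by (intro sum_mono sq)
    also have "\<dots> = d * (int H)\<^sup>2" by (simp add: d_def)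
    finally have "4 * d * (\<Sum>i\<in>UNIV. (a $ i)\<^sup>2) \<le> (int H)\<^sup>2" using d by (simp add: power2_eq_square)
    moreover have "4 * d * ((int H)\<^sup>2 - 2 * d * int H) \<le> 4 * d * (\<Sum>i\<in>UNIV. (a $ i)\<^sup>2)"
      using assms(1) d by (intro mult_left_mono) (auto simp: shell_def d_def)
    ultimately have 1: "4 * d * ((int H)\<^sup>2 - 2 * d * int H) \<le> (int H)\<^sup>2" by linarith
    have "2 * d * int H \<le> int H * int H - 2 * d * int H" using mult_right_mono[OF H4, of "int H"] by (simp add: algebra_simps)
    moreover have "0 \<le> 2 * d * int H" using d by simp
    ultimately have "0 \<le> (int H)\<^sup>2 - 2 * d * int H" by (simp add: power2_eq_square)
    then have "4 * ((int H)\<^sup>2 - 2 * d * int H) \<le> 4 * d * ((int H)\<^sup>2 - 2 * d * int H)"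
      using d by (intro mult_right_mono) auto
    with 1 have "(3 * int H) * int H \<le> (8 * d) * int H" by (simp add: power2_eq_square)
    then have "3 * int H \<le> 8 * d" by (rule mult_right_le_imp_le) (use H4 d in linarith)
    then show False using H4 d by linarith
  qed
  then show thesis using that by (auto simp: d_def)
qed

lemma shell_count:
  assumes "4 * CARD('k::finite) \<le> H"
  defines "S \<equiv> {a :: int ^ 'k. shell H a \<and> (\<forall>j. \<bar>a $ j\<bar> \<le> int H)}"
  shows "finite S \<and> card S \<le> 2 * CARD('k) * ((3 * H) ^ (CARD('k) - 1) * (4 * CARD('k)^2 + 1))"
proof -
  let ?J = "\<lambda>j :: 'k. {- int H..int H}"
  let ?n = "(3 * H) ^ (CARD('k) - 1) * (4 * CARD('k)^2 + 1)"
  define T where "T p = {a :: int ^ 'k. (\<forall>j. j \<noteq> fst p \<longrightarrow> a $ j \<in> ?J j) \<and> shell H a \<and>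
     int H \<le> 2 * int CARD('k) * (snd p * a $ fst p)}" for p
  have H: "0 < H" using assms zero_less_card_finite[where 'a = 'k] by linarith
  have T: "finite (T p) \<and> card (T p) \<le> ?n" if "p \<in> UNIV \<times> {1, -1}" for p
    unfolding T_def
  proof (rule slab_count[OF _ _ _ H])
    show "snd p = 1 \<or> snd p = -1" using that by auto
    show "card {- int H..int H} \<le> 3 * H" using H by simp
  qed simp
  have "S \<subseteq> (\<Union>p\<in>UNIV \<times> {1, -1}. T p)"
  proof
    fix a assume a: "a \<in> S"
    then obtain i where i: "int H \<le> 2 * int CARD('k) * \<bar>a $ i\<bar>"
      using shell_large_coordinate[OF _ assms(1)] by (auto simp: S_def)
    have "a $ j \<in> ?J j" for j using a by (auto simp: S_def abs_le_iff minus_le_iff)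
    then have "a \<in> T (i, if 0 \<le> a $ i then 1 else -1)" using a i by (auto simp: T_def S_def)
    then show "a \<in> (\<Union>p\<in>UNIV \<times> {1, -1}. T p)" by (intro UN_I) auto
  qed
  moreover have fin: "finite (\<Union>p\<in>(UNIV :: 'k set) \<times> {1, -1}. T p)" using T by auto
  ultimately have "finite S" "card S \<le> card (\<Union>p\<in>(UNIV :: 'k set) \<times> {1, -1}. T p)"
    by (auto intro: finite_subset card_mono)
  note this(2)
  also have "card (\<Union>p\<in>(UNIV :: 'k set) \<times> {1, -1}. T p) \<le> (\<Sum>p\<in>(UNIV :: 'k set) \<times> {1, -1 :: int}. card (T p))"
    by (rule card_UN_le) simp
  also have "\<dots> \<le> (\<Sum>p\<in>(UNIV :: 'k set) \<times> {1, -1 :: int}. ?n)" by (rule sum_mono) (use T in blast)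
  also have "\<dots> = 2 * CARD('k) * ?n" by (simp add: card_cartesian_product)
  finally show ?thesis using \<open>finite S\<close> by simp
qed

lemma card_int_interval:
  fixes y Y :: real
  shows "finite {k :: int. \<bar>of_int k - y\<bar> \<le> Y}" "0 \<le> Y \<Longrightarrow> real (card {k :: int. \<bar>of_int k - y\<bar> \<le> Y}) \<le> 2 * Y + 1"
proof -
  have *: "{k :: int. \<bar>of_int k - y\<bar> \<le> Y} = {\<lceil>y - Y\<rceil>..\<lfloor>y + Y\<rfloor>}"
    by (auto simp: ceiling_le_iff le_floor_iff abs_le_iff)
  show "finite {k :: int. \<bar>of_int k - y\<bar> \<le> Y}" unfolding * by simp
  show "0 \<le> Y \<Longrightarrow> real (card {k :: int. \<bar>of_int k - y\<bar> \<le> Y}) \<le> 2 * Y + 1"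
    unfolding * by (simp add: nat_le_iff) linarith
qed

text \<open>
  Let \<open>i\<close> be the largest coordinate of \<open>v\<close>. In the tube around the line of \<open>v\<close> every coordinate of
  \<open>a\<close> is, up to \<open>\<rho> = R / D\<close>, the multiple \<open>\<alpha> j\<close> of \<open>a $ i\<close>. Hence the shell condition is one
  for \<open>(a $ i)\<^sup>2\<close> alone, and it places \<open>\<bar>a $ i\<bar>\<close> within a multiple of \<open>\<rho>\<close> of the length \<open>g\<close> at
  which the line meets the sphere of radius \<open>H\<close>.
\<close>

lemma tube_coordinates:
  fixes v a :: "int ^ 'k::finite" and i :: 'k
  assumes H: "0 < H" and shell: "shell H a" and aH: "\<And>j. \<bar>a $ j\<bar> \<le> int H" and tube: "tube R v a"
    and D: "0 < D" "\<bar>v $ i\<bar> = D" "\<And>j. \<bar>v $ j\<bar> \<le> D" "D \<le> R"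
  defines "\<alpha> \<equiv> \<lambda>j. real_of_int (v $ j) / real_of_int (v $ i)"
  defines "g \<equiv> real H / sqrt (\<Sum>j\<in>UNIV. (\<alpha> j)\<^sup>2)"
  defines "\<rho> \<equiv> real_of_int R / real_of_int D"
  shows "real H / real CARD('k) \<le> g"
    and "\<bar>\<bar>real_of_int (a $ i)\<bar> - g\<bar> \<le> 4 * real CARD('k)^2 * \<rho>"
    and "\<bar>real_of_int (a $ j) - \<alpha> j * real_of_int (a $ i)\<bar> \<le> \<rho>"
proof -
  define d where "d = real CARD('k)"
  have d: "1 \<le> d" by (simp add: d_def Suc_le_eq)
  have vi: "real_of_int (v $ i) \<noteq> 0" using D by auto
  have aD: "\<bar>real_of_int (v $ i)\<bar> = real_of_int D" using D(2) by (metis of_int_abs)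
  have \<rho>1: "1 \<le> \<rho>" using D by (simp add: \<rho>_def)
  have \<alpha>1: "\<bar>\<alpha> j\<bar> \<le> 1" for j
  proof -
    have "\<bar>real_of_int (v $ j)\<bar> \<le> real_of_int D" using D(3)[of j] by (metis of_int_abs of_int_le_iff)
    then show ?thesis using D(1) by (simp add: \<alpha>_def aD)
  qed
  have "\<alpha> i = 1" using vi by (simp add: \<alpha>_def)
  define S where "S = (\<Sum>j\<in>UNIV. (\<alpha> j)\<^sup>2)"
  have S1: "1 \<le> S" unfolding S_def using member_le_sum[of i UNIV "\<lambda>j. (\<alpha> j)\<^sup>2"] \<open>\<alpha> i = 1\<close> by simp
  have Sd: "S \<le> d" unfolding S_def d_def
    using sum_bounded_above[of UNIV "\<lambda>j. (\<alpha> j)\<^sup>2" 1] \<alpha>1 by (simp add: abs_square_le_1)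
  have gS: "g = real H / sqrt S" by (simp add: g_def S_def)
  have "sqrt S \<le> d"
  proof (rule real_le_lsqrt)
    have "d * 1 \<le> d * d" using d by (intro mult_left_mono) auto
    then show "S \<le> d\<^sup>2" using Sd by (simp add: power2_eq_square)
  qed (use d in auto)
  then show gd: "real H / real CARD('k) \<le> g"
    unfolding gS d_def[symmetric] using S1 by (intro divide_left_mono) (use d in auto)
  have diff: "\<bar>real_of_int (a $ j) - \<alpha> j * real_of_int (a $ i)\<bar> \<le> \<rho>" for j
  proof -
    have "v $ j * a $ i - v $ i * a $ j \<le> R" "v $ i * a $ j - v $ j * a $ i \<le> R"
      using tube by (auto simp: tube_def)
    then have "\<bar>v $ i * a $ j - v $ j * a $ i\<bar> \<le> R" by linarith
    then have "\<bar>real_of_int (v $ i) * real_of_int (a $ j) - real_of_int (v $ j) * real_of_int (a $ i)\<bar> \<le> real_of_int R"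
      by (metis of_int_abs of_int_diff of_int_le_iff of_int_mult)
    moreover have "real_of_int (v $ i) * real_of_int (a $ j) - real_of_int (v $ j) * real_of_int (a $ i)
       = real_of_int (v $ i) * (real_of_int (a $ j) - \<alpha> j * real_of_int (a $ i))"
      using vi by (simp add: \<alpha>_def algebra_simps)
    ultimately have "real_of_int D * \<bar>real_of_int (a $ j) - \<alpha> j * real_of_int (a $ i)\<bar> \<le> real_of_int R"
      by (simp add: abs_mult aD)
    then show ?thesis using D(1) by (simp add: \<rho>_def pos_le_divide_eq mult.commute)
  qed
  then show "\<bar>real_of_int (a $ j) - \<alpha> j * real_of_int (a $ i)\<bar> \<le> \<rho>" .
  have aHr: "\<bar>real_of_int (a $ j)\<bar> \<le> real H" for j using aH[of j] by (metis of_int_abs of_int_le_iff of_int_of_nat_eq)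
  have sqd: "\<bar>(real_of_int (a $ j))\<^sup>2 - (\<alpha> j * real_of_int (a $ i))\<^sup>2\<bar> \<le> 2 * real H * \<rho>" for j
  proof -
    have "\<bar>\<alpha> j * real_of_int (a $ i)\<bar> \<le> 1 * real H"
      unfolding abs_mult by (rule mult_mono[OF \<alpha>1 aHr]) auto
    then have "\<bar>real_of_int (a $ j) + \<alpha> j * real_of_int (a $ i)\<bar> \<le> 2 * real H" using aHr[of j] by linarith
    then have "\<bar>real_of_int (a $ j) + \<alpha> j * real_of_int (a $ i)\<bar> * \<bar>real_of_int (a $ j) - \<alpha> j * real_of_int (a $ i)\<bar> \<le> 2 * real H * \<rho>"
      by (rule mult_mono[OF _ diff]) auto
    then show ?thesis by (simp add: abs_mult[symmetric] power2_eq_square algebra_simps)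
  qed
  let ?x = "real_of_int (a $ i)"
  have "\<bar>(\<Sum>j\<in>UNIV. (real_of_int (a $ j))\<^sup>2) - ?x\<^sup>2 * S\<bar> = \<bar>\<Sum>j\<in>UNIV. ((real_of_int (a $ j))\<^sup>2 - (\<alpha> j * ?x)\<^sup>2)\<bar>"
    by (simp add: S_def sum_subtractf sum_distrib_left power_mult_distrib mult.commute)
  also have "\<dots> \<le> (\<Sum>j\<in>UNIV. \<bar>(real_of_int (a $ j))\<^sup>2 - (\<alpha> j * ?x)\<^sup>2\<bar>)" by (rule sum_abs)
  also have "\<dots> \<le> (\<Sum>j\<in>(UNIV :: 'k set). 2 * real H * \<rho>)" by (intro sum_mono sqd)
  also have "\<dots> = 2 * d * real H * \<rho>" by (simp add: d_def)
  finally have 1: "\<bar>(\<Sum>j\<in>UNIV. (real_of_int (a $ j))\<^sup>2) - ?x\<^sup>2 * S\<bar> \<le> 2 * d * real H * \<rho>" .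
  have "real_of_int \<bar>(\<Sum>j\<in>UNIV. (a $ j)\<^sup>2) - (int H)\<^sup>2\<bar> \<le> real_of_int (2 * int CARD('k) * int H)"
    using shell unfolding shell_def by (simp only: of_int_le_iff)
  then have 2: "\<bar>(\<Sum>j\<in>UNIV. (real_of_int (a $ j))\<^sup>2) - (real H)\<^sup>2\<bar> \<le> 2 * d * real H"
    by (simp add: d_def)
  have "2 * d * real H \<le> 2 * d * real H * \<rho>" using mult_left_mono[OF \<rho>1, of "2 * d * real H"] d by simp
  with 1 2 have 3: "\<bar>?x\<^sup>2 * S - (real H)\<^sup>2\<bar> \<le> 4 * d * real H * \<rho>" by linarith
  have g2: "g\<^sup>2 * S = (real H)\<^sup>2" using S1 by (simp add: gS power_divide)
  have "\<bar>?x\<^sup>2 - g\<^sup>2\<bar> \<le> \<bar>?x\<^sup>2 - g\<^sup>2\<bar> * S" using S1 by (simp add: mult_le_cancel_left1)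
  also have "\<dots> = \<bar>(?x\<^sup>2 - g\<^sup>2) * S\<bar>" using S1 by (simp add: abs_mult)
  also have "(?x\<^sup>2 - g\<^sup>2) * S = ?x\<^sup>2 * S - (real H)\<^sup>2" unfolding g2[symmetric] by (simp add: left_diff_distrib)
  also note 3
  finally have 4: "\<bar>?x\<^sup>2 - g\<^sup>2\<bar> \<le> 4 * d * real H * \<rho>" .
  have g0: "0 < g" using H S1 by (simp add: gS)
  have "\<bar>\<bar>?x\<bar> - g\<bar> * g \<le> \<bar>\<bar>?x\<bar> - g\<bar> * (\<bar>?x\<bar> + g)" by (intro mult_left_mono) auto
  also have "\<dots> = \<bar>(\<bar>?x\<bar> - g) * (\<bar>?x\<bar> + g)\<bar>" using g0 by (simp add: abs_mult)
  also have "\<dots> = \<bar>?x\<^sup>2 - g\<^sup>2\<bar>" by (simp add: power2_eq_square algebra_simps)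
  also note 4
  finally have 5: "\<bar>\<bar>?x\<bar> - g\<bar> * g \<le> 4 * d * real H * \<rho>" .
  have "real H \<le> d * g" using gd d by (simp add: d_def[symmetric] pos_divide_le_eq mult.commute)
  then have "4 * d * \<rho> * real H \<le> 4 * d * \<rho> * (d * g)" using d \<rho>1 by (intro mult_left_mono) auto
  with 5 have "\<bar>\<bar>?x\<bar> - g\<bar> * g \<le> (4 * d^2 * \<rho>) * g" by (simp add: power2_eq_square algebra_simps)
  then show "\<bar>\<bar>?x\<bar> - g\<bar> \<le> 4 * real CARD('k)^2 * \<rho>" using g0 by (simp add: d_def)
qed

text \<open>
  A random direction projects \<open>v\<close> to length at most \<open>r\<close> with probability of order
  \<open>(r / norm v) ^ (d - 1)\<close>; this is the discrete form. If \<open>\<rho>\<close> is comparable to \<open>H\<close>, the bound is that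
  for the whole shell. Otherwise the tube meets the shell in two short pieces, in which the
  coordinate \<open>a $ i\<close> is still large.
\<close>

lemma tube_count:
  fixes v :: "int ^ 'k::finite" and i :: 'k
  assumes H: "4 * CARD('k) \<le> H"
    and D: "0 < D" "\<bar>v $ i\<bar> = D" "\<And>j. \<bar>v $ j\<bar> \<le> D" "D \<le> R"
  defines "S \<equiv> {a :: int ^ 'k. shell H a \<and> (\<forall>j. \<bar>a $ j\<bar> \<le> int H) \<and> tube R v a}"
  shows "real (card S) \<le> 2 * real CARD('k) * (4 * real CARD('k)^2 + 1) *
     (24 * real CARD('k)^3 * (real_of_int R / real_of_int D)) ^ (CARD('k) - 1)"
proof -
  define d where "d = real CARD('k)"
  define \<rho> where "\<rho> = real_of_int R / real_of_int D"
  have d: "1 \<le> d" by (simp add: d_def Suc_le_eq)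
  have \<rho>1: "1 \<le> \<rho>" using D by (simp add: \<rho>_def)
  have H0: "0 < H" using H zero_less_card_finite[where 'a = 'k] by linarith
  have d23: "d\<^sup>2 \<le> d^3" using d by (intro power_increasing) auto
  show ?thesis
  proof (cases "8 * d^3 * \<rho> \<le> real H")
    case False
    then have "3 * real H \<le> 24 * d^3 * \<rho>" by linarith
    then have "(3 * real H) ^ (CARD('k) - 1) \<le> (24 * d^3 * \<rho>) ^ (CARD('k) - 1)" by (intro power_mono) auto
    moreover have "card S \<le> card {a :: int ^ 'k. shell H a \<and> (\<forall>j. \<bar>a $ j\<bar> \<le> int H)}"
      using shell_count[OF H] by (intro card_mono) (auto simp: S_def)
    then have "card S \<le> 2 * CARD('k) * ((3 * H) ^ (CARD('k) - 1) * (4 * CARD('k)^2 + 1))"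
      using shell_count[OF H] by linarith
    then have "real (card S) \<le> real (2 * CARD('k) * ((3 * H) ^ (CARD('k) - 1) * (4 * CARD('k)^2 + 1)))"
      by (rule of_nat_mono)
    then have "real (card S) \<le> 2 * d * (4 * d^2 + 1) * (3 * real H) ^ (CARD('k) - 1)"
      by (simp add: d_def algebra_simps)
    ultimately show ?thesis unfolding d_def[symmetric] \<rho>_def[symmetric] using d
      by (elim order_trans) (intro mult_left_mono, auto)
  next
    case True
    define \<alpha> where "\<alpha> j = real_of_int (v $ j) / real_of_int (v $ i)" for j
    define g where "g = real H / sqrt (\<Sum>j\<in>UNIV. (\<alpha> j)\<^sup>2)"
    have \<alpha>1: "\<bar>\<alpha> j\<bar> \<le> 1" for j
    proof -
      have "\<bar>real_of_int (v $ j)\<bar> \<le> real_of_int D" "\<bar>real_of_int (v $ i)\<bar> = real_of_int D"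
        using D(2) D(3)[of j] by (metis of_int_abs of_int_le_iff)+
      then show ?thesis using D(1) by (simp add: \<alpha>_def)
    qed
    define Y where "Y = 5 * d\<^sup>2 * \<rho>"
    have d2: "1 \<le> d\<^sup>2" using d by simp
    have Y1: "5 \<le> Y" using mult_mono[OF d2 \<rho>1] by (simp add: Y_def)
    define J where "J s j = {k :: int. \<bar>of_int k - s * \<alpha> j * g\<bar> \<le> Y}" for s j
    define X where "X = nat \<lfloor>2 * Y + 1\<rfloor>"
    define T where "T s = {a :: int ^ 'k. (\<forall>j. j \<noteq> i \<longrightarrow> a $ j \<in> J (of_int s) j) \<and> shell H a \<and>
       int H \<le> 2 * int CARD('k) * (s * a $ i)}" for s :: int
    have T: "finite (T s) \<and> card (T s) \<le> X ^ (CARD('k) - 1) * (4 * CARD('k)^2 + 1)" if "s = 1 \<or> s = -1" for s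
      unfolding T_def
    proof (rule slab_count[OF that _ _ H0])
      show "finite (J (of_int s) j)" for j unfolding J_def by (rule card_int_interval)
      have "real (card (J (of_int s) j)) \<le> 2 * Y + 1" for j
        unfolding J_def using Y1 by (intro card_int_interval) auto
      then show "card (J (of_int s) j) \<le> X" for j unfolding X_def by (intro le_nat_floor)
    qed
    have "S \<subseteq> T 1 \<union> T (-1)"
    proof
      fix a assume a: "a \<in> S"
      then have aa: "shell H a" "\<And>j. \<bar>a $ j\<bar> \<le> int H" "tube R v a" by (auto simp: S_def)
      note tc = tube_coordinates[OF H0 aa D, folded \<alpha>_def, folded g_def \<rho>_def d_def]
      define s :: int where "s = (if 0 \<le> a $ i then 1 else -1)"
      have sx: "real_of_int (a $ i) = real_of_int s * \<bar>real_of_int (a $ i)\<bar>" by (auto simp: s_def)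
      have s1: "\<bar>real_of_int s\<bar> = 1" by (simp add: s_def)
      have ai: "\<bar>real_of_int (a $ i) - real_of_int s * g\<bar> \<le> 4 * d\<^sup>2 * \<rho>"
        using tc(2) by (subst sx) (simp add: right_diff_distrib[symmetric] abs_mult s1)
      have "a $ j \<in> J (of_int s) j" for j
      proof -
        have "\<bar>\<alpha> j * (real_of_int (a $ i) - real_of_int s * g)\<bar> \<le> 1 * (4 * d\<^sup>2 * \<rho>)"
          unfolding abs_mult by (rule mult_mono[OF \<alpha>1 ai]) auto
        then have "\<bar>\<alpha> j * real_of_int (a $ i) - real_of_int s * \<alpha> j * g\<bar> \<le> 4 * d\<^sup>2 * \<rho>" by (simp add: algebra_simps)
        then have "\<bar>real_of_int (a $ j) - real_of_int s * \<alpha> j * g\<bar> \<le> \<rho> + 4 * d\<^sup>2 * \<rho>"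
          using tc(3)[of j] by linarith
        also have "\<dots> \<le> Y" using mult_right_mono[OF d2, of \<rho>] \<rho>1 by (simp add: Y_def)
        finally show ?thesis by (simp add: J_def)
      qed
      moreover have "int H \<le> 2 * int CARD('k) * (s * a $ i)"
      proof -
        have "8 * d ^ 3 * \<rho> = 2 * d * (4 * d\<^sup>2 * \<rho>)" by (simp add: power2_eq_square power3_eq_cube)
        then have "2 * d * (4 * d\<^sup>2 * \<rho>) \<le> real H" using True by linarith
        moreover have "2 * real H \<le> 2 * d * g" using tc(1) d by (simp add: pos_divide_le_eq mult.commute)
        moreover have "2 * d * (g - 4 * d\<^sup>2 * \<rho>) \<le> 2 * d * \<bar>real_of_int (a $ i)\<bar>"
          using tc(2) d by (intro mult_left_mono) (auto simp: abs_le_iff)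
        ultimately have "real H \<le> 2 * d * \<bar>real_of_int (a $ i)\<bar>" by (simp add: algebra_simps)
        then have "real_of_int (int H) \<le> real_of_int (2 * int CARD('k) * \<bar>a $ i\<bar>)" by (simp add: d_def)
        then have "int H \<le> 2 * int CARD('k) * \<bar>a $ i\<bar>" by (simp only: of_int_le_iff)
        moreover have "\<bar>a $ i\<bar> = s * a $ i" by (simp add: s_def)
        ultimately show ?thesis by simp
      qed
      ultimately have "a \<in> T s" using aa by (simp add: T_def)
      then show "a \<in> T 1 \<union> T (-1)" by (auto simp: s_def split: if_splits)
    qed
    then have "card S \<le> card (T 1 \<union> T (-1))" using T by (intro card_mono) auto
    also have "\<dots> \<le> card (T 1) + card (T (-1))" by (rule card_Un_le)
    also have "\<dots> \<le> 2 * (X ^ (CARD('k) - 1) * (4 * CARD('k)^2 + 1))" using T[of 1] T[of "-1"] by simp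
    finally have "real (card S) \<le> real (2 * (X ^ (CARD('k) - 1) * (4 * CARD('k)^2 + 1)))" by (rule of_nat_mono)
    also have "\<dots> = 2 * (4 * d^2 + 1) * real X ^ (CARD('k) - 1)" by (simp add: d_def algebra_simps)
    also have "\<dots> \<le> 2 * d * (4 * d^2 + 1) * (24 * d^3 * \<rho>) ^ (CARD('k) - 1)"
    proof (rule mult_mono)
      have "real X \<le> 2 * Y + 1" using Y1 by (simp add: X_def)
      also have "\<dots> \<le> 24 * d\<^sup>2 * \<rho>" using Y1 unfolding Y_def by linarith
      also have "\<dots> \<le> 24 * d^3 * \<rho>" using d23 \<rho>1 by simp
      finally show "real X ^ (CARD('k) - 1) \<le> (24 * d^3 * \<rho>) ^ (CARD('k) - 1)" by (intro power_mono) auto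
      show "2 * (4 * d^2 + 1) \<le> 2 * d * (4 * d^2 + 1)" using d by (intro mult_right_mono) auto
    qed (use d in auto)
    finally show ?thesis by (simp add: d_def \<rho>_def)
  qed
qed

section \<open>Dyadic cubes and the average energy\<close>

definition cell :: "nat \<Rightarrow> real ^ 'k::finite \<Rightarrow> int ^ 'k" where
  "cell n x = (\<chi> i. \<lfloor>x $ i * 2 ^ n\<rfloor>)"

definition ancestor :: "nat \<Rightarrow> int ^ 'k::finite \<Rightarrow> int ^ 'k" where
  "ancestor l z = (\<chi> i. z $ i div 2 ^ l)"

definition corner :: "nat \<Rightarrow> int ^ 'k::finite \<Rightarrow> real ^ 'k" where
  "corner n z = (\<chi> i. of_int (z $ i) * (1/2) ^ n)"

lemma in_dyadic_cube: "x \<in> dyadic_cube n z \<longleftrightarrow> cell n x = z"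
proof -
  have "of_int k * (1/2) ^ n \<le> y \<and> y < (of_int k + 1) * (1/2) ^ n \<longleftrightarrow> \<lfloor>y * 2 ^ n\<rfloor> = k" for k :: int and y :: real
    unfolding floor_eq_iff by (simp add: power_one_over field_simps)
  then show ?thesis by (simp add: dyadic_cube_def cell_def vec_eq_iff)
qed

lemma cell_corner: "cell n (corner n z) = z"
  by (simp add: cell_def corner_def vec_eq_iff power_one_over)

lemma inj_dyadic_cube: "inj (dyadic_cube n)"
  by (rule injI) (metis in_dyadic_cube cell_corner)

lemma cell_ancestor:
  assumes "m \<le> n" shows "cell m x = ancestor (n - m) (cell n x)"
proof -
  have "\<lfloor>y * 2 ^ m\<rfloor> = \<lfloor>y * 2 ^ n\<rfloor> div 2 ^ (n - m)" for y :: real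
  proof -
    have "(2::real) ^ n = 2 ^ m * 2 ^ (n - m)" using assms by (simp flip: power_add)
    then have "y * 2 ^ m = (y * 2 ^ n) / real_of_int (2 ^ (n - m))" by simp
    also have "\<lfloor>\<dots>\<rfloor> = \<lfloor>y * 2 ^ n\<rfloor> div 2 ^ (n - m)" by (rule floor_divide_real_eq_div) simp
    finally show ?thesis .
  qed
  then show ?thesis by (simp add: cell_def ancestor_def)
qed

lemma cover_cubes_union:
  "cover_cubes n (\<Union>(dyadic_cube n ` Z)) = dyadic_cube n ` Z"
proof (intro equalityI subsetI)
  fix Q assume "Q \<in> cover_cubes n (\<Union>(dyadic_cube n ` Z))"
  then obtain z x z' where *: "Q = dyadic_cube n z" "x \<in> dyadic_cube n z" "z' \<in> Z" "x \<in> dyadic_cube n z'"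
    by (auto simp: cover_cubes_def dyadic_cubes_def)
  then have "z = z'" by (simp add: in_dyadic_cube)
  with * show "Q \<in> dyadic_cube n ` Z" by simp
next
  fix Q assume "Q \<in> dyadic_cube n ` Z"
  then obtain z where z: "Q = dyadic_cube n z" "z \<in> Z" by auto
  have "corner n z \<in> dyadic_cube n z" by (simp add: in_dyadic_cube cell_corner)
  with z show "Q \<in> cover_cubes n (\<Union>(dyadic_cube n ` Z))"
    by (auto simp: cover_cubes_def dyadic_cubes_def)
qed

lemma cover_cubes_union_Int:
  assumes "m \<le> n"
  shows "cover_cubes n (\<Union>(dyadic_cube n ` Z) \<inter> dyadic_cube m w) = dyadic_cube n ` {z \<in> Z. ancestor (n - m) z = w}"
proof (intro equalityI subsetI)
  fix Q assume "Q \<in> cover_cubes n (\<Union>(dyadic_cube n ` Z) \<inter> dyadic_cube m w)"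
  then obtain z x z' where *: "Q = dyadic_cube n z" "x \<in> dyadic_cube n z" "z' \<in> Z" "x \<in> dyadic_cube n z'" "x \<in> dyadic_cube m w"
    by (auto simp: cover_cubes_def dyadic_cubes_def)
  then have "z = z'" "ancestor (n - m) z = w" using cell_ancestor[OF assms, of x] by (auto simp: in_dyadic_cube)
  with * show "Q \<in> dyadic_cube n ` {z \<in> Z. ancestor (n - m) z = w}" by auto
next
  fix Q assume "Q \<in> dyadic_cube n ` {z \<in> Z. ancestor (n - m) z = w}"
  then obtain z where z: "Q = dyadic_cube n z" "z \<in> Z" "ancestor (n - m) z = w" by auto
  have "corner n z \<in> dyadic_cube n z" "corner n z \<in> dyadic_cube m w"
    using cell_ancestor[OF assms, of "corner n z"] z by (auto simp: in_dyadic_cube cell_corner)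
  with z show "Q \<in> cover_cubes n (\<Union>(dyadic_cube n ` Z) \<inter> dyadic_cube m w)"
    by (auto simp: cover_cubes_def dyadic_cubes_def)
qed

lemma bounded_dyadic_cube: "bounded (dyadic_cube n (z :: int ^ 'k::finite))"
proof -
  have "dyadic_cube n z \<subseteq> cbox (corner n z) (\<chi> i. (of_int (z $ i) + 1) * (1/2) ^ n)"
    by (auto simp: dyadic_cube_def corner_def mem_box_cart less_imp_le)
  then show ?thesis using bounded_cbox bounded_subset by blast
qed

text \<open>
  The condition that defines a \<^const>\<open>delta_family\<close>, in terms of the positions of its cubes.
\<close>

definition regular :: "nat \<Rightarrow> real \<Rightarrow> real \<Rightarrow> (int ^ 'k::finite) set \<Rightarrow> bool" where
  "regular n s c Z \<longleftrightarrow> (\<forall>m\<le>n. \<forall>w.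
     real (card {z \<in> Z. ancestor (n - m) z = w}) \<le> c * 2 powr (- s * real m) * real (card Z))"

lemma delta_family_iff:
  assumes "finite Z" "Z \<noteq> {}"
  shows "delta_family n s c (dyadic_cube n ` Z) \<longleftrightarrow> regular n s c Z"
proof -
  have c: "card (dyadic_cube n ` Y) = card Y" for Y :: "(int ^ 'k) set"
    by (rule card_image) (rule inj_on_subset[OF inj_dyadic_cube], simp)
  have "bounded (\<Union>(dyadic_cube n ` Z))"
    by (rule bounded_Union) (use assms bounded_dyadic_cube in auto)
  moreover have "\<Union>(dyadic_cube n ` Z) \<noteq> {}"
  proof -
    obtain z where "z \<in> Z" using assms by auto
    moreover have "corner n z \<in> dyadic_cube n z" by (simp add: in_dyadic_cube cell_corner)
    ultimately show ?thesis by blast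
  qed
  moreover have "dyadic_cube n ` Z \<subseteq> dyadic_cubes n" by (auto simp: dyadic_cubes_def)
  ultimately show ?thesis
    by (auto simp: regular_def delta_family_def delta_set_def dyadic_cubes_def cover_cubes_union cover_cubes_union_Int c)
qed

lemma card_box_vec:
  assumes "\<And>i. finite (J i)" "\<And>i. card (J i) \<le> q"
  shows "finite {w :: 'a ^ 'k::finite. \<forall>i. w $ i \<in> J i} \<and> card {w :: 'a ^ 'k::finite. \<forall>i. w $ i \<in> J i} \<le> q ^ CARD('k)"
proof -
  let ?S = "{w :: 'a ^ 'k. \<forall>i. w $ i \<in> J i}"
  have inj: "inj_on vec_nth ?S" by (auto intro: inj_onI simp: vec_nth_inject)
  have sub: "vec_nth ` ?S \<subseteq> PiE UNIV J" by auto
  have fin: "finite (PiE UNIV J)" using assms by (intro finite_PiE) auto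
  have "card ?S \<le> card (PiE UNIV J)" by (rule card_inj_on_le[OF inj sub fin])
  also have "\<dots> = (\<Prod>i\<in>UNIV. card (J i))" by (simp add: card_PiE)
  also have "\<dots> \<le> (\<Prod>i\<in>(UNIV :: 'k set). q)" using assms by (intro prod_mono) auto
  finally show ?thesis using finite_imageD[OF finite_subset[OF sub fin] inj] by simp
qed

lemma div_close:
  fixes x y k :: int
  assumes "0 < k" "\<bar>x - y\<bar> \<le> k" shows "\<bar>x div k - y div k\<bar> \<le> 1"
proof -
  have "x div k \<le> (y + k) div k" "y div k \<le> (x + k) div k" using assms by (intro zdiv_mono1; linarith)+
  then show ?thesis using assms(1) by simp
qed

text \<open>
  Points at distance at most \<open>2 ^ l\<close> from \<open>z\<close> lie in the \<open>3 ^ d\<close> cubes of that size around \<open>z\<close>.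
\<close>

lemma near_count:
  fixes Z :: "(int ^ 'k::finite) set"
  assumes fin: "finite Z" and b: "\<And>w. real (card {z \<in> Z. ancestor l z = w}) \<le> b"
  shows "real (card {z' \<in> Z. \<forall>i. \<bar>z $ i - z' $ i\<bar> \<le> 2 ^ l}) \<le> 3 ^ CARD('k) * b"
proof -
  let ?J = "\<lambda>i. {ancestor l z $ i - 1..ancestor l z $ i + 1}"
  let ?W = "{w :: int ^ 'k. \<forall>i. w $ i \<in> ?J i}"
  have W: "finite ?W" "card ?W \<le> 3 ^ CARD('k)" using card_box_vec[of ?J 3] by auto
  have "{z' \<in> Z. \<forall>i. \<bar>z $ i - z' $ i\<bar> \<le> 2 ^ l} \<subseteq> (\<Union>w\<in>?W. {z \<in> Z. ancestor l z = w})"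
  proof
    fix z' assume z': "z' \<in> {z' \<in> Z. \<forall>i. \<bar>z $ i - z' $ i\<bar> \<le> 2 ^ l}"
    then have "\<bar>z $ i div 2 ^ l - z' $ i div 2 ^ l\<bar> \<le> 1" for i by (intro div_close) auto
    then have "ancestor l z' \<in> ?W" by (auto simp: ancestor_def abs_le_iff algebra_simps)
    then show "z' \<in> (\<Union>w\<in>?W. {z \<in> Z. ancestor l z = w})" using z' by auto
  qed
  then have "card {z' \<in> Z. \<forall>i. \<bar>z $ i - z' $ i\<bar> \<le> 2 ^ l} \<le> card (\<Union>w\<in>?W. {z \<in> Z. ancestor l z = w})"
    using W(1) fin by (intro card_mono) auto
  also have "\<dots> \<le> (\<Sum>w\<in>?W. card {z \<in> Z. ancestor l z = w})" by (rule card_UN_le[OF W(1)])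
  finally have "real (card {z' \<in> Z. \<forall>i. \<bar>z $ i - z' $ i\<bar> \<le> 2 ^ l}) \<le> real (\<Sum>w\<in>?W. card {z \<in> Z. ancestor l z = w})"
    by (rule of_nat_mono)
  also have "\<dots> = (\<Sum>w\<in>?W. real (card {z \<in> Z. ancestor l z = w}))" by (rule of_nat_sum)
  also have "\<dots> \<le> (\<Sum>w\<in>?W. b)" by (intro sum_mono b)
  also have "\<dots> = real (card ?W) * b" by simp
  also have "\<dots> \<le> real (3 ^ CARD('k)) * b"
    using order_trans[OF _ b] by (intro mult_right_mono of_nat_mono W(2)) auto
  finally show ?thesis by simp
qed

text \<open>The factor \<open>192 d\<^sup>4\<close> is \<open>24 d\<^sup>3\<close> from \<open>tube_count\<close> times \<open>8 d\<close> from the tube width.\<close>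

definition count_const :: "nat \<Rightarrow> real" where
  "count_const d = 2 * real d * (4 * real d ^ 2 + 1) * (192 * real d ^ 4) ^ (d - 1)"

lemma grid_size:
  assumes "1 \<le> n" shows "4 * CARD('k::finite) \<le> 2 ^ (n + CARD('k))"
proof -
  have "2 * j \<le> 2 ^ j" if "1 \<le> j" for j :: nat
    using that by (induction j rule: dec_induct) auto
  then have "2 * CARD('k) \<le> 2 ^ CARD('k)" by (simp add: Suc_le_eq)
  moreover have "(2::nat) ^ 1 * 2 ^ CARD('k) \<le> 2 ^ n * 2 ^ CARD('k)"
    using assms by (intro mult_le_mono1 power_increasing) auto
  then have "(2::nat) * 2 ^ CARD('k) \<le> 2 ^ (n + CARD('k))" by (simp add: power_add)
  ultimately show ?thesis by linarith
qed

text \<open>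
  The bounds of \<open>shell_count\<close> and \<open>tube_count\<close> in one: for a vector of size about \<open>2 ^ (n - l)\<close>
  the summand \<open>l\<close>, or the last one if \<open>v\<close> is shorter than \<open>2 ^ (n - m)\<close>, already bounds the
  left hand side. As a sum over scales the bound can be summed over \<open>v\<close> term by term.
\<close>

lemma direction_count:
  fixes v :: "int ^ 'k::finite"
  assumes n: "1 \<le> n" and m: "m \<le> n" and v: "\<And>i. \<bar>v $ i\<bar> \<le> 2 ^ n"
  defines "H \<equiv> mesh CARD('k) n" and "R \<equiv> tube_width CARD('k) n m"
  shows "real (card {a :: int ^ 'k. shell H a \<and> (\<forall>j. \<bar>a $ j\<bar> \<le> int H) \<and> tube (int R) v a}) \<le>
    (\<Sum>l\<le>m. of_bool (\<forall>i. \<bar>v $ i\<bar> \<le> 2 ^ (n - l)) *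
       (count_const CARD('k) * real H ^ (CARD('k) - 1) * (1/2) ^ ((m - l) * (CARD('k) - 1))))"
    (is "real (card ?S) \<le> (\<Sum>l\<le>m. ?f l)")
proof -
  let ?d = "CARD('k)"
  have d: "1 \<le> real ?d" by (simp add: Suc_le_eq)
  have R: "R = 4 * ?d * H * 2 ^ (n - m)" by (simp add: R_def H_def tube_width_def)
  have H4: "4 * ?d \<le> H" unfolding H_def mesh_def by (rule grid_size[OF n])
  have pos: "0 \<le> ?f l" for l by (simp add: count_const_def)
  obtain i where i: "\<And>j. \<bar>v $ j\<bar> \<le> \<bar>v $ i\<bar>"
  proof -
    have "Max (range (\<lambda>j. \<bar>v $ j\<bar>)) \<in> range (\<lambda>j. \<bar>v $ j\<bar>)" by (rule Max_in) auto
    then obtain i where "Max (range (\<lambda>j. \<bar>v $ j\<bar>)) = \<bar>v $ i\<bar>" by (rule rangeE)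
    moreover have "\<bar>v $ j\<bar> \<le> Max (range (\<lambda>j. \<bar>v $ j\<bar>))" for j by (rule Max_ge) auto
    ultimately have "\<bar>v $ j\<bar> \<le> \<bar>v $ i\<bar>" for j by simp
    then show thesis using that by blast
  qed
  define D where "D = \<bar>v $ i\<bar>"
  have vD: "(\<forall>i. \<bar>v $ i\<bar> \<le> 2 ^ k) \<longleftrightarrow> D \<le> 2 ^ k" for k using i order_trans by (auto simp: D_def)
  define l where "l = Max {l. l \<le> m \<and> D \<le> 2 ^ (n - l)}"
  have fin: "finite {l. l \<le> m \<and> D \<le> 2 ^ (n - l)}" by (rule finite_subset[of _ "{..m}"]) auto
  have "0 \<in> {l. l \<le> m \<and> D \<le> 2 ^ (n - l)}" using v by (simp add: D_def)
  then have "{l. l \<le> m \<and> D \<le> 2 ^ (n - l)} \<noteq> {}" by blast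
  from Max_in[OF fin this] have l: "l \<le> m" "D \<le> 2 ^ (n - l)" unfolding l_def by auto
  have "real (card ?S) \<le> ?f l"
  proof (cases "l < m")
    case False
    then have lm: "l = m" using l by simp
    have "card ?S \<le> card {a :: int ^ 'k. shell H a \<and> (\<forall>j. \<bar>a $ j\<bar> \<le> int H)}"
      using shell_count[OF H4] by (intro card_mono) auto
    also have "\<dots> \<le> 2 * ?d * ((3 * H) ^ (?d - 1) * (4 * ?d^2 + 1))" using shell_count[OF H4] by simp
    finally have "real (card ?S) \<le> real (2 * ?d * ((3 * H) ^ (?d - 1) * (4 * ?d^2 + 1)))" by (rule of_nat_mono)
    also have "\<dots> = 2 * real ?d * (4 * real ?d ^ 2 + 1) * 3 ^ (?d - 1) * real H ^ (?d - 1)"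
      by (simp add: power_mult_distrib algebra_simps)
    also have "\<dots> \<le> count_const ?d * real H ^ (?d - 1)"
    proof -
      have "3 \<le> 192 * real ?d ^ 4" using one_le_power[OF d, of 4] by linarith
      then have "3 ^ (?d - 1) \<le> (192 * real ?d ^ 4) ^ (?d - 1)" by (intro power_mono) auto
      then show ?thesis unfolding count_const_def by (intro mult_right_mono mult_left_mono) auto
    qed
    also have "\<dots> = ?f l" using l(2) unfolding vD lm by simp
    finally show ?thesis .
  next
    case True
    have "\<not> D \<le> 2 ^ (n - Suc l)"
    proof
      assume "D \<le> 2 ^ (n - Suc l)"
      then have "Suc l \<in> {l. l \<le> m \<and> D \<le> 2 ^ (n - l)}" using True by simp
      then have "Suc l \<le> l" unfolding l_def using fin by (rule Max_ge[rotated])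
      then show False by simp
    qed
    then have D2: "2 ^ (n - Suc l) < D" by simp
    have "0 < (2::int) ^ (n - Suc l)" by simp
    with D2 have D0: "0 < D" by linarith
    have "D \<le> 2 ^ n" using v by (simp add: D_def)
    also have "\<dots> \<le> int H" by (simp add: H_def mesh_def power_add)
    also have "\<dots> \<le> int R"
    proof -
      have "1 * H \<le> (4 * ?d * 2 ^ (n - m)) * H" by (rule mult_le_mono1) (simp add: Suc_le_eq)
      then have "H \<le> R" by (simp only: R mult_1 ac_simps)
      then show ?thesis by simp
    qed
    finally have DR: "D \<le> int R" .
    have i': "\<bar>v $ i\<bar> = D" "\<And>j. \<bar>v $ j\<bar> \<le> D" using i by (auto simp: D_def)
    have "real (card ?S) \<le> 2 * real ?d * (4 * real ?d^2 + 1) * (24 * real ?d^3 * (real_of_int (int R) / real_of_int D)) ^ (?d - 1)"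
      by (rule tube_count[OF H4 D0 i' DR])
    also have "\<dots> \<le> 2 * real ?d * (4 * real ?d^2 + 1) * (192 * real ?d ^ 4 * real H * (1/2) ^ (m - l)) ^ (?d - 1)"
    proof (intro mult_left_mono power_mono)
      have e: "(2::real) ^ (n - m) = 2 * 2 ^ (n - Suc l) * (1/2) ^ (m - l)"
      proof -
        have "n - l = (n - m) + (m - l)" "n - l = Suc (n - Suc l)" using True m by auto
        then have "(2::real) ^ (n - m) * 2 ^ (m - l) = 2 * 2 ^ (n - Suc l)"
          by (simp only: power_add[symmetric] power_Suc[symmetric])
        then show ?thesis by (simp add: power_one_over field_simps)
      qed
      have D2r: "2 ^ (n - Suc l) \<le> real_of_int D"
        using D2 of_int_le_iff[of "2 ^ (n - Suc l)" D, where 'a = real] by simp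
      have "real_of_int (int R) / real_of_int D \<le> real R / 2 ^ (n - Suc l)"
        using D2r D0 by (simp add: frac_le)
      also have "\<dots> = 8 * real ?d * real H * (1/2) ^ (m - l)"
        by (simp add: R e)
      finally have "24 * real ?d^3 * (real_of_int (int R) / real_of_int D) \<le> 24 * real ?d^3 * (8 * real ?d * real H * (1/2) ^ (m - l))"
        by (intro mult_left_mono) auto
      then show "24 * real ?d^3 * (real_of_int (int R) / real_of_int D) \<le> 192 * real ?d ^ 4 * real H * (1/2) ^ (m - l)"
        by (simp add: power3_eq_cube power4_eq_xxxx algebra_simps)
    qed (use D0 in auto)
    also have "\<dots> = count_const ?d * real H ^ (?d - 1) * (1/2) ^ ((m - l) * (?d - 1))"
      by (simp only: count_const_def power_mult_distrib power_mult mult.assoc)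
    also have "\<dots> = ?f l" using l(2) unfolding vD by simp
    finally show ?thesis .
  qed
  also have "?f l \<le> (\<Sum>l\<le>m. ?f l)" by (rule member_le_sum) (use l pos in auto)
  finally show ?thesis .
qed

text \<open>
  Double counting: the sum over all grid directions of the number of pairs in the tube is the sum over
  pairs of the number of directions. For fixed \<open>z\<close> the partners at distance about \<open>2 ^ (n - l)\<close>
  contribute a share of order \<open>c * 2 powr (- t l - (d - 1) (m - l))\<close> of all combinations of a partner
  and a direction, and because \<open>u \<le> t\<close> and \<open>u \<le> d - 1\<close> the power is at most \<open>2 powr (- u m)\<close> for
  every \<open>l\<close>. Markov's inequality then bounds the number of directions with \<open>2 ^ k\<close> pairs.
\<close>

lemma energy_average:
  fixes Z :: "(int ^ 'k::finite) set" and k :: nat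
  assumes n: "1 \<le> n" and m: "m \<le> n" and fin: "finite Z"
    and Z: "\<And>z z' i. z \<in> Z \<Longrightarrow> z' \<in> Z \<Longrightarrow> \<bar>z $ i - z' $ i\<bar> \<le> 2 ^ n"
    and reg: "regular n t c Z"
    and u: "u \<le> t" "u \<le> real CARD('k) - 1" and c: "0 \<le> c"
  defines "H \<equiv> mesh CARD('k) n"
  shows "real (card (exceptional_codes n m k Z)) * 2 ^ k \<le>
    count_const CARD('k) * 3 ^ CARD('k) * (real n + 1) * real H ^ (CARD('k) - 1) * c * 2 powr (- u * real m) * (real (card Z))\<^sup>2"
proof -
  let ?d = "CARD('k)"
  define R where "R = tube_width ?d n m"
  define E where "E = exceptional_codes n m k Z"
  have E_def': "E = {x. x < H ^ ?d \<and> shell H (grid_vec H x :: int ^ 'k) \<and> 2 ^ k \<le>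
     card {(z, z') \<in> Z \<times> Z. tube (int R) (z - z') (grid_vec H x)}}"
    by (simp add: E_def exceptional_codes_def tube_pairs_def H_def R_def)
  have frost: "real (card {z \<in> Z. ancestor (n - l) z = w}) \<le> c * 2 powr (- t * real l) * real (card Z)"
    if "l \<le> n" for l w using reg that by (simp add: regular_def)
  let ?S = "\<lambda>v. {a :: int ^ 'k. shell H a \<and> (\<forall>j. \<bar>a $ j\<bar> \<le> int H) \<and> tube (int R) v a}"
  let ?X = "{x. x < H ^ ?d \<and> shell H (grid_vec H x :: int ^ 'k)}"
  let ?K = "count_const ?d * real H ^ (?d - 1)"
  have H0: "0 < H" by (simp add: H_def mesh_def)
  have d1: "1 \<le> ?d" by (simp add: Suc_le_eq)
  have K0: "0 \<le> ?K" by (simp add: count_const_def)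
  have H4: "4 * ?d \<le> H" unfolding H_def mesh_def by (rule grid_size[OF n])
  have finX: "finite ?X" by simp
    have one: "(\<Sum>z'\<in>Z. real (card (?S (z - z')))) \<le> 3 ^ ?d * (real n + 1) * ?K * c * 2 powr (- u * real m) * real (card Z)"
    if z: "z \<in> Z" for z
  proof -
    have "(\<Sum>z'\<in>Z. real (card (?S (z - z')))) \<le> (\<Sum>z'\<in>Z. \<Sum>l\<le>m. of_bool (\<forall>i. \<bar>z $ i - z' $ i\<bar> \<le> 2 ^ (n - l)) *
        (?K * (1/2) ^ ((m - l) * (?d - 1))))"
    proof (rule sum_mono)
      fix z' assume "z' \<in> Z"
      then have "\<bar>(z - z') $ i\<bar> \<le> 2 ^ n" for i using Z z by simp
      from direction_count[OF n m this]
      show "real (card (?S (z - z'))) \<le> (\<Sum>l\<le>m. of_bool (\<forall>i. \<bar>z $ i - z' $ i\<bar> \<le> 2 ^ (n - l)) *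
        (?K * (1/2) ^ ((m - l) * (?d - 1))))" by (simp add: H_def R_def)
    qed
    also have "\<dots> = (\<Sum>l\<le>m. \<Sum>z'\<in>Z. of_bool (\<forall>i. \<bar>z $ i - z' $ i\<bar> \<le> 2 ^ (n - l)) *
        (?K * (1/2) ^ ((m - l) * (?d - 1))))" by (rule sum.swap)
    also have "\<dots> = (\<Sum>l\<le>m. real (card {z' \<in> Z. \<forall>i. \<bar>z $ i - z' $ i\<bar> \<le> 2 ^ (n - l)}) *
        (?K * (1/2) ^ ((m - l) * (?d - 1))))"
      using fin by (simp add: sum_distrib_right[symmetric] sum_of_bool_eq Int_def)
    also have "\<dots> \<le> (\<Sum>l\<le>m. 3 ^ ?d * ?K * c * real (card Z) * 2 powr (- u * real m))"
    proof (rule sum_mono)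
      fix l assume "l \<in> {..m}"
      then have l: "l \<le> m" "l \<le> n" using m by auto
      have "2 powr (- t * real l) * (1/2) ^ ((m - l) * (?d - 1)) = 2 powr (- t * real l - (real m - real l) * (real ?d - 1))"
      proof -
        have "(1/2::real) ^ k = 2 powr (- real k)" for k
          by (simp add: powr_minus_divide powr_realpow power_one_over)
        then have "(1/2::real) ^ ((m - l) * (?d - 1)) = 2 powr (- ((real m - real l) * (real ?d - 1)))"
          using l d1 by (simp add: of_nat_diff)
        then show ?thesis by (simp only: powr_add[symmetric]) (simp only: diff_conv_add_uminus)
      qed
      also have "\<dots> \<le> 2 powr (- u * real m)"
      proof (rule powr_mono)
        have "u * real l \<le> t * real l" "u * (real m - real l) \<le> (real ?d - 1) * (real m - real l)"
          using u l by (auto intro!: mult_right_mono)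
        then show "- t * real l - (real m - real l) * (real ?d - 1) \<le> - u * real m" by (simp add: algebra_simps)
      qed simp
      finally have decay: "2 powr (- t * real l) * (1/2) ^ ((m - l) * (?d - 1)) \<le> 2 powr (- u * real m)" .
      have "real (card {z' \<in> Z. \<forall>i. \<bar>z $ i - z' $ i\<bar> \<le> 2 ^ (n - l)}) \<le> 3 ^ ?d * (c * 2 powr (- t * real l) * real (card Z))"
        by (rule near_count[OF fin frost[OF l(2)]])
      then have "real (card {z' \<in> Z. \<forall>i. \<bar>z $ i - z' $ i\<bar> \<le> 2 ^ (n - l)}) * (?K * (1/2) ^ ((m - l) * (?d - 1)))
         \<le> 3 ^ ?d * (c * 2 powr (- t * real l) * real (card Z)) * (?K * (1/2) ^ ((m - l) * (?d - 1)))"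
        using K0 by (intro mult_right_mono) auto
      also have "\<dots> = 3 ^ ?d * ?K * c * real (card Z) * (2 powr (- t * real l) * (1/2) ^ ((m - l) * (?d - 1)))" by simp
      also have "\<dots> \<le> 3 ^ ?d * ?K * c * real (card Z) * 2 powr (- u * real m)"
        by (rule mult_left_mono[OF decay]) (use K0 c in simp)
      finally show "real (card {z' \<in> Z. \<forall>i. \<bar>z $ i - z' $ i\<bar> \<le> 2 ^ (n - l)}) * (?K * (1/2) ^ ((m - l) * (?d - 1)))
         \<le> 3 ^ ?d * ?K * c * real (card Z) * 2 powr (- u * real m)"
        .
    qed
    also have "\<dots> = (real m + 1) * (3 ^ ?d * ?K * c * real (card Z) * 2 powr (- u * real m))" by simp
    also have "\<dots> \<le> (real n + 1) * (3 ^ ?d * ?K * c * real (card Z) * 2 powr (- u * real m))"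
      using m K0 c by (intro mult_right_mono) auto
    finally show ?thesis by (simp add: mult_ac)
  qed
  have "real (card E) * 2 ^ k = (\<Sum>x\<in>E. 2 ^ k)" by simp
  also have "\<dots> \<le> (\<Sum>x\<in>E. real (card {(z, z') \<in> Z \<times> Z. tube (int R) (z - z') (grid_vec H x)}))"
  proof (rule sum_mono)
    fix x assume "x \<in> E"
    then have "2 ^ k \<le> card {(z, z') \<in> Z \<times> Z. tube (int R) (z - z') (grid_vec H x)}" by (simp add: E_def')
    then have "real (2 ^ k) \<le> real (card {(z, z') \<in> Z \<times> Z. tube (int R) (z - z') (grid_vec H x)})"
      by (rule of_nat_mono)
    then show "2 ^ k \<le> real (card {(z, z') \<in> Z \<times> Z. tube (int R) (z - z') (grid_vec H x)})"
      by simp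
  qed
  also have "\<dots> \<le> (\<Sum>x\<in>?X. real (card {(z, z') \<in> Z \<times> Z. tube (int R) (z - z') (grid_vec H x)}))"
    by (rule sum_mono2[OF finX]) (auto simp: E_def')
  also have "\<dots> = (\<Sum>x\<in>?X. \<Sum>p\<in>Z \<times> Z. of_bool (tube (int R) (fst p - snd p) (grid_vec H x)))"
  proof (rule sum.cong[OF refl])
    fix x
    have "{(z, z') \<in> Z \<times> Z. tube (int R) (z - z') (grid_vec H x)} = (Z \<times> Z) \<inter> {p. tube (int R) (fst p - snd p) (grid_vec H x)}"
      by auto
    then show "real (card {(z, z') \<in> Z \<times> Z. tube (int R) (z - z') (grid_vec H x)}) =
      (\<Sum>p\<in>Z \<times> Z. of_bool (tube (int R) (fst p - snd p) (grid_vec H x)))"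
      using fin by (simp add: sum_of_bool_eq)
  qed
  also have "\<dots> = (\<Sum>p\<in>Z \<times> Z. \<Sum>x\<in>?X. of_bool (tube (int R) (fst p - snd p) (grid_vec H x)))" by (rule sum.swap)
  also have "\<dots> \<le> (\<Sum>p\<in>Z \<times> Z. real (card (?S (fst p - snd p))))"
  proof (rule sum_mono)
    fix p :: "(int ^ 'k) \<times> (int ^ 'k)"
    let ?Y = "{x \<in> ?X. tube (int R) (fst p - snd p) (grid_vec H x)}"
    have "card ?Y \<le> card (?S (fst p - snd p))"
    proof (rule card_inj_on_le)
      show "inj_on (grid_vec H :: nat \<Rightarrow> int ^ 'k) ?Y" by (rule inj_on_subset[OF grid_vec_inj]) auto
      show "grid_vec H ` ?Y \<subseteq> ?S (fst p - snd p)" using grid_vec_bound[OF H0] by (auto intro: less_imp_le)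
      show "finite (?S (fst p - snd p))" by (rule finite_subset[OF _ shell_count[OF H4, THEN conjunct1]]) auto
    qed
    moreover have "(\<Sum>x\<in>?X. of_bool (tube (int R) (fst p - snd p) (grid_vec H x))) = real (card ?Y)"
      using finX by (simp add: sum_of_bool_eq Int_def)
    ultimately show "(\<Sum>x\<in>?X. of_bool (tube (int R) (fst p - snd p) (grid_vec H x))) \<le> real (card (?S (fst p - snd p)))"
      by simp
  qed
  also have "\<dots> = (\<Sum>z\<in>Z. \<Sum>z'\<in>Z. real (card (?S (z - z'))))" by (simp add: sum.cartesian_product case_prod_unfold)
  also have "\<dots> \<le> (\<Sum>z\<in>Z. 3 ^ ?d * (real n + 1) * ?K * c * 2 powr (- u * real m) * real (card Z))"
    by (intro sum_mono one)
  finally show ?thesis unfolding E_def by (simp add: power2_eq_square mult_ac)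
qed

section \<open>A regular part of the projection\<close>

text \<open>
  If few pairs of points have images in a common cube, at every scale, then a regular set is contained
  in the image. Remove the points with too many partners at some scale; as there are only \<open>n + 1\<close>
  scales, at least half of the points remain. The fibres of \<open>g\<close> over the images of the remaining
  points may still have different sizes, so pass to the images whose fibres have size between
  \<open>2 ^ l\<close> and \<open>2 ^ (l + 1)\<close> for the most popular \<open>l\<close>. For these, counting images is the same as
  counting points up to a factor 2.
\<close>

lemma regular_image:
  fixes g :: "'a \<Rightarrow> int ^ 'c::finite" and V u :: real
  assumes fin: "finite Z" and ne: "Z \<noteq> {}" and V: "0 < V" and L: "card Z < 2 ^ L"
    and pairs: "\<And>m. m \<le> n \<Longrightarrow> real (card {(z, z') \<in> Z \<times> Z. ancestor (n - m) (g z) = ancestor (n - m) (g z')})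
       \<le> V * 2 powr (- u * real m) * (real (card Z))\<^sup>2"
  defines "K \<equiv> 8 * (real n + 1) * V * real L"
  shows "\<exists>Y \<subseteq> g ` Z. Y \<noteq> {} \<and> regular n u K Y"
proof -
  define A where "A m y = ancestor (n - m) y" for m and y :: "int ^ 'c"
  define deg where "deg m z = card {z' \<in> Z. A m (g z) = A m (g z')}" for m z
  define T where "T m = 2 * (real n + 1) * V * 2 powr (- u * real m) * real (card Z)" for m
  define B where "B m = {z \<in> Z. T m < real (deg m z)}" for m
  define G where "G = Z - (\<Union>m\<le>n. B m)"
  have cZ: "0 < real (card Z)" using fin ne by (simp add: card_gt_0_iff)
  have B: "2 * (real n + 1) * real (card (B m)) \<le> real (card Z)" if m: "m \<le> n" for m
  proof -
    have "real (card (B m)) * T m = (\<Sum>z\<in>B m. T m)" by simp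
    also have "\<dots> \<le> (\<Sum>z\<in>B m. real (deg m z))" by (rule sum_mono) (simp add: B_def)
    also have "\<dots> \<le> (\<Sum>z\<in>Z. real (deg m z))" by (rule sum_mono2[OF fin]) (auto simp: B_def)
    also have "\<dots> = real (\<Sum>z\<in>Z. card {z' \<in> Z. A m (g z) = A m (g z')})" by (simp add: deg_def)
    also have "(\<Sum>z\<in>Z. card {z' \<in> Z. A m (g z) = A m (g z')}) = card (SIGMA z:Z. {z' \<in> Z. A m (g z) = A m (g z')})"
      using fin by (simp add: card_SigmaI)
    also have "(SIGMA z:Z. {z' \<in> Z. A m (g z) = A m (g z')}) =
       {(z, z') \<in> Z \<times> Z. ancestor (n - m) (g z) = ancestor (n - m) (g z')}" by (auto simp: A_def)
    also have "real (card \<dots>) \<le> V * 2 powr (- u * real m) * (real (card Z))\<^sup>2" by (rule pairs[OF m])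
    finally have "(2 * (real n + 1) * real (card (B m))) * (V * 2 powr (- u * real m) * real (card Z)) \<le>
       real (card Z) * (V * 2 powr (- u * real m) * real (card Z))"
      by (simp add: T_def power2_eq_square algebra_simps)
    then show ?thesis by (rule mult_right_le_imp_le) (use V cZ in simp)
  qed
  have "(real n + 1) * (2 * real (card (\<Union>m\<le>n. B m))) \<le> (real n + 1) * real (card Z)"
  proof -
    have "card (\<Union>m\<le>n. B m) \<le> (\<Sum>m\<le>n. card (B m))" by (rule card_UN_le) simp
    then have "real (card (\<Union>m\<le>n. B m)) \<le> real (\<Sum>m\<le>n. card (B m))" by (rule of_nat_mono)
    then have "2 * (real n + 1) * real (card (\<Union>m\<le>n. B m)) \<le> 2 * (real n + 1) * (\<Sum>m\<le>n. real (card (B m)))"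
      by (intro mult_left_mono) auto
    also have "\<dots> = (\<Sum>m\<le>n. 2 * (real n + 1) * real (card (B m)))" by (rule sum_distrib_left)
    also have "\<dots> \<le> (\<Sum>m\<le>n. real (card Z))" by (rule sum_mono) (use B in auto)
    finally show ?thesis by (simp add: algebra_simps)
  qed
  then have "2 * real (card (\<Union>m\<le>n. B m)) \<le> real (card Z)" by (rule mult_left_le_imp_le) simp
  moreover have "card G = card Z - card (\<Union>m\<le>n. B m)" unfolding G_def
    by (rule card_Diff_subset) (use fin in \<open>auto simp: B_def\<close>)
  moreover have "card (\<Union>m\<le>n. B m) \<le> card Z" by (rule card_mono[OF fin]) (auto simp: B_def)
  ultimately have G: "real (card Z) \<le> 2 * real (card G)" by (simp add: of_nat_diff)
  have finG: "finite G" and GZ: "G \<subseteq> Z" using fin by (auto simp: G_def)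
  have degG: "real (deg m z) \<le> T m" if "z \<in> G" "m \<le> n" for m z
    using that by (auto simp: G_def B_def not_less)
  define w where "w y = card {z \<in> G. g z = y}" for y
  define lev where "lev y = (LEAST l. w y < 2 ^ Suc l)" for y
  have lev1: "w y < 2 ^ Suc (lev y)" for y
    unfolding lev_def by (rule LeastI_ex) (metis less_exp less_SucI power_Suc less_trans lessI power_strict_increasing_iff one_less_numeral_iff semiring_norm(76))
  have lev2: "2 ^ lev y \<le> w y" if "y \<in> g ` G" for y
  proof (cases "lev y")
    case 0
    have "{z \<in> G. g z = y} \<noteq> {}" using that by auto
    then show ?thesis using 0 finG by (simp add: w_def card_gt_0_iff Suc_le_eq)
  next
    case (Suc l)
    then have "\<not> w y < 2 ^ Suc l" unfolding lev_def by (intro not_less_Least) simp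
    then show ?thesis using Suc by simp
  qed
  have levL: "lev y < L" if "y \<in> g ` G" for y
  proof -
    have "2 ^ lev y \<le> w y" by (rule lev2[OF that])
    also have "w y \<le> card Z" unfolding w_def by (rule card_mono[OF fin]) (use GZ in auto)
    also have "\<dots> < 2 ^ L" by (rule L)
    finally show ?thesis by simp
  qed
  define F where "F l = {z \<in> G. lev (g z) = l}" for l
  have "\<exists>l<L. card G \<le> L * card (F l)"
  proof (rule ccontr)
    assume no: "\<not> ?thesis"
    have "G = (\<Union>l<L. F l)" using levL by (auto simp: F_def)
    then have "card G \<le> (\<Sum>l<L. card (F l))" using card_UN_le[of "{..<L}" F] by simp
    then have "L * card G \<le> (\<Sum>l<L. L * card (F l))" by (simp add: sum_distrib_left[symmetric])
    moreover have "0 < L" using levL G cZ by (metis card.empty empty_iff ex_in_conv gr0I image_eqI less_irrefl mult_zero_right not_less not_less_zero of_nat_0)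
    then have "(\<Sum>l<L. L * card (F l)) < (\<Sum>l<L. card G)"
      using no by (intro sum_strict_mono) (auto simp: not_le)
    ultimately show False by simp
  qed
  then obtain l where l: "card G \<le> L * card (F l)" by blast
  define Y where "Y = g ` F l"
  have FG: "F l \<subseteq> G" and finF: "finite (F l)" using finG by (auto simp: F_def)
  have Yw: "{z \<in> F l. g z = y} = {z \<in> G. g z = y}" if "y \<in> Y" for y
    using that by (auto simp: Y_def F_def)
  have Yl: "lev y = l" "y \<in> g ` G" if "y \<in> Y" for y using that by (auto simp: Y_def F_def)
  have finY: "finite Y" by (simp add: Y_def finF)
  have cF: "card (F l) = (\<Sum>y\<in>Y. w y)"
  proof -
    have "card (F l) = (\<Sum>z\<in>F l. 1)" by simp
    also have "\<dots> = (\<Sum>y\<in>Y. \<Sum>z\<in>{z \<in> F l. g z = y}. 1)" unfolding Y_def by (rule sum.image_gen[OF finF])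
    also have "\<dots> = (\<Sum>y\<in>Y. w y)" by (rule sum.cong) (auto simp: w_def Yw)
    finally show ?thesis .
  qed
  have up: "card (F l) \<le> 2 ^ Suc l * card Y"
  proof -
    have "(\<Sum>y\<in>Y. w y) \<le> (\<Sum>y\<in>Y. 2 ^ Suc l)" by (rule sum_mono) (use lev1 Yl in \<open>metis less_imp_le\<close>)
    then show ?thesis by (simp add: cF mult.commute)
  qed
  have cG: "0 < card G" using G cZ by (metis gr0I mult_zero_right not_less of_nat_0)
  then have Yne: "Y \<noteq> {}" using l by (auto simp: Y_def)
  have main: "real (card {y \<in> Y. A m y = v}) \<le> K * 2 powr (- u * real m) * real (card Y)" if m: "m \<le> n" for m v
  proof (cases "{z \<in> F l. A m (g z) = v} = {}")
    case True
    then have "{y \<in> Y. A m y = v} = {}" by (auto simp: Y_def)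
    then have "card {y \<in> Y. A m y = v} = 0" by (simp only: card.empty)
    moreover have "0 \<le> K" using V by (simp add: K_def)
    ultimately show ?thesis by simp
  next
    case False
    then obtain z0 where z0: "z0 \<in> F l" "A m (g z0) = v" by auto
    let ?Y = "{y \<in> Y. A m y = v}"
    have "2 ^ l * card ?Y = (\<Sum>y\<in>?Y. 2 ^ l)" by simp
    also have "\<dots> \<le> (\<Sum>y\<in>?Y. w y)" by (rule sum_mono) (use lev2 Yl in fastforce)
    also have "\<dots> = (\<Sum>y\<in>?Y. card {z \<in> F l. g z = y})" by (rule sum.cong) (auto simp: w_def Yw)
    also have "\<dots> = card (\<Union>y\<in>?Y. {z \<in> F l. g z = y})"
      by (rule card_UN_disjoint[symmetric]) (use finY finF in auto)
    also have "\<dots> \<le> deg m z0" unfolding deg_def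
      by (rule card_mono) (use fin FG GZ z0 in auto)
    finally have "real (2 ^ l * card ?Y) \<le> real (deg m z0)" by (rule of_nat_mono)
    also have "\<dots> \<le> T m" by (rule degG) (use z0 FG m in auto)
    also have "\<dots> \<le> 2 * (real n + 1) * V * 2 powr (- u * real m) * (2 * real (2 ^ Suc l * (L * card Y)))"
      unfolding T_def
    proof (rule mult_left_mono)
      have "card G \<le> L * (2 ^ Suc l * card Y)" by (rule order_trans[OF l]) (rule mult_le_mono2[OF up])
      then have "card G \<le> 2 ^ Suc l * (L * card Y)" by (simp add: mult_ac)
      then have "real (card G) \<le> real (2 ^ Suc l * (L * card Y))" by (rule of_nat_mono)
      with G show "real (card Z) \<le> 2 * real (2 ^ Suc l * (L * card Y))" by linarith
    qed (use V in simp)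
    also have "\<dots> = 2 ^ l * (K * 2 powr (- u * real m) * real (card Y))" by (simp add: K_def)
    finally have "2 ^ l * real (card ?Y) \<le> 2 ^ l * (K * 2 powr (- u * real m) * real (card Y))" by simp
    then show ?thesis by (rule mult_left_le_imp_le) simp
  qed
  moreover have "Y \<subseteq> g ` Z" using FG GZ by (auto simp: Y_def)
  ultimately show ?thesis using Yne unfolding A_def regular_def by blast
qed

text \<open>A regular set is large, because it has at most one element in each of the smallest cubes.\<close>

lemma regular_card:
  fixes Y :: "(int ^ 'c::finite) set"
  assumes "regular n u K Y" "Y \<noteq> {}"
  shows "2 powr (u * real n) \<le> K * real (card Y)"
proof -
  obtain y where y: "y \<in> Y" using assms(2) by (meson ex_in_conv)
  have "{y' \<in> Y. ancestor (n - n) y' = ancestor (n - n) y} = {y}"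
    using y by (auto simp: ancestor_def vec_eq_iff)
  then have "1 \<le> K * 2 powr (- u * real n) * real (card Y)"
    using assms(1)[unfolded regular_def, THEN spec, of n, THEN mp, OF order.refl, THEN spec, of "ancestor (n - n) y"]
    by simp
  then have "2 powr (u * real n) * 1 \<le> 2 powr (u * real n) * (K * 2 powr (- u * real n) * real (card Y))"
    by (intro mult_left_mono) auto
  also have "\<dots> = K * real (card Y) * (2 powr (u * real n) * 2 powr (- u * real n))" by simp
  also have "2 powr (u * real n) * 2 powr (- u * real n) = 1" by (simp add: powr_add[symmetric])
  finally show ?thesis by simp
qed

lemma regular_mono:
  assumes "regular n u K Y" "K \<le> K'"
  shows "regular n u K' Y"
proof -
  have "K * 2 powr (- u * real m) * real (card Y) \<le> K' * 2 powr (- u * real m) * real (card Y)" for m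
    using assms(2) by (intro mult_right_mono) auto
  then show ?thesis using assms(1) unfolding regular_def by (meson order_trans)
qed

definition shadow :: "nat \<Rightarrow> real ^ 'k::finite \<Rightarrow> (real ^ 'k \<Rightarrow> real ^ 'c::finite) \<Rightarrow> int ^ 'k \<Rightarrow> int ^ 'c" where
  "shadow n e \<phi> z = cell n (\<phi> (perp_proj e (corner n z)))"

lemma perp_proj_diff: "perp_proj e x - perp_proj e y = perp_proj e (x - y)"
  by (simp add: perp_proj_def inner_diff_left scaleR_diff_left)

lemma perp_proj_scaleR: "perp_proj e (r *\<^sub>R x) = r *\<^sub>R perp_proj e x"
  by (simp add: perp_proj_def scaleR_diff_right)

lemma approximating_grid_point:
  fixes e :: "real ^ 'k::finite"
  assumes e: "norm e = 1" and H: "0 < H"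
  obtains c where "c < H ^ CARD('k)" "shell H (grid_vec H c :: int ^ 'k)"
    "\<And>i. \<bar>real_of_int (grid_vec H c $ i) - real H * e $ i\<bar> \<le> 1"
proof -
  have e1: "\<bar>e $ i\<bar> \<le> 1" for i using component_le_norm_cart[of e i] e by simp
  \<comment> \<open>Odd numerators have distance 2, so rounding costs at most 1; the minimum matters only for \<open>e $ i = 1\<close>.\<close>
  define b where "b i = min (nat \<lfloor>(real H * e $ i + real H) / 2\<rfloor>) (H - 1)" for i
  have b: "b i < H" for i using H by (auto simp: b_def)
  from grid_vec_surj[of b H, OF b] obtain c where c: "c < H ^ CARD('k)"
    "\<And>i. grid_vec H c $ (i :: 'k) = 2 * int (b i) + 1 - int H" by blast
  have near: "\<bar>real_of_int (grid_vec H c $ i) - real H * e $ i\<bar> \<le> 1" for i :: 'k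
  proof -
    let ?t = "(real H * e $ i + real H) / 2"
    have "- (real H * 1) \<le> real H * e $ i" "real H * e $ i \<le> real H * 1"
      using e1[of i] mult_left_mono[of "-1" "e $ i" "real H"] mult_left_mono[of "e $ i" 1 "real H"] by auto
    then have t: "0 \<le> ?t" "?t \<le> real H" by auto
    have f: "real (nat \<lfloor>?t\<rfloor>) \<le> ?t" "?t < real (nat \<lfloor>?t\<rfloor>) + 1"
    proof -
      have "real (nat \<lfloor>?t\<rfloor>) = of_int \<lfloor>?t\<rfloor>" using t by (intro of_nat_nat) simp
      then show "real (nat \<lfloor>?t\<rfloor>) \<le> ?t" "?t < real (nat \<lfloor>?t\<rfloor>) + 1"
        using of_int_floor_le[of ?t] real_of_int_floor_add_one_gt[of ?t] by linarith+
    qed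
    have "real (b i) \<le> ?t \<and> ?t \<le> real (b i) + 1"
    proof (cases "nat \<lfloor>?t\<rfloor> \<le> H - 1")
      case True
      then show ?thesis using f by (simp add: b_def)
    next
      case False
      then have "b i = H - 1" "real H \<le> real (nat \<lfloor>?t\<rfloor>)" by (auto simp: b_def)
      then show ?thesis using f t H by (simp add: of_nat_diff)
    qed
    then show ?thesis unfolding c(2) by (simp add: abs_le_iff)
  qed
  have "shell H (grid_vec H c :: int ^ 'k)"
  proof -
    let ?a = "\<lambda>i :: 'k. real_of_int (grid_vec H c $ i)"
    have sq: "\<bar>(?a i)\<^sup>2 - (real H * e $ i)\<^sup>2\<bar> \<le> 2 * real H" for i
    proof -
      have "\<bar>grid_vec H c $ i\<bar> < int H" by (rule grid_vec_bound[OF H])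
      then have "\<bar>?a i\<bar> \<le> real H" by linarith
      moreover have "\<bar>real H * e $ i\<bar> \<le> real H * 1" unfolding abs_mult using e1 by (intro mult_mono) auto
      ultimately have "\<bar>?a i + real H * e $ i\<bar> \<le> 2 * real H" by linarith
      from mult_mono[OF near[of i] this] have "\<bar>?a i - real H * e $ i\<bar> * \<bar>?a i + real H * e $ i\<bar> \<le> 2 * real H" by simp
      then show ?thesis by (simp add: abs_mult[symmetric] power2_eq_square algebra_simps)
    qed
    have "(\<Sum>i\<in>UNIV. (e $ i)\<^sup>2) = 1"
      using e by (simp add: norm_eq_1 inner_vec_def power2_eq_square)
    then have "(\<Sum>i\<in>UNIV. (real H * e $ i)\<^sup>2) = (real H)\<^sup>2"
      by (simp add: power_mult_distrib sum_distrib_left[symmetric])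
    then have "\<bar>(\<Sum>i\<in>UNIV. (?a i)\<^sup>2) - (real H)\<^sup>2\<bar> = \<bar>\<Sum>i\<in>UNIV. ((?a i)\<^sup>2 - (real H * e $ i)\<^sup>2)\<bar>"
      by (simp add: sum_subtractf)
    also have "\<dots> \<le> (\<Sum>i\<in>UNIV. \<bar>(?a i)\<^sup>2 - (real H * e $ i)\<^sup>2\<bar>)" by (rule sum_abs)
    also have "\<dots> \<le> (\<Sum>i\<in>(UNIV :: 'k set). 2 * real H)" by (intro sum_mono sq)
    finally have "real_of_int \<bar>(\<Sum>i\<in>UNIV. (grid_vec H c $ (i :: 'k))\<^sup>2) - (int H)\<^sup>2\<bar> \<le> real_of_int (2 * int CARD('k) * int H)"
      by (simp add: mult_ac)
    then show ?thesis unfolding shell_def by (simp only: of_int_le_iff)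
  qed
  with c(1) near show thesis using that by blast
qed

text \<open>
  Two points with images in a common cube of side \<open>2 ^ (- m)\<close> differ by a vector whose projection
  is at most \<open>d * 2 ^ (n - m)\<close> in units of \<open>2 ^ (- n)\<close>. The minors of that vector with \<open>e\<close> equal
  those of its projection with \<open>e\<close>; passing from \<open>H e\<close> to a grid point \<open>a\<close> near it
  changes them by at most twice the largest entry of the vector.
\<close>

lemma same_shadow_in_tube:
  fixes e :: "real ^ 'k::finite" and \<phi> :: "real ^ 'k \<Rightarrow> real ^ 'c::finite"
  assumes e: "norm e = 1" and \<phi>: "perp_isometry e \<phi>" and card: "CARD('c) \<le> CARD('k)" and m: "m \<le> n"
    and near: "\<And>i. \<bar>real_of_int (a $ i) - real H * e $ i\<bar> \<le> 1" and H: "2 ^ n \<le> H"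
    and v: "\<And>i. \<bar>(z - z') $ i\<bar> \<le> 2 ^ n"
    and same: "ancestor (n - m) (shadow n e \<phi> z) = ancestor (n - m) (shadow n e \<phi> z')"
  shows "tube (int (4 * CARD('k) * H * 2 ^ (n - m))) (z - z') a"
proof -
  define d where "d = real CARD('k)"
  have d: "1 \<le> d" by (simp add: d_def Suc_le_eq)
  define V where "V = (\<chi> i. real_of_int ((z - z') $ i))"
  define W where "W = perp_proj e V"
  have lin: "linear \<phi>" and iso: "\<And>x. x \<bullet> e = 0 \<Longrightarrow> norm (\<phi> x) = norm x"
    using \<phi> by (auto simp: perp_isometry_def)
  let ?y = "\<phi> (perp_proj e (corner n z))" and ?y' = "\<phi> (perp_proj e (corner n z'))"
  have "cell m ?y = cell m ?y'" using same cell_ancestor[OF m] unfolding shadow_def by metis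
  then have "\<lfloor>?y $ i * 2 ^ m\<rfloor> = \<lfloor>?y' $ i * 2 ^ m\<rfloor>" for i by (simp add: cell_def vec_eq_iff)
  then have "\<bar>?y $ i * 2 ^ m - ?y' $ i * 2 ^ m\<bar> < 1" for i by (smt (verit) floor_eq_iff)
  then have comp: "2 ^ m * \<bar>(?y - ?y') $ i\<bar> \<le> 1" for i
  proof -
    have "2 ^ m * \<bar>(?y - ?y') $ i\<bar> = \<bar>?y $ i * 2 ^ m - ?y' $ i * 2 ^ m\<bar>"
      by (simp add: left_diff_distrib[symmetric] abs_mult)
    then show ?thesis using \<open>\<And>i. \<bar>?y $ i * 2 ^ m - ?y' $ i * 2 ^ m\<bar> < 1\<close>[of i] by linarith
  qed
  have "2 ^ m * norm (?y - ?y') \<le> 2 ^ m * (\<Sum>i\<in>UNIV. \<bar>(?y - ?y') $ i\<bar>)"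
    by (intro mult_left_mono norm_le_l1_cart) auto
  also have "\<dots> = (\<Sum>i\<in>UNIV. 2 ^ m * \<bar>(?y - ?y') $ i\<bar>)" by (rule sum_distrib_left)
  also have "\<dots> \<le> (\<Sum>i\<in>(UNIV :: 'c set). 1)" by (intro sum_mono comp)
  also have "\<dots> \<le> d" using card by (simp add: d_def)
  finally have 1: "2 ^ m * norm (?y - ?y') \<le> d" .
  have "corner n z - corner n z' = (1/2) ^ n *\<^sub>R V"
    by (simp add: corner_def V_def vec_eq_iff algebra_simps)
  then have "perp_proj e (corner n z) - perp_proj e (corner n z') = (1/2) ^ n *\<^sub>R W"
    by (simp add: perp_proj_diff perp_proj_scaleR W_def)
  then have "?y - ?y' = (1/2) ^ n *\<^sub>R \<phi> W"
    using linear_diff[OF lin] linear_cmul[OF lin] by metis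
  moreover have "W \<bullet> e = 0" using e by (simp add: W_def perp_proj_def inner_diff_left norm_eq_1)
  ultimately have "norm (?y - ?y') = (1/2) ^ n * norm W" by (simp add: iso)
  with 1 have "2 ^ m * ((1/2) ^ n * norm W) \<le> d" by simp
  moreover have "(2::real) ^ n = 2 ^ m * 2 ^ (n - m)" using m by (simp flip: power_add)
  ultimately have W: "norm W \<le> d * 2 ^ (n - m)" by (simp add: power_one_over field_simps)
  have Wi: "\<bar>W $ i\<bar> \<le> d * 2 ^ (n - m)" for i using component_le_norm_cart[of W i] W by linarith
  have e1: "\<bar>e $ i\<bar> \<le> 1" for i using component_le_norm_cart[of e i] e by simp
  have cross: "\<bar>V $ j * e $ i - V $ i * e $ j\<bar> \<le> 2 * d * 2 ^ (n - m)" for i j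
  proof -
    have "V = W + (V \<bullet> e) *\<^sub>R e" by (simp add: W_def perp_proj_def)
    then have c: "V $ k = W $ k + (V \<bullet> e) * e $ k" for k by (metis vector_add_component vector_scaleR_component real_scaleR_def)
    have "V $ j * e $ i - V $ i * e $ j = W $ j * e $ i - W $ i * e $ j"
      unfolding c[of j] c[of i] by (simp add: algebra_simps)
    moreover have "\<bar>W $ j * e $ i\<bar> \<le> (d * 2 ^ (n - m)) * 1" "\<bar>W $ i * e $ j\<bar> \<le> (d * 2 ^ (n - m)) * 1"
      unfolding abs_mult using d by (intro mult_mono Wi e1; simp)+
    ultimately show ?thesis by linarith
  qed
  have Vb: "\<bar>V $ i\<bar> \<le> real H" for i
  proof -
    have "int (2 ^ n) \<le> int H" using H by (simp only: of_nat_le_iff)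
    then have "\<bar>(z - z') $ i\<bar> \<le> int H" using v[of i] by (simp only: of_nat_power of_nat_numeral)
    then show ?thesis unfolding V_def by simp
  qed
  have "V $ j * real_of_int (a $ i) - V $ i * real_of_int (a $ j) \<le> 4 * d * real H * 2 ^ (n - m)" for i j
  proof -
    have "\<bar>V $ j * (real_of_int (a $ i) - real H * e $ i)\<bar> \<le> real H * 1"
      "\<bar>V $ i * (real_of_int (a $ j) - real H * e $ j)\<bar> \<le> real H * 1"
      unfolding abs_mult by (intro mult_mono Vb near; simp)+
    moreover have "V $ j * real_of_int (a $ i) - V $ i * real_of_int (a $ j) =
       real H * (V $ j * e $ i - V $ i * e $ j) + V $ j * (real_of_int (a $ i) - real H * e $ i)
       - V $ i * (real_of_int (a $ j) - real H * e $ j)" by (simp add: algebra_simps)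
    moreover have "real H * (V $ j * e $ i - V $ i * e $ j) \<le> real H * (2 * d * 2 ^ (n - m))"
      using cross[of j i] by (intro mult_left_mono) (auto simp: abs_le_iff)
    moreover have "1 * 1 \<le> d * 2 ^ (n - m)" using d by (intro mult_mono) auto
    then have "2 * real H * 1 \<le> 2 * real H * (d * 2 ^ (n - m))" by (intro mult_left_mono) auto
    ultimately show ?thesis by (simp add: algebra_simps)
  qed
  then have "real_of_int ((z - z') $ j * a $ i - (z - z') $ i * a $ j) \<le> real_of_int (int (4 * CARD('k) * H * 2 ^ (n - m)))" for i j
    by (simp add: V_def d_def)
  then show ?thesis unfolding tube_def by (simp only: of_int_le_iff) simp
qed

lemma half_power_powr: "((1/2 :: real) ^ n) powr x = 2 powr (- real n * x)"
proof -
  have "(1/2 :: real) ^ n = 2 powr (- real n)" by (simp add: powr_minus_divide powr_realpow power_one_over)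
  then show ?thesis by (simp add: powr_powr)
qed

text \<open>
  The length of the payload is \<open>a\<^sup>2\<close> for the integer part \<open>a\<close> of the square root of \<open>(D - 2 \<epsilon>) n\<close>. This is
  less than \<open>(D - \<epsilon>) n\<close> by a margin that absorbs the overhead of the program, and more than the logarithm
  \<open>(D - 3 \<epsilon>) n + O(log n)\<close> of the number of exceptional directions.
\<close>

lemma asymptotic_choice:
  fixes \<epsilon> D r K :: real and d :: nat
  assumes "0 < \<epsilon>" "\<epsilon> < 1/4" "1 \<le> D"
  shows "eventually (\<lambda>n. \<exists>a :: nat.
      r + real a + 1 + real a ^ 2 < D * real n - \<epsilon> * real n \<and>
      K * (real n + 1) * 2 powr (D * real n - 3 * \<epsilon> * real n) * (real a + 1) ^ 12 \<le> 2 ^ (a ^ 2) \<and>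
      2 * (n + 1) * d + n + 1 < (a + 1) ^ 4 \<and>
      16 * (real n + 1) * ((real n + 1) * real d + 1) \<le> 2 powr (\<epsilon> * real n) \<and> 1 \<le> n) sequentially"
proof -
  define \<beta> where "\<beta> = D - 2 * \<epsilon>"
  have \<beta>: "0 < \<beta>" using assms by (simp add: \<beta>_def)
  have 1: "eventually (\<lambda>n :: nat. r + sqrt (\<beta> * real n) + 1 < \<epsilon> * real n) sequentially"
    using assms(1) \<beta> by real_asymp
  have 2: "eventually (\<lambda>n :: nat. K * (real n + 1) * (sqrt (\<beta> * real n) + 1) ^ 12 \<le> 2 powr (\<epsilon> * real n - 2 * sqrt (\<beta> * real n))) sequentially"
    using assms(1) \<beta> by real_asymp
  have 3: "eventually (\<lambda>n :: nat. 2 * (real n + 1) * real d + real n + 1 < (\<beta> * real n)\<^sup>2) sequentially"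
    using \<beta> by real_asymp
  have 4: "eventually (\<lambda>n :: nat. 16 * (real n + 1) * ((real n + 1) * real d + 1) \<le> 2 powr (\<epsilon> * real n)) sequentially"
    using assms(1) by real_asymp
  have 5: "eventually (\<lambda>n :: nat. 1 \<le> sqrt (\<beta> * real n)) sequentially"
    using \<beta> by real_asymp
  show ?thesis
    using 1 2 3 4 5 eventually_ge_at_top[of 1]
  proof eventually_elim
    case (elim n)
    define s where "s = sqrt (\<beta> * real n)"
    have s2: "s\<^sup>2 = \<beta> * real n" using \<beta> by (simp add: s_def)
    define a where "a = nat \<lfloor>s\<rfloor>"
    have s1: "1 \<le> s" using elim by (simp add: s_def)
    have a: "real a \<le> s" "s < real a + 1" unfolding a_def using s1 by (simp_all add: of_nat_nat)
    have asq: "real a ^ 2 \<le> s\<^sup>2" using a by (intro power_mono) auto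
    have "(s - 1)\<^sup>2 \<le> real a ^ 2" using a s1 by (intro power_mono) auto
    then have asq2: "s\<^sup>2 - 2 * s \<le> real a ^ 2" by (simp add: power2_diff)
    have K0: "K * (real n + 1) * (real a + 1) ^ 12 \<le> 2 powr (\<epsilon> * real n - 2 * s)"
    proof (cases "0 \<le> K")
      case True
      have "(real a + 1) ^ 12 \<le> (s + 1) ^ 12" using a by (intro power_mono) auto
      then have "K * (real n + 1) * (real a + 1) ^ 12 \<le> K * (real n + 1) * (s + 1) ^ 12"
        using True by (intro mult_left_mono) auto
      then show ?thesis using elim(2) by (simp add: s_def)
    next
      case False
      then have "K * (real n + 1) * (real a + 1) ^ 12 \<le> 0" by (intro mult_nonpos_nonneg) auto
      then show ?thesis by (rule order_trans) simp
    qed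
    have "K * (real n + 1) * 2 powr (D * real n - 3 * \<epsilon> * real n) * (real a + 1) ^ 12
       = 2 powr (D * real n - 3 * \<epsilon> * real n) * (K * (real n + 1) * (real a + 1) ^ 12)" by simp
    also have "\<dots> \<le> 2 powr (D * real n - 3 * \<epsilon> * real n) * 2 powr (\<epsilon> * real n - 2 * s)"
      by (rule mult_left_mono[OF K0]) simp
    also have "\<dots> = 2 powr (s\<^sup>2 - 2 * s)" unfolding s2 \<beta>_def by (simp add: powr_add[symmetric] algebra_simps)
    also have "\<dots> \<le> 2 powr (real (a ^ 2))" using asq2 by (intro powr_mono) auto
    also have "\<dots> = 2 ^ (a ^ 2)" by (simp add: powr_realpow del: of_nat_power)
    finally have A: "K * (real n + 1) * 2 powr (D * real n - 3 * \<epsilon> * real n) * (real a + 1) ^ 12 \<le> 2 ^ (a ^ 2)" .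
    have "(\<beta> * real n)\<^sup>2 = s ^ 4" unfolding s2[symmetric] by (simp flip: power_mult)
    also have "\<dots> \<le> (real a + 1) ^ 4" using a s1 by (intro power_mono) auto
    finally have "real (2 * (n + 1) * d + n + 1) < real ((a + 1) ^ 4)" using elim(3) by (simp add: algebra_simps)
    then have B: "2 * (n + 1) * d + n + 1 < (a + 1) ^ 4" by (simp only: of_nat_less_iff)
    have C: "r + real a + 1 + real a ^ 2 < D * real n - \<epsilon> * real n"
      using asq a(1) elim(1) unfolding s2 \<beta>_def s_def[unfolded \<beta>_def, symmetric] by (simp add: algebra_simps)
    show ?case using A B C elim(4,6) by blast
  qed
qed

section \<open>The projection in a complex direction\<close>

lemma data_bounds:
  assumes "\<forall>Q\<in>dyadic_cube n ` Z. Q \<subseteq> cbox (0 :: real ^ 'k::finite) 1" "z \<in> Z"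
  shows "0 \<le> z $ i" "z $ i \<le> 2 ^ n"
proof -
  have "corner n z \<in> dyadic_cube n z" by (simp add: in_dyadic_cube cell_corner)
  then have "corner n z \<in> cbox 0 1" using assms by auto
  then have *: "0 \<le> real_of_int (z $ i) * (1/2) ^ n" "real_of_int (z $ i) * (1/2) ^ n \<le> 1"
    by (auto simp: mem_box_cart corner_def)
  have "0 < (1/2 :: real) ^ n" by simp
  with *(1) have "0 \<le> real_of_int (z $ i)" by (meson mult_neg_pos not_less)
  then show "0 \<le> z $ i" by simp
  have "real_of_int (z $ i) \<le> real_of_int (2 ^ n)" using *(2) by (simp add: power_one_over field_simps)
  then show "z $ i \<le> 2 ^ n" by (simp only: of_int_le_iff)
qed

lemma card_data:
  assumes "\<And>z i. z \<in> Z \<Longrightarrow> 0 \<le> z $ i \<and> z $ i \<le> (2 :: int) ^ n"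
  shows "card (Z :: (int ^ 'k::finite) set) \<le> 2 ^ ((n + 1) * CARD('k))"
proof -
  let ?J = "\<lambda>i :: 'k. {0..(2 :: int) ^ n}"
  have "card (?J i) \<le> 2 ^ (n + 1)" for i
  proof -
    have "nat (2 ^ n + 1) = 2 ^ n + 1" by (simp add: nat_add_distrib nat_power_eq)
    then show ?thesis by (simp add: Suc_le_eq)
  qed
  from card_box_vec[of ?J, OF _ this] have J: "finite {w :: int ^ 'k. \<forall>i. w $ i \<in> ?J i}"
    "card {w :: int ^ 'k. \<forall>i. w $ i \<in> ?J i} \<le> (2 ^ (n + 1)) ^ CARD('k)" by auto
  have "card Z \<le> card {w :: int ^ 'k. \<forall>i. w $ i \<in> ?J i}" by (rule card_mono[OF J(1)]) (use assms in auto)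
  with J(2) show ?thesis by (simp only: power_mult)
qed

text \<open>
  The threshold for the number of pairs has to be a power of two, as only its exponent fits into the
  program. An integer above \<open>2 x\<close> is at least the first power of two that is not below \<open>x\<close>; this
  includes the case \<open>x \<le> 1\<close>, where the power is 1.
\<close>

lemma threshold_exponent:
  fixes x :: real
  assumes "0 < x" "x \<le> 2 ^ b"
  obtains k :: nat where "k \<le> b" "x \<le> 2 ^ k" "\<And>N :: nat. 2 * x < real N \<Longrightarrow> 2 ^ k \<le> N"
proof -
  define k where "k = (LEAST k. x \<le> 2 ^ k)"
  have 1: "x \<le> 2 ^ k" unfolding k_def by (rule LeastI[of _ b]) (rule assms)
  have 2: "k \<le> b" unfolding k_def by (rule Least_le) (rule assms)
  have 3: "2 ^ k \<le> N" if N: "2 * x < real N" for N :: nat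
  proof (cases k)
    case 0
    have "0 < real N" using N assms by linarith
    then show ?thesis using 0 by simp
  next
    case (Suc j)
    then have "\<not> x \<le> 2 ^ j" unfolding k_def by (intro not_less_Least) simp
    then have "real (2 ^ k) \<le> real N" using N Suc by simp
    then show ?thesis by (simp only: of_nat_le_iff)
  qed
  show thesis by (rule that[OF 2 1 3])
qed

text \<open>
  If the projected energy at scale \<open>m\<close> were too large, a grid point near \<open>e\<close> would be exceptional.
  By \<open>energy_average\<close> there are few exceptional grid points, so \<open>e\<close> would have a short program
  at scale \<open>n\<close>, against the lower bound for its complexity \<open>\<kappa>\<close>.
\<close>

lemma projected_energy:
  fixes e :: "real ^ 'd::finite" and \<phi> :: "real ^ 'd \<Rightarrow> real ^ 'c::finite" and Z :: "(int ^ 'd) set"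
    and \<epsilon> \<eta> t u r :: real and n m a \<kappa> :: nat
  defines "D \<equiv> real CARD('d) - 1"
  defines "V \<equiv> 2 * 2 powr ((\<eta> + 3 * \<epsilon>) * real n)"
  assumes card: "CARD('d) = CARD('c) + 1"
    and simple: "\<And>a m k c.
      n < (a + 1) ^ 4 \<Longrightarrow> m < (a + 1) ^ 4 \<Longrightarrow> k < (a + 1) ^ 4 \<Longrightarrow>
      c \<in> exceptional_codes n m k Z \<Longrightarrow> card (exceptional_codes n m k Z) * (a + 1) ^ 12 \<le> 2 ^ (a ^ 2) \<Longrightarrow>
      norm (grid_point (mesh CARD('d) n) c - e) < (1/2) ^ n \<Longrightarrow> real \<kappa> \<le> r + real a + 1 + real a ^ 2"
    and \<kappa>: "D * real n - \<epsilon> * real n \<le> real \<kappa>"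
    and fin: "finite Z" and ne: "Z \<noteq> {}" and box: "\<And>z i. z \<in> Z \<Longrightarrow> 0 \<le> z $ i \<and> z $ i \<le> 2 ^ n"
    and reg: "regular n t (2 powr (\<eta> * real n)) Z"
    and u: "u \<le> t" "u \<le> D" "0 \<le> u"
    and small: "0 < \<epsilon>" "0 < \<eta>" "\<eta> + 3 * \<epsilon> \<le> 1" and n: "1 \<le> n"
    and a: "r + real a + 1 + real a ^ 2 < D * real n - \<epsilon> * real n"
      "count_const CARD('d) * 3 ^ CARD('d) * 2 ^ (CARD('d) * (CARD('d) - 1)) * (real n + 1)
         * 2 powr (D * real n - 3 * \<epsilon> * real n) * (real a + 1) ^ 12 \<le> 2 ^ (a ^ 2)"
      "2 * (n + 1) * CARD('d) + n + 1 < (a + 1) ^ 4"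
    and e: "norm e = 1" and \<phi>: "perp_isometry e \<phi>" and m: "m \<le> n"
  shows "real (card {(z, z') \<in> Z \<times> Z. ancestor (n - m) (shadow n e \<phi> z) = ancestor (n - m) (shadow n e \<phi> z')})
    \<le> V * 2 powr (- u * real m) * (real (card Z))\<^sup>2"
proof (rule ccontr)
  let ?d = "CARD('d)"
  let ?P = "{(z, z') \<in> Z \<times> Z. ancestor (n - m) (shadow n e \<phi> z) = ancestor (n - m) (shadow n e \<phi> z')}"
  assume "\<not> ?thesis"
  then have big: "V * 2 powr (- u * real m) * (real (card Z))\<^sup>2 < real (card ?P)" by simp
  have cZ: "0 < real (card Z)" using fin ne by (simp add: card_gt_0_iff)
  \<comment> \<open>The margin \<open>3 * \<epsilon>\<close> makes the exceptional set smaller than a payload of \<open>(D - 2 * \<epsilon>) * n\<close> bits.\<close>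
  define x where "x = 2 powr ((\<eta> + 3 * \<epsilon>) * real n) * 2 powr (- u * real m) * (real (card Z))\<^sup>2"
  have x0: "0 < x" using cZ by (simp add: x_def)
  have "x \<le> 2 ^ n * 1 * (2 ^ ((n + 1) * ?d))\<^sup>2"
    unfolding x_def
  proof (intro mult_mono power_mono)
    have "2 powr ((\<eta> + 3 * \<epsilon>) * real n) \<le> 2 powr (real n)"
      using small mult_right_mono[of "\<eta> + 3 * \<epsilon>" 1 "real n"] by (intro powr_mono) auto
    then show "2 powr ((\<eta> + 3 * \<epsilon>) * real n) \<le> 2 ^ n" by (simp add: powr_realpow)
    show "2 powr (- u * real m) \<le> 1" using u powr_mono[of "- u * real m" 0 2] by simp
    have "real (card Z) \<le> real (2 ^ ((n + 1) * ?d))" by (rule of_nat_mono) (rule card_data[OF box])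
    then show "real (card Z) \<le> 2 ^ ((n + 1) * ?d)" by simp
  qed auto
  also have "\<dots> = 2 ^ (n + 2 * ((n + 1) * ?d))" by (simp only: power_add power_even_eq mult_1_right)
  finally obtain k where k: "k \<le> n + 2 * ((n + 1) * ?d)" "x \<le> 2 ^ k" "\<And>N :: nat. 2 * x < real N \<Longrightarrow> 2 ^ k \<le> N"
    using threshold_exponent[OF x0] by blast
  define H :: nat where "H = mesh ?d n"
  have H0: "0 < H" by (simp add: H_def mesh_def)
  define R where "R = tube_width ?d n m"
  define E where "E = exceptional_codes n m k Z"
  have diff: "\<bar>(z - z') $ i\<bar> \<le> 2 ^ n" if "z \<in> Z" "z' \<in> Z" for z z' i
    using box[OF that(1), of i] box[OF that(2), of i] by (simp add: abs_le_iff)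
  obtain c where c: "c < H ^ ?d" "shell H (grid_vec H c :: int ^ 'd)"
    "\<And>i. \<bar>real_of_int (grid_vec H c $ i) - real H * e $ i\<bar> \<le> 1"
    using approximating_grid_point[OF e H0] by blast
  have dc: "CARD('c) \<le> ?d" using card by simp
  have nH: "2 ^ n \<le> H" by (simp add: H_def mesh_def power_add)
  have "tube (int R) (z - z') (grid_vec H c)"
    if "z \<in> Z" "z' \<in> Z" "ancestor (n - m) (shadow n e \<phi> z) = ancestor (n - m) (shadow n e \<phi> z')" for z z'
    unfolding R_def tube_width_def H_def[symmetric] by (rule same_shadow_in_tube[OF e \<phi> dc m c(3) nH diff[OF that(1,2)] that(3)])
  then have "?P \<subseteq> tube_pairs R Z (grid_vec H c)" unfolding tube_pairs_def by blast
  then have "card ?P \<le> card (tube_pairs R Z (grid_vec H c))"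
    by (rule card_mono[rotated]) (rule finite_subset[of _ "Z \<times> Z"], use fin in \<open>auto simp: tube_pairs_def\<close>)
  then have "2 * x < real (card (tube_pairs R Z (grid_vec H c)))"
    using big by (simp add: x_def V_def mult.assoc)
  then have cE: "c \<in> E" using c k(3) by (simp add: E_def exceptional_codes_def H_def R_def)
  have cardE: "real (card E) * 2 ^ k \<le> count_const ?d * 3 ^ ?d * (real n + 1) * real H ^ (?d - 1) *
      2 powr (\<eta> * real n) * 2 powr (- u * real m) * (real (card Z))\<^sup>2"
    unfolding E_def H_def
    by (rule energy_average[OF n m fin _ reg u(1)]) (use diff u D_def in auto)
  also have "\<dots> = count_const ?d * 3 ^ ?d * 2 ^ (?d * (?d - 1)) * (real n + 1) * 2 powr (D * real n - 3 * \<epsilon> * real n) * x"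
  proof -
    have "real H ^ (?d - 1) = 2 ^ (?d * (?d - 1)) * 2 powr (D * real n)"
    proof -
      have "real H ^ (?d - 1) = 2 ^ (?d * (?d - 1)) * 2 ^ (n * (?d - 1))"
        by (simp add: H_def mesh_def power_add power_mult_distrib power_mult)
      moreover have "D * real n = real (n * (?d - 1))" using card by (simp add: D_def)
      ultimately show ?thesis by (simp add: powr_realpow del: of_nat_mult)
    qed
    moreover have "2 powr (D * real n) * 2 powr (\<eta> * real n) = 2 powr (D * real n - 3 * \<epsilon> * real n) * 2 powr ((\<eta> + 3 * \<epsilon>) * real n)"
      by (simp add: powr_add[symmetric] algebra_simps)
    ultimately show ?thesis unfolding x_def by (simp add: mult_ac)
  qed
  also have "\<dots> \<le> count_const ?d * 3 ^ ?d * 2 ^ (?d * (?d - 1)) * (real n + 1) * 2 powr (D * real n - 3 * \<epsilon> * real n) * 2 ^ k"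
    using k(2) by (intro mult_left_mono) (auto simp: count_const_def)
  finally have "real (card E) \<le> count_const ?d * 3 ^ ?d * 2 ^ (?d * (?d - 1)) * (real n + 1) * 2 powr (D * real n - 3 * \<epsilon> * real n)"
    by (rule mult_right_le_imp_le) simp
  then have "real (card E) * (real a + 1) ^ 12 \<le> 2 ^ (a ^ 2)"
    using a(2) by (meson mult_right_mono order_trans zero_le_power of_nat_0_le_iff add_nonneg_nonneg zero_le_one)
  then have "real (card E * (a + 1) ^ 12) \<le> real (2 ^ (a ^ 2))" by (simp add: add.commute)
  then have small_E: "card E * (a + 1) ^ 12 \<le> 2 ^ (a ^ 2)" by (simp only: of_nat_le_iff)
  have "norm (grid_point H c - e) \<le> (\<Sum>i\<in>UNIV. \<bar>(grid_point H c - e) $ i\<bar>)" by (rule norm_le_l1_cart)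
  also have "\<dots> \<le> (\<Sum>i\<in>(UNIV :: 'd set). 1 / real H)"
  proof (rule sum_mono)
    fix i
    have "(grid_point H c - e) $ i = (real_of_int (grid_vec H c $ i) - real H * e $ i) / real H"
      using H0 by (simp add: grid_point_def diff_divide_distrib)
    then show "\<bar>(grid_point H c - e) $ i\<bar> \<le> 1 / real H"
      using c(3)[of i] H0 by (simp add: abs_divide divide_right_mono)
  qed
  also have "\<dots> = real ?d / 2 ^ ?d * (1/2) ^ n" by (simp add: H_def mesh_def power_add power_one_over)
  also have "\<dots> < 1 * (1/2) ^ n"
  proof (rule mult_strict_right_mono)
    have "real ?d < real (2 ^ ?d)" by (simp only: of_nat_less_iff less_exp)
    then show "real ?d / 2 ^ ?d < 1" by simp
  qed simp
  finally have close: "norm (grid_point H c - e) < (1/2) ^ n" by simp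
  have "real \<kappa> \<le> r + real a + 1 + real a ^ 2"
    by (rule simple[of a m k c]) (use cE small_E close a(3) k(1) m in \<open>auto simp: E_def H_def algebra_simps\<close>)
  with a(1) \<kappa> show False by linarith
qed

lemma regular_singleton:
  assumes "0 \<le> u" "2 powr (u * real n) \<le> K"
  shows "regular n u K {y :: int ^ 'c::finite}"
  unfolding regular_def
proof (intro allI impI)
  fix m w assume m: "m \<le> n"
  have "card {y' \<in> {y}. ancestor (n - m) y' = w} \<le> card {y}" by (rule card_mono) auto
  then have "real (card {y' \<in> {y}. ancestor (n - m) y' = w}) \<le> 2 powr (u * real m) * 2 powr (- u * real m)"
    by (simp add: powr_add[symmetric])
  also have "\<dots> \<le> K * 2 powr (- u * real m)"
  proof (rule mult_right_mono)
    have "2 powr (u * real m) \<le> 2 powr (u * real n)"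
      using assms(1) m by (intro powr_mono mult_left_mono) auto
    then show "2 powr (u * real m) \<le> K" using assms(2) by linarith
  qed simp
  finally show "real (card {y' \<in> {y}. ancestor (n - m) y' = w}) \<le> K * 2 powr (- u * real m) * real (card {y})"
    by simp
qed

text \<open>
  If \<open>\<epsilon> + \<eta>\<close> is bounded below, the permitted loss exceeds \<open>2 powr (u n)\<close> and a single cube will do.
  This leaves the case of small parameters, in which all loss comes from the bound on the energy, a
  polynomial in \<open>n\<close> and the constant of the given family.
\<close>

lemma regular_shadow:
  fixes U \<Phi> :: tm and t :: real
  assumes card: "CARD('d::finite) = CARD('c::finite) + 1"
    and U: "universal_prefix_tm U" and \<Phi>: "valid_tm \<Phi>" and t: "t > 0"
  defines "D \<equiv> real CARD('d) - 1"
  defines "u \<equiv> min t D"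
  shows "\<exists>C>0. \<forall>\<epsilon>>0. \<forall>\<eta>>0. \<exists>N. \<forall>n\<ge>N. \<forall>A (zs :: (int ^ 'd) list) e (\<phi> :: real ^ 'd \<Rightarrow> real ^ 'c).
      set zs \<noteq> {} \<longrightarrow> regular n t (2 powr (\<eta> * real n)) (set zs) \<longrightarrow>
      (\<forall>Q\<in>dyadic_cube n ` set zs. Q \<subseteq> cbox 0 1) \<longrightarrow>
      tm_outputs \<Phi> A (enc_nat 1) (enc_list (enc_vec enc_int) zs) \<longrightarrow>
      norm e = 1 \<longrightarrow> real (kolm_prec U A n e) \<ge> D * real n - \<epsilon> * real n \<longrightarrow> perp_isometry e \<phi> \<longrightarrow>
      (\<exists>Y \<subseteq> shadow n e \<phi> ` set zs. Y \<noteq> {} \<and> regular n u (2 powr (real n * (C * (\<epsilon> + \<eta>)))) Y)"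
proof -
  let ?d = "CARD('d)"
  have D1: "1 \<le> D" using card by (simp add: D_def Suc_le_eq)
  have u: "u \<le> t" "u \<le> D" "0 \<le> u" using t D1 by (auto simp: u_def)
  define C where "C = 4 * real ?d + 8"
  obtain r0 :: nat where r0: "\<forall>A (zs :: (int ^ 'd) list) a n m k c x l.
    tm_outputs \<Phi> A (enc_nat 1) (enc_list (enc_vec enc_int) zs) \<longrightarrow>
    (\<forall>z\<in>set zs. \<forall>i. 0 \<le> z $ i) \<longrightarrow>
    n < (a + 1) ^ 4 \<longrightarrow> m < (a + 1) ^ 4 \<longrightarrow> k < (a + 1) ^ 4 \<longrightarrow>
    c \<in> exceptional_codes n m k (set zs) \<longrightarrow>
    card (exceptional_codes n m k (set zs)) * (a + 1) ^ 12 \<le> 2 ^ (a ^ 2) \<longrightarrow>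
    norm (grid_point (mesh ?d n) c - x) < (1/2) ^ l \<longrightarrow>
    kolm_prec U A l (x :: real ^ 'd) \<le> r0 + a + 1 + a ^ 2"
    using exceptional_directions_simple[OF U \<Phi>] by blast
  have "\<exists>N. \<forall>n\<ge>N. \<forall>A (zs :: (int ^ 'd) list) e (\<phi> :: real ^ 'd \<Rightarrow> real ^ 'c).
      set zs \<noteq> {} \<longrightarrow> regular n t (2 powr (\<eta> * real n)) (set zs) \<longrightarrow>
      (\<forall>Q\<in>dyadic_cube n ` set zs. Q \<subseteq> cbox 0 1) \<longrightarrow>
      tm_outputs \<Phi> A (enc_nat 1) (enc_list (enc_vec enc_int) zs) \<longrightarrow>
      norm e = 1 \<longrightarrow> real (kolm_prec U A n e) \<ge> D * real n - \<epsilon> * real n \<longrightarrow> perp_isometry e \<phi> \<longrightarrow>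
      (\<exists>Y \<subseteq> shadow n e \<phi> ` set zs. Y \<noteq> {} \<and> regular n u (2 powr (real n * (C * (\<epsilon> + \<eta>)))) Y)"
    if eps: "0 < \<epsilon>" "0 < \<eta>" for \<epsilon> \<eta> :: real
  proof (cases "\<epsilon> + \<eta> < 1/4")
    case False
    have "u \<le> C * (1/4)" using u(2) by (simp add: C_def D_def)
    also have "\<dots> \<le> C * (\<epsilon> + \<eta>)" using False by (intro mult_left_mono) (auto simp: C_def)
    finally have uC: "u \<le> C * (\<epsilon> + \<eta>)" .
    have one: "regular n u (2 powr (real n * (C * (\<epsilon> + \<eta>)))) {y}" for n and y :: "int ^ 'c"
      by (rule regular_singleton[OF u(3)])
        (use mult_right_mono[OF uC, of "real n"] in \<open>simp add: mult.commute\<close>)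
    show ?thesis
    proof (rule exI[of _ 0], intro allI impI)
      fix n and zs :: "(int ^ 'd) list" and e and \<phi> :: "real ^ 'd \<Rightarrow> real ^ 'c"
      assume "set zs \<noteq> {}"
      then obtain z where "z \<in> set zs" by (meson ex_in_conv)
      then show "\<exists>Y \<subseteq> shadow n e \<phi> ` set zs. Y \<noteq> {} \<and> regular n u (2 powr (real n * (C * (\<epsilon> + \<eta>)))) Y"
        using one by (intro exI[of _ "{shadow n e \<phi> z}"]) blast
    qed
  next
    case True
    then have small: "\<epsilon> < 1/4" "\<eta> + 3 * \<epsilon> \<le> 1" using eps by auto
    let ?K = "count_const ?d * 3 ^ ?d * 2 ^ (?d * (?d - 1))"
    from asymptotic_choice[OF eps(1) small(1) D1, of "real r0" ?K ?d]
    obtain N where N: "\<And>n. N \<le> n \<Longrightarrow> \<exists>a :: nat.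
      real r0 + real a + 1 + real a ^ 2 < D * real n - \<epsilon> * real n \<and>
      ?K * (real n + 1) * 2 powr (D * real n - 3 * \<epsilon> * real n) * (real a + 1) ^ 12 \<le> 2 ^ (a ^ 2) \<and>
      2 * (n + 1) * ?d + n + 1 < (a + 1) ^ 4 \<and>
      16 * (real n + 1) * ((real n + 1) * real ?d + 1) \<le> 2 powr (\<epsilon> * real n) \<and> 1 \<le> n"
      unfolding eventually_sequentially by blast
    show ?thesis
    proof (rule exI[of _ N], intro allI impI)
      fix n A and zs :: "(int ^ 'd) list" and e and \<phi> :: "real ^ 'd \<Rightarrow> real ^ 'c"
      assume "N \<le> n" and ne: "set zs \<noteq> {}"
        and reg: "regular n t (2 powr (\<eta> * real n)) (set zs)"
        and box: "\<forall>Q\<in>dyadic_cube n ` set zs. Q \<subseteq> cbox 0 1"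
        and run: "tm_outputs \<Phi> A (enc_nat 1) (enc_list (enc_vec enc_int) zs)"
        and e: "norm e = 1" and kol: "real (kolm_prec U A n e) \<ge> D * real n - \<epsilon> * real n"
        and \<phi>: "perp_isometry e \<phi>"
      from N[OF \<open>N \<le> n\<close>] obtain a :: nat where a:
        "real r0 + real a + 1 + real a ^ 2 < D * real n - \<epsilon> * real n"
        "?K * (real n + 1) * 2 powr (D * real n - 3 * \<epsilon> * real n) * (real a + 1) ^ 12 \<le> 2 ^ (a ^ 2)"
        "2 * (n + 1) * ?d + n + 1 < (a + 1) ^ 4"
        "16 * (real n + 1) * ((real n + 1) * real ?d + 1) \<le> 2 powr (\<epsilon> * real n)" "1 \<le> n" by blast
      note bounds = data_bounds[OF box]
      let ?V = "2 * 2 powr ((\<eta> + 3 * \<epsilon>) * real n)"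
      have pairs: "real (card {(z, z') \<in> set zs \<times> set zs. ancestor (n - m) (shadow n e \<phi> z) = ancestor (n - m) (shadow n e \<phi> z')})
         \<le> ?V * 2 powr (- u * real m) * (real (card (set zs)))\<^sup>2" if m: "m \<le> n" for m
      proof (rule projected_energy[OF card _ kol[unfolded D_def] finite_set ne _ reg u(1) u(2)[unfolded D_def] u(3)
            eps small(2) a(5) a(1)[unfolded D_def] a(2)[unfolded D_def] a(3) e \<phi> m])
        fix b m' k c
        assume "n < (b + 1) ^ 4" "m' < (b + 1) ^ 4" "k < (b + 1) ^ 4"
          "c \<in> exceptional_codes n m' k (set zs)" "card (exceptional_codes n m' k (set zs)) * (b + 1) ^ 12 \<le> 2 ^ (b ^ 2)"
          "norm (grid_point (mesh ?d n) c - e) < (1/2) ^ n"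
        with run bounds(1) r0[THEN spec, of A, THEN spec, of zs, THEN spec, of b, THEN spec, of n, THEN spec, of m',
            THEN spec, of k, THEN spec, of c, THEN spec, of e, THEN spec, of n]
        have "kolm_prec U A n e \<le> r0 + b + 1 + b ^ 2" by blast
        then show "real (kolm_prec U A n e) \<le> real r0 + real b + 1 + real b ^ 2"
          using of_nat_mono[of "kolm_prec U A n e" "r0 + b + 1 + b ^ 2", where 'a = real] by simp
      qed (use bounds in auto)
      let ?L = "(n + 1) * ?d + 1"
      have "card (set zs) \<le> 2 ^ ((n + 1) * ?d)" by (rule card_data) (use bounds in auto)
      then have L: "card (set zs) < 2 ^ ?L" by (simp add: le_less_trans)
      have V0: "0 < ?V" by simp
      let ?K = "8 * (real n + 1) * ?V * real ?L"
      obtain Y where Y: "Y \<subseteq> shadow n e \<phi> ` set zs" "Y \<noteq> {}" "regular n u ?K Y"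
        using regular_image[where g = "shadow n e \<phi>" and Z = "set zs", OF finite_set ne V0 L pairs] by blast
      have "?K = (16 * (real n + 1) * ((real n + 1) * real ?d + 1)) * 2 powr ((\<eta> + 3 * \<epsilon>) * real n)"
        by (simp add: algebra_simps)
      also have "\<dots> \<le> 2 powr (\<epsilon> * real n) * 2 powr ((\<eta> + 3 * \<epsilon>) * real n)"
        by (rule mult_right_mono[OF a(4)]) simp
      also have "\<dots> = 2 powr ((4 * \<epsilon> + \<eta>) * real n)" by (simp add: powr_add[symmetric] algebra_simps)
      also have "\<dots> \<le> 2 powr ((C * (\<epsilon> + \<eta>)) * real n)"
      proof (intro powr_mono mult_right_mono)
        have "4 * \<epsilon> + \<eta> \<le> 4 * (\<epsilon> + \<eta>)" using eps by simp
        also have "\<dots> \<le> C * (\<epsilon> + \<eta>)" using eps by (intro mult_right_mono) (auto simp: C_def)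
        finally show "4 * \<epsilon> + \<eta> \<le> C * (\<epsilon> + \<eta>)" .
      qed auto
      finally have "?K \<le> 2 powr (real n * (C * (\<epsilon> + \<eta>)))" by (simp add: mult.commute)
      from regular_mono[OF Y(3) this]
      show "\<exists>Y \<subseteq> shadow n e \<phi> ` set zs. Y \<noteq> {} \<and> regular n u (2 powr (real n * (C * (\<epsilon> + \<eta>)))) Y"
        using Y(1,2) by blast
    qed
  qed
  moreover have "0 < C" by (simp add: C_def)
  ultimately show ?thesis by blast
qed

theorem theorem3p4:
  fixes U \<Phi> :: tm and t :: real
  assumes "CARD('d::finite) = CARD('c::finite) + 1"
    and "universal_prefix_tm U"
    and "valid_tm \<Phi>"
    and "t > 0"
  shows "\<exists>C>0. \<exists>c>0. \<forall>\<epsilon>>0. \<forall>\<eta>>0. \<exists>N. \<forall>n\<ge>N. \<forall>\<delta>. \<delta> = (1/2 :: real) ^ n \<longrightarrow>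
    (\<forall>(P :: (real ^ 'd) set set) A.
      delta_family n t (\<delta> powr (- \<eta>)) P \<and> (\<forall>Q\<in>P. Q \<subseteq> cbox 0 1) \<and>
      computes_data \<Phi> A n P [t, \<epsilon>, \<eta>] \<longrightarrow>
      (\<forall>e \<in> sphere 0 1.
        real (kolm_prec U A n e) \<ge> (real CARD('d) - 1) * real n - \<epsilon> * real n \<longrightarrow>
        (\<forall>\<phi> :: real ^ 'd \<Rightarrow> real ^ 'c. perp_isometry e \<phi> \<longrightarrow>
          (\<exists>P\<^sub>2 \<subseteq> cover_cubes n (\<Union>Q\<in>P. \<phi> ` perp_proj e ` Q).
            delta_family n (min t (real CARD('d) - 1)) (\<delta> powr (- (C * (\<epsilon> + \<eta>)))) P\<^sub>2 \<and>
            real (card P\<^sub>2) \<ge> c * \<delta> powr (- min t (real CARD('d) - 1) + C * (\<epsilon> + \<eta>))))))"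
proof -
  let ?d = "CARD('d)"
  define D where "D = real ?d - 1"
  define u where "u = min t D"
  obtain C where C0: "0 < C" and C: "\<forall>\<epsilon>>0. \<forall>\<eta>>0. \<exists>N. \<forall>n\<ge>N. \<forall>A (zs :: (int ^ 'd) list) e (\<phi> :: real ^ 'd \<Rightarrow> real ^ 'c).
      set zs \<noteq> {} \<longrightarrow> regular n t (2 powr (\<eta> * real n)) (set zs) \<longrightarrow>
      (\<forall>Q\<in>dyadic_cube n ` set zs. Q \<subseteq> cbox 0 1) \<longrightarrow>
      tm_outputs \<Phi> A (enc_nat 1) (enc_list (enc_vec enc_int) zs) \<longrightarrow>
      norm e = 1 \<longrightarrow> real (kolm_prec U A n e) \<ge> D * real n - \<epsilon> * real n \<longrightarrow> perp_isometry e \<phi> \<longrightarrow>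
      (\<exists>Y \<subseteq> shadow n e \<phi> ` set zs. Y \<noteq> {} \<and> regular n u (2 powr (real n * (C * (\<epsilon> + \<eta>)))) Y)"
    using regular_shadow[where 'd = 'd and 'c = 'c, OF assms] unfolding u_def D_def by blast
  show ?thesis
  proof (rule exI[of _ C], rule conjI[OF C0], rule exI[of _ 1], intro conjI allI impI)
    fix \<epsilon> \<eta> :: real assume eps: "0 < \<epsilon>" "0 < \<eta>"
    from C[THEN spec, THEN mp, OF eps(1), THEN spec, THEN mp, OF eps(2)] obtain N where
      N: "\<forall>n\<ge>N. \<forall>A (zs :: (int ^ 'd) list) e (\<phi> :: real ^ 'd \<Rightarrow> real ^ 'c).
      set zs \<noteq> {} \<longrightarrow> regular n t (2 powr (\<eta> * real n)) (set zs) \<longrightarrow>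
      (\<forall>Q\<in>dyadic_cube n ` set zs. Q \<subseteq> cbox 0 1) \<longrightarrow>
      tm_outputs \<Phi> A (enc_nat 1) (enc_list (enc_vec enc_int) zs) \<longrightarrow>
      norm e = 1 \<longrightarrow> real (kolm_prec U A n e) \<ge> D * real n - \<epsilon> * real n \<longrightarrow> perp_isometry e \<phi> \<longrightarrow>
      (\<exists>Y \<subseteq> shadow n e \<phi> ` set zs. Y \<noteq> {} \<and> regular n u (2 powr (real n * (C * (\<epsilon> + \<eta>)))) Y)" ..
    show "\<exists>N. \<forall>n\<ge>N. \<forall>\<delta>. \<delta> = (1/2 :: real) ^ n \<longrightarrow>
    (\<forall>(P :: (real ^ 'd) set set) A.
      delta_family n t (\<delta> powr (- \<eta>)) P \<and> (\<forall>Q\<in>P. Q \<subseteq> cbox 0 1) \<and>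
      computes_data \<Phi> A n P [t, \<epsilon>, \<eta>] \<longrightarrow>
      (\<forall>e \<in> sphere 0 1.
        real (kolm_prec U A n e) \<ge> (real CARD('d) - 1) * real n - \<epsilon> * real n \<longrightarrow>
        (\<forall>\<phi> :: real ^ 'd \<Rightarrow> real ^ 'c. perp_isometry e \<phi> \<longrightarrow>
          (\<exists>P\<^sub>2 \<subseteq> cover_cubes n (\<Union>Q\<in>P. \<phi> ` perp_proj e ` Q).
            delta_family n (min t (real CARD('d) - 1)) (\<delta> powr (- (C * (\<epsilon> + \<eta>)))) P\<^sub>2 \<and>
            real (card P\<^sub>2) \<ge> 1 * \<delta> powr (- min t (real CARD('d) - 1) + C * (\<epsilon> + \<eta>))))))"
    proof (rule exI[of _ N], intro allI impI ballI, elim conjE)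
      fix n and \<delta> :: real and P :: "(real ^ 'd) set set" and A e and \<phi> :: "real ^ 'd \<Rightarrow> real ^ 'c"
      assume n: "N \<le> n" and \<delta>: "\<delta> = (1/2) ^ n" and e: "e \<in> sphere 0 1"
        and kol: "real (kolm_prec U A n e) \<ge> (real CARD('d) - 1) * real n - \<epsilon> * real n"
        and \<phi>: "perp_isometry e \<phi>"
        and fam: "delta_family n t (\<delta> powr (- \<eta>)) P" and box: "\<forall>Q\<in>P. Q \<subseteq> cbox 0 1"
        and data: "computes_data \<Phi> A n P [t, \<epsilon>, \<eta>]"
      from data obtain zs :: "(int ^ 'd) list" where zs: "dyadic_cube n ` set zs = P"
        "tm_outputs \<Phi> A (enc_nat 1) (enc_list (enc_vec enc_int) zs)" unfolding computes_data_def by blast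
      have \<delta>p: "\<delta> powr x = 2 powr (real n * (- x))" for x unfolding \<delta> half_power_powr by simp
      have "P \<noteq> {}" using fam by (auto simp: delta_family_def delta_set_def)
      then have ne: "set zs \<noteq> {}" using zs(1) by auto
      have reg: "regular n t (2 powr (\<eta> * real n)) (set zs)"
        using fam unfolding delta_family_iff[OF finite_set ne, symmetric] zs(1) \<delta>p by (simp add: mult.commute)
      have box': "\<forall>Q\<in>dyadic_cube n ` set zs. Q \<subseteq> cbox 0 1" using box unfolding zs(1) .
      have e1: "norm e = 1" using e by simp
      from N[THEN spec, THEN mp, OF n, THEN spec, THEN spec, THEN spec, THEN spec, THEN mp, OF ne, THEN mp, OF reg,
          THEN mp, OF box', THEN mp, OF zs(2), THEN mp, OF e1, THEN mp, OF kol[folded D_def], THEN mp, OF \<phi>]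
      obtain Y where Y: "Y \<subseteq> shadow n e \<phi> ` set zs" "Y \<noteq> {}"
        "regular n u (2 powr (real n * (C * (\<epsilon> + \<eta>)))) Y" by blast
      have finY: "finite Y" using Y(1) by (rule finite_subset) simp
      let ?P = "dyadic_cube n ` Y"
      have "?P \<subseteq> cover_cubes n (\<Union>Q\<in>P. \<phi> ` perp_proj e ` Q)"
      proof
        fix Q assume "Q \<in> ?P"
        then obtain z where z: "z \<in> set zs" "Q = dyadic_cube n (shadow n e \<phi> z)" using Y(1) by auto
        have "\<phi> (perp_proj e (corner n z)) \<in> Q" by (simp add: z(2) in_dyadic_cube shadow_def)
        moreover have "corner n z \<in> dyadic_cube n z" by (simp add: in_dyadic_cube cell_corner)
        moreover have "dyadic_cube n z \<in> P" using z(1) zs(1) by auto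
        ultimately show "Q \<in> cover_cubes n (\<Union>Q\<in>P. \<phi> ` perp_proj e ` Q)"
          using z(2) unfolding cover_cubes_def dyadic_cubes_def by blast
      qed
      moreover have "delta_family n (min t (real ?d - 1)) (\<delta> powr (- (C * (\<epsilon> + \<eta>)))) ?P"
        unfolding delta_family_iff[OF finY Y(2)] \<delta>p using Y(3) by (simp add: u_def D_def)
      moreover have "real (card ?P) \<ge> 1 * \<delta> powr (- min t (real ?d - 1) + C * (\<epsilon> + \<eta>))"
      proof -
        have cP: "card ?P = card Y" by (rule card_image) (rule inj_on_subset[OF inj_dyadic_cube], simp)
        have "2 powr (u * real n) * 2 powr (- (real n * (C * (\<epsilon> + \<eta>)))) \<le>
           (2 powr (real n * (C * (\<epsilon> + \<eta>))) * real (card Y)) * 2 powr (- (real n * (C * (\<epsilon> + \<eta>))))"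
          by (rule mult_right_mono[OF regular_card[OF Y(3,2)]]) simp
        also have "\<dots> = real (card Y)" by (simp add: powr_minus)
        also have "2 powr (u * real n) * 2 powr (- (real n * (C * (\<epsilon> + \<eta>)))) = \<delta> powr (- u + C * (\<epsilon> + \<eta>))"
          unfolding \<delta>p by (simp add: powr_add[symmetric] algebra_simps)
        finally show ?thesis unfolding cP by (simp add: u_def D_def)
      qed
      ultimately show "\<exists>P\<^sub>2 \<subseteq> cover_cubes n (\<Union>Q\<in>P. \<phi> ` perp_proj e ` Q).
            delta_family n (min t (real CARD('d) - 1)) (\<delta> powr (- (C * (\<epsilon> + \<eta>)))) P\<^sub>2 \<and>
            real (card P\<^sub>2) \<ge> 1 * \<delta> powr (- min t (real CARD('d) - 1) + C * (\<epsilon> + \<eta>))" by blast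
    qed
  qed simp
qed

end
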